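(* It is possible to check whether a sequence of $n$ elements is a permutation of another sequence of $n$ elements, with probability at least $1-\delta$ of detecting an incorrect result, in time $$O\!\left(\left(\frac{n}{pw} + \beta\right) \log\frac1\delta + \alpha \log p\right).$$
   Context: Distributed model: $p$ processing elements (PEs) connected by a network with full-duplex, single-ported communication; sending a message of $m$ bits takes time $\alpha+\beta m$; $\alpha,\beta$ are treated as variables in asymptotic analysis. Machine word size is $w$ bits; elements consist of a constant number of machine words. Each of the two sequences is distributed so that every PE holds $O(n/p)$ of its elements. Random hash functions are available. $\log=\log_2$. A checker always accepts when the second sequence is indeed a permutation of the first, and otherwise accepts with probability at most $\delta$.
   Formalization: Proved assuming w ≤ K·log(1/δ) for an arbitrary constant K (the O-constant may depend on K; for fixed δ and growing w the bound is below the time to read the input), α ≥ 1 in units of one instruction, and n, p, ⌈log(1/δ)⌉ < 2^w. *)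

theory Defs
  imports "HOL-Probability.Probability" "HOL-Library.Multiset"
begin

section \<open>Elements, distributed sequences, random hash functions\<close>

text \<open>Machine words of \<open>w\<close> bits are natural numbers below \<open>2 ^ w\<close>, because \<open>w\<close> is a parameter and
  not a type. An element consists of \<open>k\<close> machine words.\<close>

definition elements :: "nat \<Rightarrow> nat \<Rightarrow> nat list set" where
  "elements w k = {x. length x = k \<and> set x \<subseteq> {..<2 ^ w}}"

text \<open>PE \<open>i < p\<close> holds the elements \<open>loc i\<close>. Neither contiguity nor any order of the local parts is
  assumed. \<open>C\<close> is the constant hidden in ``every PE holds \<open>O(n/p)\<close> elements''.\<close>

definition well_distributed :: "real \<Rightarrow> nat \<Rightarrow> 'a list \<Rightarrow> (nat \<Rightarrow> 'a list) \<Rightarrow> bool" where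
  "well_distributed C p xs loc \<longleftrightarrow>
     mset xs = (\<Sum>i<p. mset (loc i)) \<and>
     (\<forall>i<p. real (length (loc i)) \<le> C * real (length xs) / real p)"

text \<open>A family of independent, uniformly random functions from elements to machine words: \<open>h (j, x)\<close>
  is the value of the \<open>j\<close>-th function on \<open>x\<close>. All PEs see the same family.\<close>

type_synonym hash = "nat \<times> nat list \<Rightarrow> nat"

definition random_hash :: "nat \<Rightarrow> nat \<Rightarrow> hash pmf" where
  "random_hash w k = Pi_pmf ({..<2 ^ w} \<times> elements w k) 0 (\<lambda>_. pmf_of_set {..<2 ^ w})"


section \<open>A single PE: a unit-cost word RAM\<close>

text \<open>The registers \<open>Rank\<close> to \<open>Len2\<close> initially hold the parameters, see \<open>init\<close> below. \<open>Dest\<close>,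
  \<open>Source\<close>, \<open>MsgLen\<close>, \<open>MsgBits\<close> describe communication requests, \<open>Done\<close> and \<open>Accept\<close> the end of the
  computation. The arrays \<open>In1 j\<close> and \<open>In2 j\<close> hold the \<open>j\<close>-th words of the local elements of the two
  sequences; \<open>Send\<close> and \<open>Recv\<close> are message buffers.\<close>

datatype reg = Rank | Procs | Total | WordSize | ErrBits | Len1 | Len2
  | Dest | Source | MsgLen | MsgBits | Done | Accept | Reg nat

datatype array = In1 nat | In2 nat | Send | Recv | Arr nat

record pe =
  regs :: "reg \<Rightarrow> nat"
  mem :: "array \<Rightarrow> nat \<Rightarrow> nat"

datatype binop = Add | Sub | Mul | Div | Mod | And | Or | Xor | Shl | Shr | Less | Equal

fun apply_op :: "nat \<Rightarrow> binop \<Rightarrow> nat \<Rightarrow> nat \<Rightarrow> nat" where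
  "apply_op w Add x y = (x + y) mod 2 ^ w"
| "apply_op w Sub x y = (x + 2 ^ w - y) mod 2 ^ w"
| "apply_op w Mul x y = (x * y) mod 2 ^ w"
| "apply_op w Div x y = x div y"
| "apply_op w Mod x y = x mod y"
| "apply_op w And x y = Bit_Operations.and x y"
| "apply_op w Or x y = Bit_Operations.or x y"
| "apply_op w Xor x y = Bit_Operations.xor x y"
| "apply_op w Shl x y = (x * 2 ^ y) mod 2 ^ w"
| "apply_op w Shr x y = x div 2 ^ y"
| "apply_op w Less x y = of_bool (x < y)"
| "apply_op w Equal x y = of_bool (x = y)"

datatype com =
    Skip
  | Const reg nat
  | Op binop reg reg reg
  | Load reg array reg
  | Store array reg reg
  | Hash reg reg "reg list"
  | Seq com com
  | Cond reg com com
  | Loop reg com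

definition set_reg :: "reg \<Rightarrow> nat \<Rightarrow> pe \<Rightarrow> pe" where
  "set_reg r x s = s\<lparr>regs := (regs s)(r := x)\<rparr>"

definition set_mem :: "array \<Rightarrow> nat \<Rightarrow> nat \<Rightarrow> pe \<Rightarrow> pe" where
  "set_mem A i x s = s\<lparr>mem := (mem s)(A := (mem s A)(i := x))\<rparr>"

text \<open>\<open>exec w h c s t s'\<close>: with word size \<open>w\<close> and hash functions \<open>h\<close>, the program \<open>c\<close> leads from \<open>s\<close>
  to \<open>s'\<close> in \<open>t\<close> time units.\<close>

inductive exec :: "nat \<Rightarrow> hash \<Rightarrow> com \<Rightarrow> pe \<Rightarrow> nat \<Rightarrow> pe \<Rightarrow> bool" for w h where
  Skip: "exec w h Skip s 1 s"
| Const: "exec w h (Const r x) s 1 (set_reg r (x mod 2 ^ w) s)"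
| Op: "exec w h (Op f r a b) s 1 (set_reg r (apply_op w f (regs s a) (regs s b)) s)"
| Load: "exec w h (Load r A i) s 1 (set_reg r (mem s A (regs s i)) s)"
| Store: "exec w h (Store A i a) s 1 (set_mem A (regs s i) (regs s a) s)"
| Hash: "exec w h (Hash r j as) s (1 + length as) (set_reg r (h (regs s j, map (regs s) as)) s)"
| Seq: "exec w h c1 s t1 s1 \<Longrightarrow> exec w h c2 s1 t2 s2 \<Longrightarrow> exec w h (Seq c1 c2) s (t1 + t2) s2"
| CondT: "regs s r \<noteq> 0 \<Longrightarrow> exec w h c1 s t s' \<Longrightarrow> exec w h (Cond r c1 c2) s (1 + t) s'"
| CondF: "regs s r = 0 \<Longrightarrow> exec w h c2 s t s' \<Longrightarrow> exec w h (Cond r c1 c2) s (1 + t) s'"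
| LoopT: "regs s r \<noteq> 0 \<Longrightarrow> exec w h c s t1 s1 \<Longrightarrow> exec w h (Loop r c) s1 t2 s2 \<Longrightarrow>
    exec w h (Loop r c) s (1 + t1 + t2) s2"
| LoopF: "regs s r = 0 \<Longrightarrow> exec w h (Loop r c) s 1 s"


section \<open>The network\<close>

text \<open>The PEs proceed in supersteps. In each of them every PE that is not done executes the program
  once (keeping its state from one superstep to the next) and may then, simultaneously, send one
  message and receive one message (full-duplex, single-ported). \<open>Dest = i + 1\<close> requests sending to
  PE \<open>i\<close>, \<open>Source = i + 1\<close> requests receiving from PE \<open>i\<close>, and \<open>0\<close> stands for no request. A message
  consists of the low \<open>MsgBits\<close> bits of each of the first \<open>MsgLen\<close> words of the buffer \<open>Send\<close>.\<close>

definition finished :: "pe \<Rightarrow> bool" where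
  "finished s \<longleftrightarrow> regs s Done \<noteq> 0"

definition sends_to :: "pe \<Rightarrow> nat \<Rightarrow> bool" where
  "sends_to s j \<longleftrightarrow> \<not> finished s \<and> regs s Dest = j + 1"

definition receives_from :: "pe \<Rightarrow> nat \<Rightarrow> bool" where
  "receives_from s i \<longleftrightarrow> \<not> finished s \<and> regs s Source = i + 1"

definition msg_bits :: "pe \<Rightarrow> nat" where
  "msg_bits s = regs s MsgLen * regs s MsgBits"

definition message :: "pe \<Rightarrow> nat \<Rightarrow> nat" where
  "message s x = (if x < regs s MsgLen then mem s Send x mod 2 ^ regs s MsgBits else 0)"

text \<open>Every send must be met by a receive and conversely, so that no information can be conveyed by
  the absence of a message.\<close>

definition matched :: "nat \<Rightarrow> (nat \<Rightarrow> pe) \<Rightarrow> bool" where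
  "matched p S \<longleftrightarrow>
     (\<forall>i<p. \<forall>j. sends_to (S i) j \<longrightarrow> j < p \<and> receives_from (S j) i) \<and>
     (\<forall>j<p. \<forall>i. receives_from (S j) i \<longrightarrow> i < p \<and> sends_to (S i) j)"

definition exchange :: "(nat \<Rightarrow> pe) \<Rightarrow> nat \<Rightarrow> pe" where
  "exchange S j =
     (if \<exists>i. receives_from (S j) i
      then (S j)\<lparr>mem := (mem (S j))(Recv := message (S (regs (S j) Source - 1)))\<rparr>
      else S j)"

definition exchange_time :: "real \<Rightarrow> real \<Rightarrow> nat \<Rightarrow> (nat \<Rightarrow> pe) \<Rightarrow> real" where
  "exchange_time \<alpha> \<beta> p S =
     (let I = {i. i < p \<and> (\<exists>j. sends_to (S i) j)}
      in if I = {} then 0 else Max ((\<lambda>i. \<alpha> + \<beta> * real (msg_bits (S i))) ` I))"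

definition local_phase :: "nat \<Rightarrow> hash \<Rightarrow> com \<Rightarrow> pe \<Rightarrow> nat \<Rightarrow> pe \<Rightarrow> bool" where
  "local_phase w h prog s t s' \<longleftrightarrow>
     (if finished s then t = 0 \<and> s' = s else exec w h prog s t s')"

text \<open>\<open>run w h prog \<alpha> \<beta> p S T S'\<close>: from the global state \<open>S\<close> all \<open>p\<close> PEs finish after time \<open>T\<close>, in the
  global state \<open>S'\<close>. A superstep costs the longest local computation plus the longest
  communication.\<close>

inductive run :: "nat \<Rightarrow> hash \<Rightarrow> com \<Rightarrow> real \<Rightarrow> real \<Rightarrow> nat \<Rightarrow>
    (nat \<Rightarrow> pe) \<Rightarrow> real \<Rightarrow> (nat \<Rightarrow> pe) \<Rightarrow> bool" for w h prog \<alpha> \<beta> p where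
  run_done: "(\<forall>i<p. finished (S i)) \<Longrightarrow> run w h prog \<alpha> \<beta> p S 0 S"
| run_step: "\<not> (\<forall>i<p. finished (S i)) \<Longrightarrow>
    (\<forall>i<p. local_phase w h prog (S i) (t i) (S1 i)) \<Longrightarrow>
    matched p S1 \<Longrightarrow>
    run w h prog \<alpha> \<beta> p (exchange S1) T S2 \<Longrightarrow>
    run w h prog \<alpha> \<beta> p S (real (Max (t ` {..<p})) + exchange_time \<alpha> \<beta> p S1 + T) S2"


section \<open>Checkers\<close>

text \<open>The failure probability \<open>\<delta>\<close> is made known to the program as \<open>\<lceil>log 2 (1/\<delta>)\<rceil>\<close>.\<close>

definition init :: "nat \<Rightarrow> nat \<Rightarrow> nat \<Rightarrow> real \<Rightarrow>
    (nat \<Rightarrow> nat list list) \<Rightarrow> (nat \<Rightarrow> nat list list) \<Rightarrow> nat \<Rightarrow> pe" where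
  "init w p n \<delta> la lb i =
     \<lparr>regs = (\<lambda>r. case r of
         Rank \<Rightarrow> i | Procs \<Rightarrow> p | Total \<Rightarrow> n | WordSize \<Rightarrow> w
       | ErrBits \<Rightarrow> nat \<lceil>log 2 (1 / \<delta>)\<rceil>
       | Len1 \<Rightarrow> length (la i) | Len2 \<Rightarrow> length (lb i) | _ \<Rightarrow> 0),
      mem = (\<lambda>A x. case A of
         In1 j \<Rightarrow> if x < length (la i) \<and> j < length (la i ! x) then la i ! x ! j else 0
       | In2 j \<Rightarrow> if x < length (lb i) \<and> j < length (lb i ! x) then lb i ! x ! j else 0
       | _ \<Rightarrow> 0)\<rparr>"

text \<open>The verdict is the one reached by PE \<open>0\<close>.\<close>

definition accepting :: "(nat \<Rightarrow> pe) \<Rightarrow> bool" where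
  "accepting S \<longleftrightarrow> regs (S 0) Accept \<noteq> 0"


subsection \<open>Runs are deterministic\<close>

inductive_cases exec_SkipE: "exec w h Skip s t s'"
inductive_cases exec_ConstE: "exec w h (Const r x) s t s'"
inductive_cases exec_OpE: "exec w h (Op f r a b) s t s'"
inductive_cases exec_LoadE: "exec w h (Load r A i) s t s'"
inductive_cases exec_StoreE: "exec w h (Store A i a) s t s'"
inductive_cases exec_HashE: "exec w h (Hash r j as) s t s'"
inductive_cases exec_SeqE: "exec w h (Seq c1 c2) s t s'"
inductive_cases exec_CondE: "exec w h (Cond r c1 c2) s t s'"
inductive_cases exec_LoopE: "exec w h (Loop r c) s t s'"

lemma exec_det:
  "exec w h c s t s' \<Longrightarrow> exec w h c s u s'' \<Longrightarrow> u = t \<and> s'' = s'"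
proof (induction arbitrary: u s'' rule: exec.induct)
  case (Skip s)
  then show ?case by (auto elim: exec_SkipE)
next
  case (Const r x s)
  then show ?case by (auto elim: exec_ConstE)
next
  case (Op f r a b s)
  then show ?case by (auto elim: exec_OpE)
next
  case (Load r A i s)
  then show ?case by (auto elim: exec_LoadE)
next
  case (Store A i a s)
  then show ?case by (auto elim: exec_StoreE)
next
  case (Hash r j as s)
  then show ?case by (auto elim: exec_HashE)
next
  case (Seq c1 s t1 s1 c2 t2 s2)
  from Seq.prems obtain u1 r1 u2 where
    "exec w h c1 s u1 r1" "exec w h c2 r1 u2 s''" "u = u1 + u2"
    by (rule exec_SeqE)
  then show ?case using Seq.IH(1)[of u1 r1] Seq.IH(2)[of u2 s''] by simp
next
  case (CondT s r c1 t s' c2)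
  from CondT.prems obtain u1 where "exec w h c1 s u1 s''" "u = 1 + u1"
    using CondT.hyps(1) by (elim exec_CondE) auto
  then show ?case using CondT.IH[of u1 s''] by simp
next
  case (CondF s r c2 t s' c1)
  from CondF.prems obtain u1 where "exec w h c2 s u1 s''" "u = 1 + u1"
    using CondF.hyps(1) by (elim exec_CondE) auto
  then show ?case using CondF.IH[of u1 s''] by simp
next
  case (LoopT s r c t1 s1 t2 s2)
  from LoopT.prems obtain u1 r1 u2 where
    "exec w h c s u1 r1" "exec w h (Loop r c) r1 u2 s''" "u = 1 + u1 + u2"
    by (rule exec_LoopE) (use LoopT.hyps(1) in auto)
  then show ?case using LoopT.IH(1)[of u1 r1] LoopT.IH(2)[of u2 s''] by simp
next
  case (LoopF s r c)
  from LoopF.prems show ?case by (rule exec_LoopE) (use LoopF.hyps in auto)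
qed

lemma exchange_cong:
  assumes "\<forall>i<p. R i = S i" "matched p S" "j < p"
  shows "exchange R j = exchange S j"
proof (cases "\<exists>i. receives_from (S j) i")
  case True
  then obtain i where i: "receives_from (S j) i" by blast
  then have "i < p" using assms(2,3) unfolding matched_def by blast
  then have "regs (S j) Source - 1 < p" using i by (simp add: receives_from_def)
  then have "R (regs (S j) Source - 1) = S (regs (S j) Source - 1)" "R j = S j"
    using assms(1,3) by blast+
  then show ?thesis by (simp only: exchange_def)
next
  case False
  then show ?thesis using assms(1,3) by (simp add: exchange_def)
qed

lemma exchange_time_cong:
  assumes "\<forall>i<p. R i = S i"
  shows "exchange_time \<alpha> \<beta> p R = exchange_time \<alpha> \<beta> p S"
proof -
  have "{i. i < p \<and> (\<exists>j. sends_to (R i) j)} = {i. i < p \<and> (\<exists>j. sends_to (S i) j)}"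
    using assms by auto
  moreover have "(\<lambda>i. \<alpha> + \<beta> * real (msg_bits (R i))) ` {i. i < p \<and> (\<exists>j. sends_to (S i) j)} =
      (\<lambda>i. \<alpha> + \<beta> * real (msg_bits (S i))) ` {i. i < p \<and> (\<exists>j. sends_to (S i) j)}"
    using assms by (intro image_cong) auto
  ultimately show ?thesis unfolding exchange_time_def Let_def by (simp only:)
qed

lemma run_det:
  assumes "run w h prog \<alpha> \<beta> p S T S'" "run w h prog \<alpha> \<beta> p R U R'" "\<forall>i<p. R i = S i"
  shows "U = T \<and> (\<forall>i<p. R' i = S' i)"
  using assms
proof (induction arbitrary: R U R' rule: run.induct)
  case (run_done S)
  from run_done.prems(1) show ?case
    by (cases rule: run.cases) (use run_done.hyps run_done.prems(2) in simp_all)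
next
  case A: (run_step S t S1 T S2)
  from A.prems(1) show ?case
  proof (cases rule: run.cases)
    case run_done
    then show ?thesis using A.hyps(1) A.prems(2) by simp
  next
    case B: (run_step u R1 V)
    have eq: "u i = t i \<and> R1 i = S1 i" if "i < p" for i
    proof -
      have "local_phase w h prog (S i) (t i) (S1 i)" "local_phase w h prog (S i) (u i) (R1 i)"
        using that A.hyps(2) B(3) A.prems(2) by simp_all
      then show ?thesis
        using exec_det[of w h prog "S i" "t i" "S1 i" "u i" "R1 i"]
        by (cases "finished (S i)") (simp_all add: local_phase_def)
    qed
    have "t ` {..<p} = u ` {..<p}" using eq by (intro image_cong) auto
    moreover have "exchange_time \<alpha> \<beta> p R1 = exchange_time \<alpha> \<beta> p S1"
      using eq by (intro exchange_time_cong) auto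
    moreover have "V = T \<and> (\<forall>i<p. R' i = S2 i)"
    proof (rule A.IH[OF B(5)], intro allI impI)
      fix i assume "i < p"
      then show "exchange R1 i = exchange S1 i"
        using eq A.hyps(3) by (intro exchange_cong) auto
    qed
    ultimately show ?thesis unfolding B(1) by metis
  qed
qed

end

theory Submission
  imports Defs "HOL-Library.Discrete_Functions"
begin

text \<open>
  Multisets \<open>A\<close> and \<open>B\<close> of size \<open>n\<close> are told apart by the integers \<open>\<Sum>x\<in>A. h x - \<Sum>x\<in>B. h x\<close>, for
  sufficiently many independent random hash functions \<open>h\<close>: if \<open>x\<close> has different multiplicities in \<open>A\<close>
  and \<open>B\<close>, then for fixed values of \<open>h\<close> elsewhere at most one value of \<open>h x\<close> makes the difference
  vanish. The sums must be taken in the integers and not modulo \<open>2 ^ w\<close>, because a difference of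
  multiplicities may share a large factor with \<open>2 ^ w\<close>. To stay in the natural numbers, an element of
  \<open>B\<close> contributes \<open>2 ^ (w - 1) - h x\<close>, so that \<open>A = B\<close> shows up as the total \<open>n * 2 ^ (w - 1)\<close>; hash
  values are halved so that all sums fit into two words.

  The local sums are added along a binary tree of PEs (PE \<open>v - 1\<close> is node \<open>v\<close>, with parent \<open>v div 2\<close>).
  The communication volume \<open>O(log (1/\<delta>))\<close> and \<open>O(log p)\<close> rounds are achieved together by
  pipelining: the sums are cut into about \<open>log p\<close> blocks of digits which are sent upwards least
  significant digit first. A node adds the digits received from its children to its own
  accumulator, sends the lowest digit and shifts the accumulator, so that the accumulator itself
  keeps the carry. The root compares the digits with those of the expected total.
\<close>

subsection \<open>A weakest-precondition calculus with time bounds\<close>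

text \<open>The run takes about \<open>2 * (D + NB)\<close> supersteps, where \<open>D\<close> is
  the depth of the tree and \<open>NB\<close> the number of blocks, and a superstep with
  communication costs \<alpha> plus \<beta> times the \<open>g * b\<close> bits of a block. The
  claimed time therefore demands \<open>NB = O(D + 1)\<close> together with
  \<open>(D + 1) * g * b = O(log (1 / \<delta>))\<close>. Two kinds of cutting achieve this. With
  many hash functions, digits are whole words and the functions are split into groups of about
  \<open>L / (D + 1)\<close>; with few of them, groups have bounded size and the sums are cut into
  digits of about \<open>err / (D + 1)\<close> bits. The main obstacle is that every counter,
  including the round number, must fit into \<open>w\<close> bits, and \<open>w\<close> may be as
  small as 1. Hence the many bounds by \<open>2 ^ w\<close> and the separate parameters for words of
  fewer than 8 bits. At least one hash function has to be evaluated on all local elements, which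
  costs on the order of \<open>n / p\<close>. The hypothesis
  \<open>real w \<le> K * log 2 (1 / \<delta>)\<close> is what lets the term
  \<open>n / (p * w) * log 2 (1 / \<delta>)\<close> pay for it.\<close>

definition wp :: "nat \<Rightarrow> hash \<Rightarrow> com \<Rightarrow> pe \<Rightarrow> nat \<Rightarrow> (pe \<Rightarrow> bool) \<Rightarrow> bool" where
  "wp w h c s B Q \<longleftrightarrow> (\<exists>t s'. exec w h c s t s' \<and> t \<le> B \<and> Q s')"

fun loop_free :: "com \<Rightarrow> bool" where
  "loop_free (Seq c1 c2) = (loop_free c1 \<and> loop_free c2)"
| "loop_free (Cond r c1 c2) = (loop_free c1 \<and> loop_free c2)"
| "loop_free (Loop r c) = False"
| "loop_free _ = True"

text \<open>Straight-line code is evaluated by the simplifier through this function. The clause for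
  \<open>Loop\<close> is a placeholder: \<open>exec_sem\<close> links \<open>sem\<close> to
  \<open>exec\<close> under \<open>loop_free\<close> alone.\<close>

fun sem :: "nat \<Rightarrow> hash \<Rightarrow> com \<Rightarrow> pe \<Rightarrow> pe" where
  "sem w h Skip s = s"
| "sem w h (Const r x) s = set_reg r (x mod 2 ^ w) s"
| "sem w h (Op f r a b) s = set_reg r (apply_op w f (regs s a) (regs s b)) s"
| "sem w h (Load r A i) s = set_reg r (mem s A (regs s i)) s"
| "sem w h (Store A i a) s = set_mem A (regs s i) (regs s a) s"
| "sem w h (Hash r j as) s = set_reg r (h (regs s j, map (regs s) as)) s"
| "sem w h (Seq c1 c2) s = sem w h c2 (sem w h c1 s)"
| "sem w h (Cond r c1 c2) s = (if regs s r \<noteq> 0 then sem w h c1 s else sem w h c2 s)"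
| "sem w h (Loop r c) s = s"

text \<open>Both branches of a conditional are charged, so that the bound depends on the code and
  not on the state.\<close>

fun cost :: "com \<Rightarrow> nat" where
  "cost (Hash r j as) = 1 + length as"
| "cost (Seq c1 c2) = cost c1 + cost c2"
| "cost (Cond r c1 c2) = 1 + (cost c1 + cost c2)"
| "cost _ = 1"

lemma exec_sem:
  assumes "loop_free c"
  shows "\<exists>t\<le>cost c. exec w h c s t (sem w h c s)"
  using assms
proof (induction c arbitrary: s)
  case (Seq c1 c2)
  then obtain t1 t2 where "t1 \<le> cost c1" "exec w h c1 s t1 (sem w h c1 s)"
    "t2 \<le> cost c2" "exec w h c2 (sem w h c1 s) t2 (sem w h c2 (sem w h c1 s))"
    by fastforce
  then show ?case by (intro exI[of _ "t1 + t2"]) (auto intro: exec.Seq)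
next
  case (Cond r c1 c2)
  obtain t1 where t1: "t1 \<le> cost c1" "exec w h c1 s t1 (sem w h c1 s)"
    using Cond by fastforce
  obtain t2 where t2: "t2 \<le> cost c2" "exec w h c2 s t2 (sem w h c2 s)"
    using Cond by fastforce
  show ?case
  proof (cases "regs s r = 0")
    case True
    then show ?thesis using t2 exec.CondF[OF True t2(2)] by (intro exI[of _ "1 + t2"]) auto
  next
    case False
    then show ?thesis using t1 exec.CondT[OF False t1(2)] by (intro exI[of _ "1 + t1"]) auto
  qed
qed (simp_all, (rule exI conjI order_refl exec.intros(1-6)[simplified])+)

lemma wp_sem: "loop_free c \<Longrightarrow> cost c \<le> B \<Longrightarrow> Q (sem w h c s) \<Longrightarrow> wp w h c s B Q"
  using exec_sem[of c w h s] unfolding wp_def by (meson le_trans)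

lemma wp_Seq: "wp w h c1 s B1 (\<lambda>s1. wp w h c2 s1 B2 Q) \<Longrightarrow> B1 + B2 \<le> B \<Longrightarrow> wp w h (Seq c1 c2) s B Q"
  unfolding wp_def by (meson exec.Seq add_mono le_trans)

lemma wp_Cond:
  assumes "regs s r \<noteq> 0 \<Longrightarrow> wp w h c1 s B Q" "regs s r = 0 \<Longrightarrow> wp w h c2 s B Q" "B < B'"
  shows "wp w h (Cond r c1 c2) s B' Q"
proof (cases "regs s r = 0")
  case True
  then obtain t s' where "exec w h c2 s t s'" "t \<le> B" "Q s'" using assms(2) by (auto simp: wp_def)
  then show ?thesis using assms(3) True exec.CondF[of s r w h c2 t s' c1]
    unfolding wp_def by (intro exI[of _ "1 + t"] exI[of _ s']) auto
next
  case False
  then obtain t s' where "exec w h c1 s t s'" "t \<le> B" "Q s'" using assms(1) by (auto simp: wp_def)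
  then show ?thesis using assms(3) False exec.CondT[of s r w h c1 t s' c2]
    unfolding wp_def by (intro exI[of _ "1 + t"] exI[of _ s']) auto
qed

lemma wp_mono: "wp w h c s B Q \<Longrightarrow> B \<le> B' \<Longrightarrow> (\<And>s'. Q s' \<Longrightarrow> Q' s') \<Longrightarrow> wp w h c s B' Q'"
  unfolding wp_def by (meson le_trans)

text \<open>The invariant is indexed by the number of completed iterations, which yields termination
  and the time bound at once. A fixed count \<open>N\<close> suffices because all loops of the
  program have an iteration count known in advance.\<close>

lemma wp_Loop:
  assumes "I 0 s"
    and step: "\<And>x s. x < N \<Longrightarrow> I x s \<Longrightarrow> regs s r \<noteq> 0 \<and> wp w h c s B (I (Suc x))"
    and stop: "\<And>s. I N s \<Longrightarrow> regs s r = 0"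
    and "N * (B + 1) + 1 \<le> B'"
  shows "wp w h (Loop r c) s B' (I N)"
proof -
  have "wp w h (Loop r c) s (y * (B + 1) + 1) (I N)" if "I x s" "x + y = N" for x y s
    using that
  proof (induction y arbitrary: x s)
    case 0
    then show ?case using stop exec.LoopF[of s r w h c] by (auto simp: wp_def intro!: exI[of _ s])
  next
    case (Suc y)
    then obtain t s1 where s1: "regs s r \<noteq> 0" "exec w h c s t s1" "t \<le> B" "I (Suc x) s1"
      using step[of x s] by (auto simp: wp_def)
    obtain t2 s2 where s2: "exec w h (Loop r c) s1 t2 s2" "t2 \<le> y * (B + 1) + 1" "I N s2"
      using Suc.IH[OF s1(4)] Suc.prems by (auto simp: wp_def)
    have "exec w h (Loop r c) s (1 + t + t2) s2"
      by (rule exec.LoopT) (use s1 s2 in auto)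
    moreover have "1 + t + t2 \<le> Suc y * (B + 1) + 1" using s1(3) s2(2) by simp
    ultimately show ?case using s2(3) unfolding wp_def by blast
  qed
  from this[OF assms(1), of N] show ?thesis
    by (rule wp_mono) (use assms(4) in auto)
qed

lemma regs_set_reg [simp]: "regs (set_reg r x s) = (regs s)(r := x)"
  and mem_set_reg [simp]: "mem (set_reg r x s) = mem s"
  and regs_set_mem [simp]: "regs (set_mem A i x s) = regs s"
  and mem_set_mem [simp]: "mem (set_mem A i x s) = (mem s)(A := (mem s A)(i := x))"
  by (simp_all add: set_reg_def set_mem_def)

definition For :: "reg \<Rightarrow> reg \<Rightarrow> reg \<Rightarrow> reg \<Rightarrow> com \<Rightarrow> com" where
  "For i n tmp one body = Seq (Const i 0) (Seq (Op Less tmp i n)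
     (Loop tmp (Seq body (Seq (Op Add i i one) (Op Less tmp i n)))))"

text \<open>The loop administration overwrites the counter and the test register, so the invariant
  must be insensitive to both (\<open>stable\<close>); the body has to preserve the counter. The
  bound \<open>N < 2 ^ w\<close> excludes wrap-around. Each iteration pays 3 beyond the body: test,
  increment, comparison.\<close>

lemma wp_For:
  assumes "I 0 s"
    and step: "\<And>x s. x < N \<Longrightarrow> I x s \<Longrightarrow> regs s i = x \<Longrightarrow>
      wp w h body s B (\<lambda>s'. I (Suc x) s' \<and> regs s' i = x)"
    and const: "\<And>x s. I x s \<Longrightarrow> regs s n = N \<and> regs s one = 1"
    and stable: "\<And>x s y. I x s \<Longrightarrow> I x (set_reg i y s) \<and> I x (set_reg tmp y s)"
    and "N < 2 ^ w" "i \<noteq> n" "i \<noteq> tmp" "tmp \<noteq> n" "i \<noteq> one" "tmp \<noteq> one"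
    and "N * (B + 3) + 3 \<le> B'"
  shows "wp w h (For i n tmp one body) s B' (I N)"
proof -
  let ?I = "\<lambda>x s. I x s \<and> regs s i = x \<and> regs s tmp = of_bool (x < N)"
  have loop: "wp w h (Loop tmp (Seq body (Seq (Op Add i i one) (Op Less tmp i n)))) s1 (N * (B + 3) + 1)
      (?I N)" if "?I 0 s1" for s1
  proof (rule wp_Loop[where B = "B + 2" and I = ?I, OF that])
    fix x s assume x: "x < N" and I: "?I x s"
    have "wp w h (Seq body (Seq (Op Add i i one) (Op Less tmp i n))) s (B + 2) (?I (Suc x))"
    proof (rule wp_Seq)
      show "wp w h body s B (\<lambda>s1. wp w h (Seq (Op Add i i one) (Op Less tmp i n)) s1 2 (?I (Suc x)))"
      proof (rule wp_mono[OF step[OF x]])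
        fix s1 assume s1: "I (Suc x) s1 \<and> regs s1 i = x"
        then have n: "regs s1 n = N" "regs s1 one = 1" using const by blast+
        have *: "I (Suc x) (set_reg tmp y (set_reg i z s1))" for y z
          using s1 stable by blast
        show "wp w h (Seq (Op Add i i one) (Op Less tmp i n)) s1 2 (?I (Suc x))"
          by (rule wp_sem) (use n s1 * x assms(5-10) in auto)
      qed (use I in auto)
    qed simp
    then show "regs s tmp \<noteq> 0 \<and> wp w h (Seq body (Seq (Op Add i i one) (Op Less tmp i n))) s (B + 2) (?I (Suc x))"
      using x I by simp
  qed (auto simp: algebra_simps)
  have n: "regs s n = N" using const assms(1) by blast
  show ?thesis unfolding For_def
    apply (rule wp_Seq[where ?B1.0 = 1 and ?B2.0 = "N * (B + 3) + 2"])
     apply (rule wp_sem; (simp; fail)?)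
     apply (rule wp_Seq[where ?B1.0 = 1 and ?B2.0 = "N * (B + 3) + 1"])
      apply (rule wp_sem; (simp; fail)?)
      apply (rule wp_mono[OF loop])
        apply (use n stable assms in auto)
    done
qed

fun writes :: "com \<Rightarrow> reg set" where
  "writes (Const r x) = {r}"
| "writes (Op f r a b) = {r}"
| "writes (Load r A i) = {r}"
| "writes (Hash r j as) = {r}"
| "writes (Seq c1 c2) = writes c1 \<union> writes c2"
| "writes (Cond r c1 c2) = writes c1 \<union> writes c2"
| "writes _ = {}"

lemma sem_writes: "r \<notin> writes c \<Longrightarrow> regs (sem w h c s) r = regs s r"
  by (induction c arbitrary: s) auto

fun stores :: "com \<Rightarrow> array set" where
  "stores (Store A i a) = {A}"
| "stores (Seq c1 c2) = stores c1 \<union> stores c2"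
| "stores (Cond r c1 c2) = stores c1 \<union> stores c2"
| "stores _ = {}"

lemma sem_stores: "stores c = {} \<Longrightarrow> mem (sem w h c s) = mem s"
  by (induction c arbitrary: s) auto

section \<open>Frame conditions for registers and arrays\<close>

definition scratch :: "reg \<Rightarrow> bool" where
  "scratch r \<longleftrightarrow> (\<exists>i\<ge>40. r = Reg i)"

lemma scratch_simps [simp]:
  "\<not> scratch Rank" "\<not> scratch Procs" "\<not> scratch Total" "\<not> scratch WordSize" "\<not> scratch ErrBits"
  "\<not> scratch Len1" "\<not> scratch Len2" "\<not> scratch Dest" "\<not> scratch Source" "\<not> scratch MsgLen"
  "\<not> scratch MsgBits" "\<not> scratch Done" "\<not> scratch Accept" "scratch (Reg i) \<longleftrightarrow> 40 \<le> i"
  by (auto simp: scratch_def)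

definition keep :: "array set \<Rightarrow> pe \<Rightarrow> pe \<Rightarrow> bool" where
  "keep As s s' \<longleftrightarrow> (\<forall>r. \<not> scratch r \<longrightarrow> regs s' r = regs s r) \<and> (\<forall>A. A \<notin> As \<longrightarrow> mem s' A = mem s A)"

lemma keep_refl [simp]: "keep As s s"
  by (simp add: keep_def)

lemma keep_set_reg [simp]: "scratch r \<Longrightarrow> keep As s (set_reg r x s') \<longleftrightarrow> keep As s s'"
  unfolding keep_def by (simp, metis)

lemma keep_set_mem [simp]: "A \<in> As \<Longrightarrow> keep As s (set_mem A i x s') \<longleftrightarrow> keep As s s'"
  unfolding keep_def by (simp, metis)

lemma keep_regs: "keep As s s' \<Longrightarrow> \<not> scratch r \<Longrightarrow> regs s' r = regs s r"
  by (simp add: keep_def)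

lemma keep_mem: "keep As s s' \<Longrightarrow> A \<notin> As \<Longrightarrow> mem s' A = mem s A"
  by (simp add: keep_def)

lemma keep_trans: "keep As s s' \<Longrightarrow> keep Bs s' s'' \<Longrightarrow> As \<union> Bs \<subseteq> Cs \<Longrightarrow> keep Cs s s''"
  unfolding keep_def by (metis UnCI subsetD)


subsection \<open>Double-word arithmetic\<close>

text \<open>The low words add up to less than \<open>2 * W\<close>, so the carry is 0 or 1, and it
  is 1 exactly if the wrapped sum has become smaller than the summand \<open>r\<close>. This is how
  \<open>add_word\<close> detects a carry without a flag.\<close>

lemma double_word_add:
  fixes V r W :: nat
  assumes "r < W" "V + r < W * W"
  shows "(V mod W + r) mod W = (V + r) mod W"
    and "(V div W + of_bool ((V + r) mod W < r)) mod W = (V + r) div W"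
proof -
  show "(V mod W + r) mod W = (V + r) mod W" by (simp add: mod_add_left_eq)
  have W: "W > 0" using assms by simp
  define a c where "a = V mod W" and "c = V div W"
  have V: "V = a + W * c" by (simp add: a_def c_def)
  have a: "a < W" using W by (simp add: a_def)
  have lt: "(V + r) div W < W" using assms(2) W by (simp add: less_mult_imp_div_less)
  have "(V + r) div W = c + (a + r) div W" 
    using W div_mult_self2[of W "a + r" c] by (simp add: V ac_simps)
  moreover have "(V + r) mod W = (a + r) mod W"
    using mod_mult_self2[of "a + r" W c] by (simp add: V ac_simps)
  moreover have "(a + r) div W = of_bool ((a + r) mod W < r)"
  proof (cases "a + r < W")
    case False
    then have "(a + r) mod W = a + r - W" "(a + r) div W = 1"
      using a assms(1) by (simp_all add: mod_if div_if)
    then show ?thesis using a False by simp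
  qed simp
  ultimately show "(V div W + of_bool ((V + r) mod W < r)) mod W = (V + r) div W"
    using lt by (simp add: c_def)
qed

text \<open>The low \<open>b\<close> bits of the high word move to the top of the low word by a left
  shift of \<open>w - b\<close>. What this shift loses is a multiple of \<open>2 ^ w\<close> and
  belongs to the new high word. For \<open>b = w\<close> the low word is simply replaced by the high
  one.\<close>

lemma double_word_shift:
  fixes V b w :: nat
  assumes "b \<le> w" "V < 2 ^ w * 2 ^ w"
  shows "(V mod 2 ^ w div 2 ^ b + (V div 2 ^ w * 2 ^ (w - b)) mod 2 ^ w) mod 2 ^ w = V div 2 ^ b mod 2 ^ w"
    and "V div 2 ^ w div 2 ^ b = V div 2 ^ b div 2 ^ w"
proof -
  define c where "c = w - b"
  have w: "w = b + c" using assms(1) by (simp add: c_def)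
  have "V div 2 ^ b = V mod 2 ^ w div 2 ^ b + V div 2 ^ w * 2 ^ c"
  proof -
    have "V = V mod 2 ^ w + 2 ^ b * (V div 2 ^ w * 2 ^ c)"
      using mod_mult_div_eq[of V "2 ^ w"] by (simp add: w power_add algebra_simps)
    then have "V div 2 ^ b = (V mod 2 ^ w + 2 ^ b * (V div 2 ^ w * 2 ^ c)) div 2 ^ b" by presburger
    also have "\<dots> = V mod 2 ^ w div 2 ^ b + V div 2 ^ w * 2 ^ c" by simp
    finally show ?thesis .
  qed
  then show "(V mod 2 ^ w div 2 ^ b + (V div 2 ^ w * 2 ^ (w - b)) mod 2 ^ w) mod 2 ^ w = V div 2 ^ b mod 2 ^ w"
    by (simp add: mod_simps c_def)
  show "V div 2 ^ w div 2 ^ b = V div 2 ^ b div 2 ^ w"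
    by (simp flip: div_mult2_eq add: mult.commute)
qed

text \<open>For \<open>b = w\<close> the power wraps to 0, and the convention
  \<open>x mod 0 = x\<close> happens to return the full word that is wanted. Full-word digits thus
  need no case distinction in \<open>pop_digit\<close>.\<close>

lemma mod_wrapped_power:
  fixes x :: nat
  assumes "b \<le> w" "x < 2 ^ w"
  shows "x mod (2 ^ b mod 2 ^ w) = x mod 2 ^ b"
  using assms by (cases "b = w") auto


subsection \<open>The program\<close>

text \<open>Registers \<open>Reg i\<close> with \<open>i \<ge> 40\<close> are scratch registers; the others keep their values from one superstep
  to the next. The accumulators are stored in \<open>Arr 0\<close> (low words) and \<open>Arr 4\<close> (high words), the expected
  totals in \<open>Arr 2\<close> and \<open>Arr 3\<close>.\<close>

fun block :: "com list \<Rightarrow> com" where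
  "block [] = Skip"
| "block (c # cs) = Seq c (block cs)"

abbreviation "rOne \<equiv> Reg 0"
abbreviation "rSh \<equiv> Reg 21"
abbreviation "rHashBits \<equiv> Reg 2"
abbreviation "rHalf \<equiv> Reg 3"
abbreviation "rD \<equiv> Reg 4"
abbreviation "rE \<equiv> Reg 5"
abbreviation "rQ \<equiv> Reg 6"
abbreviation "rNB \<equiv> Reg 7"
abbreviation "rJJ \<equiv> Reg 8"
abbreviation "rLeft \<equiv> Reg 9"
abbreviation "rRight \<equiv> Reg 10"
abbreviation "rDestA \<equiv> Reg 11"
abbreviation "rDestB \<equiv> Reg 12"
abbreviation "rPow \<equiv> Reg 13"
abbreviation "rWB \<equiv> Reg 14"
abbreviation "rEN \<equiv> Reg 15"
abbreviation "rDN \<equiv> Reg 16"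
abbreviation "rXlo \<equiv> Reg 17"
abbreviation "rXhi \<equiv> Reg 18"
abbreviation "rStarted \<equiv> Reg 19"
abbreviation "rV \<equiv> Reg 20"
abbreviation "rM \<equiv> Reg 30"
abbreviation "rPar \<equiv> Reg 31"
abbreviation "rOk \<equiv> Reg 32"
abbreviation "rSnd \<equiv> Reg 33"
abbreviation "rRcv \<equiv> Reg 34"
abbreviation "rLo \<equiv> Reg 40"
abbreviation "rHi \<equiv> Reg 41"
abbreviation "rH \<equiv> Reg 42"
abbreviation "rC \<equiv> Reg 43"
abbreviation "rX \<equiv> Reg 44"
abbreviation "rJ \<equiv> Reg 45"
abbreviation "rT1 \<equiv> Reg 46"
abbreviation "rT2 \<equiv> Reg 47"
abbreviation "rBase \<equiv> Reg 48"
abbreviation "rY \<equiv> Reg 49"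
abbreviation "rL \<equiv> Reg 50"
abbreviation "rD1 \<equiv> Reg 51"
abbreviation "rEl i \<equiv> Reg (100 + i)"

definition load_elem :: "(nat \<Rightarrow> array) \<Rightarrow> nat \<Rightarrow> com" where
  "load_elem A k = block (map (\<lambda>i. Load (rEl i) (A i) rX) [0..<k])"

definition add_word :: com where
  "add_word = block [Op Add rLo rLo rH, Op Less rC rLo rH, Op Add rHi rHi rC]"

definition hash_elem :: "nat \<Rightarrow> com" where
  "hash_elem k = block [Hash rH rJ (map (\<lambda>i. rEl i) [0..<k]), Op Shr rH rH rSh]"

definition accumulate :: "nat \<Rightarrow> com" where
  "accumulate k = For rJ rJJ rT2 rOne (block
     [block [Const rLo 0, Const rHi 0],
      For rX Len1 rT1 rOne (block [load_elem In1 k, block [hash_elem k, add_word]]),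
      For rX Len2 rT1 rOne (block [load_elem In2 k, block [hash_elem k, Op Sub rH rHalf rH, add_word]]),
      block [Store (Arr 0) rJ rLo, Store (Arr 4) rJ rHi, Store (Arr 2) rJ rXlo, Store (Arr 3) rJ rXhi]])"

definition add_received :: com where
  "add_received = For rX MsgLen rT1 rOne (block
     [Op Add rJ rBase rX, Load rH Recv rX, Load rLo (Arr 0) rJ, Load rHi (Arr 4) rJ, add_word,
      Store (Arr 0) rJ rLo, Store (Arr 4) rJ rHi])"

definition pop_digit :: "array \<Rightarrow> array \<Rightarrow> reg \<Rightarrow> com" where
  "pop_digit A B r = block
     [Load rLo A rJ, Load rHi B rJ, Op Mod r rLo rPow, Op Shr rLo rLo MsgBits, Op Shl rC rHi rWB,
      Op Add rLo rLo rC, Store A rJ rLo, Op Shr rHi rHi MsgBits, Store B rJ rHi]"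

definition emit :: com where
  "emit = For rX MsgLen rT1 rOne (block
     [Op Add rJ rBase rX, pop_digit (Arr 0) (Arr 4) rH, pop_digit (Arr 2) (Arr 3) rY,
      Store Send rX rH, Op Equal rC rH rY, Cond rC Skip (Const rOk 0)])"

abbreviation move :: "reg \<Rightarrow> reg \<Rightarrow> com" where
  "move r a \<equiv> Op Or r a a"

definition floor_log_com :: "reg \<Rightarrow> reg \<Rightarrow> com" where
  "floor_log_com r a = block
     [block [move rY a, Const r 0, Op Less rT1 rOne rY],
      Loop rT1 (block [Op Shr rY rY rOne, Op Add r r rOne, Op Less rT1 rOne rY])]"

text \<open>The expected total \<open>n * 2 ^ (w - 1)\<close> occupies two words: the low one is the
  wrapped left shift of \<open>n\<close>, the high one is \<open>n\<close> without its lowest bit.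
  \<open>rSh\<close> is both the shift that halves hash values and the truth value of
  \<open>1 < w\<close>, so that nothing is halved for one-bit words.\<close>

definition init_word :: com where
  "init_word = block
     [Const rOne 1, Op Less rSh rOne WordSize, Op Sub rHashBits WordSize rSh, Op Sub rY WordSize rOne,
      Op Shl rHalf rOne rY, Op Shl rXlo Total rY, Op Shr rXhi Total rOne, Op Add rV Rank rOne]"

text \<open>The shift by three tests \<open>w < 8\<close> in a way that is correct even if the word size is too small to
  represent the number \<open>8\<close>.\<close>

definition init_hashes :: com where
  "init_hashes = block
     [Op Sub rE rD rE, Op Add rD1 rD rOne,
      Op Sub rY ErrBits rOne, Op Div rY rY rHashBits, Op Add rL rY rOne,
      Const rT1 3, Op Shr rT1 WordSize rT1]"

definition init_digits :: com where
  "init_digits = block [Op Div rH ErrBits rD1, Op Less rC rH WordSize,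
     Cond rC (Op Add MsgBits rH rOne) (move MsgBits WordSize)]"

definition init_large :: com where
  "init_large = block [Op Div rH rY rD1, Op Add MsgLen rH rOne, init_digits,
     Op Sub rH WordSize rOne, Op Div rH rH MsgBits, Op Add rH rH rOne, Op Add rQ rH rH]"

definition init_small :: com where
  "init_small = block [move MsgLen rL, move MsgBits WordSize, Op Add rQ rOne rSh]"

definition init_params :: com where
  "init_params = block [init_hashes, Cond rT1 init_large init_small]"

definition init_derived :: com where
  "init_derived = block
     [Op Div rH rY MsgLen, Op Add rH rH rOne, Op Mul rNB rH rQ, Op Mul rJJ rH MsgLen,
      Op Shl rPow rOne MsgBits, Op Sub rWB WordSize MsgBits, Op Add rEN rE rNB, Op Add rDN rD rNB]"

text \<open>Nodes are numbered from 1 and \<open>Dest = i + 1\<close> addresses PE \<open>i\<close>,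
  so the node number of the parent is directly the value for \<open>Dest\<close>. The root obtains
  \<open>1 div 2 = 0\<close>, which stands for no request, and needs no special treatment.\<close>

definition init_parent :: com where
  "init_parent = block
     [Op Shr rY rV rOne, Op And rT1 rV rOne, Const rDestA 0, Const rDestB 0,
      Cond rT1 (move rDestB rY) (move rDestA rY)]"

text \<open>Whether \<open>2 * v\<close> is at most \<open>p\<close> is decided by comparing
  \<open>v\<close> with half of \<open>p\<close>, because \<open>2 * v\<close> itself might not fit
  into a word. \<open>init_right\<close> uses \<open>p - 1\<close> for the same test on
  \<open>2 * v + 1\<close>.\<close>

definition init_left :: com where
  "init_left = block
     [Op Shr rH Procs rOne, Op Less rC rH rV, Const rLeft 0, Cond rC Skip (Op Add rLeft rV rV)]"

definition init_right :: com where
  "init_right = block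
     [Op Sub rH Procs rOne, Op Shr rH rH rOne, Op Less rC rH rV, Const rRight 0,
      Cond rC Skip (block [Op Add rRight rV rV, Op Add rRight rRight rOne])]"

definition init_tree :: com where
  "init_tree = block [init_parent, init_left, init_right, Const rOk 1, Const rStarted 1]"

definition initialise :: "nat \<Rightarrow> com" where
  "initialise k = block
     [init_word, floor_log_com rD Procs, floor_log_com rE rV, init_params, init_derived, init_tree,
      accumulate k]"

text \<open>Time is counted in rounds \<open>m\<close> of two supersteps each. A node of height \<open>E\<close> receives the \<open>t\<close>-th blocks
  of its children in round \<open>E + t\<close> (left child in superstep A, right child in superstep B) and sends
  its own \<open>t\<close>-th block in round \<open>E + t + 1\<close>.\<close>

definition request :: "reg \<Rightarrow> reg \<Rightarrow> com" where
  "request d r = block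
     [Const rSnd 0, Const rRcv 0, Const Dest 0, Const Source 0,
      Op Less rC rE rM, Op Less rH rEN rM,
      Cond rC (Cond rH Skip (block [Const rSnd 1, move Dest d])) Skip,
      Op Less rC rM rE, Op Less rH rM rEN,
      Cond rC Skip (Cond rH (block [Const rRcv 1, move Source r]) Skip)]"

text \<open>A message arrives after the local computation of its superstep, so it is added one
  superstep later: the block of the right child, received in superstep B of the previous round, is
  added here just before the emission, and that of the left child in the following
  \<open>stepB\<close>. One buffer \<open>Recv\<close> is therefore enough. \<open>Send\<close>
  stays untouched until superstep B is over, when the odd nodes deliver their block.\<close>

definition stepA :: com where
  "stepA = block
     [request rDestA rLeft,
      Cond rSnd
        (block [block [Op Sub rBase rM rOne, Op Sub rBase rBase rE, Op Div rBase rBase rQ,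
                 Op Mul rBase rBase MsgLen],
                Cond rRight add_received Skip, emit])
        Skip,
      block [Op Equal rC rM rDN, Cond rC (block [move Accept rOk, Const Done 1]) Skip, Const rPar 1]]"

definition stepB :: com where
  "stepB = block
     [request rDestB rRight,
      Cond rRcv
        (block [block [Op Sub rBase rM rE, Op Div rBase rBase rQ, Op Mul rBase rBase MsgLen],
                Cond rLeft add_received Skip])
        Skip,
      block [Const rPar 0, Op Add rM rM rOne]]"

definition checker :: "nat \<Rightarrow> com" where
  "checker k = Seq (Cond rStarted Skip (initialise k)) (Cond rPar stepB stepA)"


subsection \<open>Parameters\<close>

locale params =
  fixes w p n err :: nat
  assumes w: "1 \<le> w" and p: "1 \<le> p" "p < 2 ^ w" and n: "1 \<le> n" "n < 2 ^ w"
    and err: "1 \<le> err" "err < 2 ^ w"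
begin

text \<open>There are \<open>J = G * g\<close> hash functions with \<open>hb\<close> useful bits each. They form \<open>G\<close> groups of \<open>g\<close>; block \<open>t\<close>
  consists of the digits number \<open>t mod q\<close> (of \<open>b\<close> bits each) of the \<open>g\<close> sums in group \<open>t div q\<close>. For small
  words there is a single group with full-word digits, since otherwise the number \<open>NB\<close> of blocks
  might not fit into a word.\<close>

definition "sh = (if 1 < w then 1 else 0 :: nat)"
definition "hb = w - sh"
definition "L = (err - 1) div hb + 1"
definition "D = floor_log p"
definition "g = (if w < 8 then L else (L - 1) div (D + 1) + 1)"
definition "b = (if w < 8 then w else if err div (D + 1) < w then err div (D + 1) + 1 else w)"
definition "q = (if w < 8 then 1 + sh else 2 * ((w - 1) div b + 1))"
definition "G = (L - 1) div g + 1"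
definition "NB = G * q"
definition "J = G * g"
definition "X = n * 2 ^ (w - 1)"

lemma hb: "1 \<le> hb" "w \<le> 2 * hb" "hb \<le> w"
  using w by (auto simp: hb_def sh_def)

text \<open>\<open>L\<close> is \<open>err / hb\<close> rounded up. The bound
  \<open>err \<le> hb * L\<close> serves the error probability, the converse estimate the running
  time.\<close>

lemma L: "1 \<le> L" "L \<le> err" "err \<le> hb * L" "L * hb \<le> err + hb"
proof -
  show "1 \<le> L" by (simp add: L_def)
  have "(err - 1) div hb \<le> err - 1" by simp
  then show "L \<le> err" using err unfolding L_def by linarith
  have "err - 1 < hb * ((err - 1) div hb + 1)" using hb(1) by (simp add: dividend_less_times_div)
  then show "err \<le> hb * L" by (simp add: L_def)
  have "(err - 1) div hb * hb \<le> err - 1" by simp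
  then show "L * hb \<le> err + hb" unfolding L_def add_mult_distrib by linarith
qed

lemma power_floor_log_le: "2 ^ D \<le> p"
  unfolding D_def using floor_log_exp2_le[of p] p by simp

lemma D: "D < w"
proof -
  have "(2::nat) ^ D < 2 ^ w" using power_floor_log_le p(2) by (rule le_less_trans)
  then show ?thesis by simp
qed

lemma g: "1 \<le> g" "g \<le> L"
proof -
  show "1 \<le> g" using L(1) by (simp add: g_def)
  have "(L - 1) div (D + 1) + 1 \<le> L" using L(1) div_le_dividend[of "L - 1" "D + 1"] by linarith
  then show "g \<le> L" by (simp add: g_def)
qed

lemma b: "1 \<le> b" "b \<le> w"
  using w by (auto simp: b_def)

lemma q: "1 \<le> q" by (auto simp: q_def)
lemma G: "1 \<le> G" by (simp add: G_def)

text \<open>The expression \<open>(a - 1) div m + 1\<close> is the quotient rounded up, in a form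
  that the program can evaluate without overflow of \<open>a + m - 1\<close>.\<close>

lemma ceil_div_bounds:
  fixes a m :: nat
  assumes "1 \<le> a" "1 \<le> m"
  shows "a \<le> ((a - 1) div m + 1) * m" "((a - 1) div m + 1) * m \<le> a + m - 1"
proof -
  have "a - 1 < m * ((a - 1) div m + 1)" using assms by (simp add: dividend_less_times_div)
  then show "a \<le> ((a - 1) div m + 1) * m" by (simp add: mult.commute)
  have "(a - 1) div m * m \<le> a - 1" by simp
  then show "((a - 1) div m + 1) * m \<le> a + m - 1" using assms unfolding add_mult_distrib by linarith
qed

lemma J: "L \<le> J" "J \<le> 2 * L"
  using ceil_div_bounds[OF L(1) g(1)] g unfolding J_def G_def by simp_all

lemma G_le: "G \<le> L" "8 \<le> w \<Longrightarrow> G \<le> D + 1" "w < 8 \<Longrightarrow> G = 1"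
proof -
  show "G \<le> L" using L(1) g(1) div_le_dividend[of "L - 1" g] unfolding G_def by linarith
  show "w < 8 \<Longrightarrow> G = 1" using L(1) by (simp add: G_def g_def)
  assume "8 \<le> w"
  then have "L \<le> g * (D + 1)" using ceil_div_bounds(1)[OF L(1), of "D + 1"] by (simp add: g_def)
  then have "L - 1 < (D + 1) * g" using L(1) by (simp add: mult.commute)
  then have "(L - 1) div g < D + 1" by (rule less_mult_imp_div_less)
  then show "G \<le> D + 1" by (simp add: G_def)
qed

text \<open>Rounding up to full groups may double the number of hash functions. For
  \<open>8 \<le> w\<close> there is room for this, since \<open>hb\<close> is at least 7 and
  \<open>L\<close> is about \<open>err / hb\<close>; for smaller words the single group gives
  \<open>J = L\<close>.\<close>

lemma J_less: "J < 2 ^ w"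
proof (cases "w < 8")
  case True
  then show ?thesis using L(2) err(2) G_le(3) by (simp add: J_def g_def)
next
  case False
  then have hb7: "hb = w - 1" by (simp add: hb_def sh_def)
  have "L * 7 \<le> L * hb" using False hb7 by (intro mult_le_mono2) linarith
  also have "\<dots> \<le> err + hb" by (rule L)
  also have "\<dots> \<le> err + w" using hb by simp
  also have "\<dots> < 2 * 2 ^ w" using err less_exp[of w] by linarith
  finally have "2 * L < 2 ^ w" by simp
  then show ?thesis using J by simp
qed

text \<open>This is \<open>NB = O(D + 1)\<close> for \<open>w = O(err)\<close>, multiplied out to
  avoid a division. If digits are full words, then \<open>q = 2\<close> and \<open>G\<close> is at
  most \<open>D + 1\<close>. Otherwise \<open>err \<le> b * (D + 1)\<close>, and it remains to bound
  \<open>G * (q * b)\<close>: the product \<open>q * b\<close> is at most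
  \<open>2 * w + 2 * b\<close>, while \<open>G * w\<close> and \<open>G * b\<close> are of the order
  of \<open>err + w\<close>.\<close>

lemma NB_le:
  shows "NB * err \<le> (D + 1) * (8 * err + 2 * w)"
proof (cases "w < 8")
  case True
  then have "NB \<le> 2" by (simp add: NB_def G_le q_def sh_def)
  then have "NB * err \<le> 8 * err" by simp
  also have "\<dots> \<le> (D + 1) * (8 * err + 2 * w)" by simp
  finally show ?thesis .
next
  case False
  show ?thesis
  proof (cases "err div (D + 1) < w")
    case F: False
    then have "b = w" by (simp add: b_def)
    then have "q = 2" using False by (simp add: q_def)
    then have "NB \<le> 2 * (D + 1)" using False G_le by (simp add: NB_def)
    then have "NB * err \<le> (D + 1) * (2 * err)" using mult_le_mono1[of NB "2 * (D + 1)" err] by (simp add: mult_ac)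
    also have "\<dots> \<le> (D + 1) * (8 * err + 2 * w)" by (intro mult_le_mono2) simp
    finally show ?thesis .
  next
    case T: True
    then have b': "b = err div (D + 1) + 1" using False by (simp add: b_def)
    have err_le: "err \<le> b * (D + 1)"
      using dividend_less_times_div[of "D + 1" err] by (simp add: b' mult.commute)
    have "(w - 1) div b * b \<le> w" by (metis div_times_less_eq_dividend diff_le_self le_trans)
    then have qb: "q * b \<le> 2 * w + 2 * b" using False by (simp add: q_def algebra_simps)
    have hbw: "hb = w - 1" using False by (simp add: hb_def sh_def)
    have Lw': "L * w \<le> 2 * err + w"
    proof -
      have "L * w = L * hb + L" using hbw False by (simp add: algebra_simps)
      also have "\<dots> \<le> err + hb + err" using L(2,4) by simp
      finally show ?thesis using hb(3) by simp
    qed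
    have "NB * err \<le> G * q * (b * (D + 1))" unfolding NB_def using err_le by simp
    also have "\<dots> = G * (D + 1) * (q * b)" by (simp only: mult_ac)
    also have "\<dots> \<le> G * (D + 1) * (2 * w + 2 * b)" using qb by simp
    also have "\<dots> = (D + 1) * (2 * (G * w) + 2 * (G * b))" by (simp add: algebra_simps)
    also have "\<dots> \<le> (D + 1) * (8 * err + 2 * w)"
    proof (intro mult_le_mono2)
      have 1: "G * w \<le> 2 * err + w" using Lw' G_le(1) mult_le_mono1 le_trans by blast
      have "G * b = G * (err div (D + 1)) + G" by (simp add: b')
      also have "G * (err div (D + 1)) \<le> (D + 1) * (err div (D + 1))"
        using G_le(2) False by (intro mult_le_mono1) simp
      also have "\<dots> \<le> err" by (rule times_div_less_eq_dividend)
      finally have 2: "G * b \<le> err + G" by simp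
      have 3: "G \<le> err" using G_le(1) L(2) by simp
      show "2 * (G * w) + 2 * (G * b) \<le> 8 * err + 2 * w"
        using 1 2 3 by linarith
    qed
    finally show ?thesis .
  qed
qed

text \<open>The threshold 8 for small words originates here: the inequality reads 200 < 256 for
  \<open>m = 8\<close> and fails for \<open>m = 7\<close>, where 161 exceeds 128.\<close>

lemma square_less_power: "8 \<le> (m::nat) \<Longrightarrow> 2 * m * m + 9 * m < 2 ^ m"
proof (induction m rule: dec_induct)
  case (step m)
  have "2 * Suc m * Suc m + 9 * Suc m = 2 * m * m + 9 * m + (4 * m + 11)" by (simp add: algebra_simps)
  also have "4 * m + 11 \<le> 2 * m * m + 9 * m" using step(1) by (simp add: trans_le_add2)
  finally show ?case using step by simp
qed simp

text \<open>The last round has number \<open>D + NB\<close>, so this is what keeps the round counter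
  from wrapping. For \<open>8 \<le> w\<close> the bound on \<open>NB * err\<close> and
  \<open>1 \<le> err\<close> make \<open>NB + D\<close> quadratic in \<open>w\<close>.\<close>

lemma NB_D_less: "NB + D < 2 ^ w"
proof (cases "w < 8")
  case True
  then have NB: "NB = 1 + sh" by (simp add: NB_def G_le q_def)
  have "w = 1 \<or> w = 2 \<or> 3 \<le> w" using w by linarith
  then show ?thesis
  proof (elim disjE)
    assume "3 \<le> w"
    then have "w + 2 < 2 ^ w"
    proof (induction w rule: dec_induct)
      case (step m)
      then show ?case by simp
    qed simp
    then show ?thesis using NB D by (simp add: sh_def)
  qed (use NB D sh_def in simp_all)
next
  case False
  have "NB * err \<le> (D + 1) * (8 * err + 2 * w)" by (rule NB_le)
  also have "\<dots> \<le> (D + 1) * ((8 + 2 * w) * err)"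
    using err(1) by (intro mult_le_mono2) (simp add: algebra_simps)
  also have "\<dots> = (D + 1) * (8 + 2 * w) * err" by (simp only: mult.assoc)
  finally have "NB \<le> (D + 1) * (8 + 2 * w)" using err(1) by simp
  also have "\<dots> \<le> w * (8 + 2 * w)" using D by (intro mult_le_mono1) simp
  finally have "NB + D < 2 * w * w + 9 * w" using D by (simp add: algebra_simps)
  then show ?thesis using square_less_power[of w] False by simp
qed

text \<open>The \<open>q\<close> digits of a sum have to cover the \<open>2 * w - 1\<close> bits of
  the expected total. The sums themselves may be up to twice as large;
  \<open>verdict_eq_sums\<close> shows that comparing the \<open>q\<close> digits is still
  conclusive.\<close>

lemma X_less: "X < 2 ^ (b * q)"
proof -
  have nX: "X < 2 ^ (w + (w - 1))" using n(2) by (simp add: X_def power_add)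
  show ?thesis
  proof (cases "w < 8")
    case True
    then have "w + (w - 1) \<le> b * q" using w by (auto simp: b_def q_def sh_def)
    with nX show ?thesis by (meson less_le_trans one_le_numeral power_increasing)
  next
    case False
    have "w \<le> ((w - 1) div b + 1) * b" using ceil_div_bounds(1)[OF w b(1)] .
    then have "w + (w - 1) \<le> b * q" using False by (simp add: q_def algebra_simps)
    with nX show ?thesis by (meson less_le_trans one_le_numeral power_increasing)
  qed
qed

lemma q_less: "q < 2 ^ w"
proof -
  have "q \<le> NB" using G by (simp add: NB_def)
  then show ?thesis using NB_D_less by simp
qed

end


subsection \<open>Local computations\<close>

lemma sem_block_append: "sem w h (block (xs @ ys)) s = sem w h (block ys) (sem w h (block xs) s)"
  by (induction xs arbitrary: s) auto

lemma loop_free_block: "loop_free (block cs) \<longleftrightarrow> (\<forall>c\<in>set cs. loop_free c)"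
  by (induction cs) auto

lemma cost_block: "cost (block cs) = sum_list (map cost cs) + 1"
  by (induction cs) auto

text \<open>The \<open>case\<close> expression inverts \<open>rEl\<close> and so recovers the word
  index from the register; under the guard no other register reaches it.\<close>

lemma load_elem:
  shows "loop_free (load_elem A k)" "cost (load_elem A k) = k + 1"
    "mem (sem w h (load_elem A k) s) = mem s"
    "regs (sem w h (load_elem A k) s) r =
       (if \<exists>i<k. r = rEl i then mem s (A (case r of Reg j \<Rightarrow> j - 100)) (regs s rX) else regs s r)"
proof -
  show "loop_free (load_elem A k)" by (simp add: load_elem_def loop_free_block)
  show "cost (load_elem A k) = k + 1" by (simp add: load_elem_def cost_block o_def sum_list_triv)
  show "mem (sem w h (load_elem A k) s) = mem s"
    by (induction k) (simp_all add: load_elem_def sem_block_append)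
  show "regs (sem w h (load_elem A k) s) r =
       (if \<exists>i<k. r = rEl i then mem s (A (case r of Reg j \<Rightarrow> j - 100)) (regs s rX) else regs s r)"
  proof (induction k arbitrary: r)
    case 0
    then show ?case by (simp add: load_elem_def)
  next
    case (Suc k)
    let ?s = "sem w h (load_elem A k) s"
    have s: "sem w h (load_elem A (Suc k)) s = set_reg (rEl k) (mem ?s (A k) (regs ?s rX)) ?s"
      by (simp add: load_elem_def sem_block_append)
    have "mem ?s = mem s" by (induction k) (simp_all add: load_elem_def sem_block_append)
    moreover have "regs ?s rX = regs s rX" using Suc[of rX] by simp
    ultimately show ?case using Suc[of r] unfolding s by (auto simp: less_Suc_eq)
  qed
qed

lemma load_elem_keep: "keep As s (sem w h (load_elem A k) s)"
  unfolding keep_def by (auto simp: load_elem)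

lemma sem_add_word:
  assumes "regs s rLo = V mod 2 ^ w" "regs s rHi = V div 2 ^ w" "regs s rH < 2 ^ w"
    "V + regs s rH < 2 ^ w * 2 ^ w"
  shows "sem w h add_word s = set_reg rHi ((V + regs s rH) div 2 ^ w)
    (set_reg rC (of_bool ((V + regs s rH) mod 2 ^ w < regs s rH)) (set_reg rLo ((V + regs s rH) mod 2 ^ w) s))"
  using double_word_add[OF assms(3,4)] assms(1,2) by (simp add: add_word_def)

locale hashed = params +
  fixes k :: nat and h :: hash
  assumes hash_less: "\<And>j x. j < 2 ^ w \<Longrightarrow> x \<in> elements w k \<Longrightarrow> h (j, x) < 2 ^ w"
begin

definition "hv j x = h (j, x) div 2 ^ sh"

text \<open>The bound is not strict because of \<open>w = 1\<close>: one-bit hash values are not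
  halved and may equal \<open>2 ^ (w - 1) = 1\<close>.\<close>

lemma hv_le: "j < 2 ^ w \<Longrightarrow> x \<in> elements w k \<Longrightarrow> hv j x \<le> 2 ^ (w - 1)"
proof (cases "1 < w")
  case True
  assume "j < 2 ^ w" "x \<in> elements w k"
  then have "h (j, x) < 2 ^ (w - 1) * 2" using hash_less[of j x] True by (simp flip: power_Suc2)
  then have "h (j, x) div 2 < 2 ^ (w - 1)" by (rule less_mult_imp_div_less)
  then show ?thesis using True by (simp add: hv_def sh_def)
next
  case False
  assume "j < 2 ^ w" "x \<in> elements w k"
  then have "h (j, x) < 2 ^ w" by (rule hash_less)
  moreover have "hv j x = h (j, x)" using False by (simp add: hv_def sh_def)
  moreover have "w = 1" using False w by simp
  ultimately show ?thesis by simp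
qed

lemma half_less: "(2::nat) ^ (w - 1) < 2 ^ w"
  using w by simp

definition "contrib neg j x = (if neg then 2 ^ (w - 1) - hv j x else hv j x)"

lemma contrib_less: "j < 2 ^ w \<Longrightarrow> x \<in> elements w k \<Longrightarrow> contrib neg j x < 2 ^ w"
  using le_less_trans[OF hv_le[of j x] half_less] less_imp_diff_less[OF half_less]
  by (simp add: contrib_def)

text \<open>One statement covers both sequences: \<open>neg\<close> selects the complemented
  contribution, and \<open>a\<close> is the total already accumulated, namely 0 for the first
  sequence and the sum of the first for the second.\<close>

lemma wp_side:
  assumes r: "regs s rOne = 1" "regs s rSh = sh" "regs s rHalf = 2 ^ (w - 1)" "regs s rJ = j"
      "regs s len = length xs" "regs s rLo = a mod 2 ^ w" "regs s rHi = a div 2 ^ w"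
    and len: "\<not> scratch len" "length xs < 2 ^ w"
    and xs: "set xs \<subseteq> elements w k" "\<And>x i. x < length xs \<Longrightarrow> i < k \<Longrightarrow> mem s (A i) x = xs ! x ! i"
    and j: "j < 2 ^ w"
    and a: "a + (\<Sum>x\<leftarrow>xs. contrib neg j x) < 2 ^ w * 2 ^ w"
    and cs: "cs = hash_elem k # (if neg then [Op Sub rH rHalf rH] else []) @ [add_word]"
  shows "wp w h (For rX len rT1 rOne (block [load_elem A k, block cs])) s (length xs * (2 * k + 20) + 3)
    (\<lambda>s'. keep {} s s' \<and> regs s' rJ = j \<and>
       regs s' rLo = (a + (\<Sum>x\<leftarrow>xs. contrib neg j x)) mod 2 ^ w \<and>
       regs s' rHi = (a + (\<Sum>x\<leftarrow>xs. contrib neg j x)) div 2 ^ w)"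
proof -
  let ?c = "contrib neg j"
  define part where "part x = a + (\<Sum>y\<leftarrow>take x xs. ?c y)" for x
  have part_Suc: "part (Suc x) = part x + ?c (xs ! x)" if "x < length xs" for x
    using that by (simp add: part_def take_Suc_conv_app_nth)
  have part_le: "part x \<le> a + (\<Sum>x\<leftarrow>xs. ?c x)" for x
  proof -
    have "(\<Sum>x\<leftarrow>xs. ?c x) = (\<Sum>y\<leftarrow>take x xs. ?c y) + (\<Sum>y\<leftarrow>drop x xs. ?c y)"
      by (metis append_take_drop_id map_append sum_list_append)
    then show ?thesis by (simp add: part_def)
  qed
  define I where "I x s' \<longleftrightarrow> keep {} s s' \<and> regs s' rJ = j \<and> regs s' rLo = part x mod 2 ^ w \<and>
    regs s' rHi = part x div 2 ^ w" for x s'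
  have "wp w h (For rX len rT1 rOne (block [load_elem A k, block cs])) s (length xs * (2 * k + 20) + 3)
      (I (length xs))"
  proof (rule wp_For[where B = "2 * k + 17"])
    show "I 0 s" using r by (simp add: I_def part_def)
  next
    fix x s1 assume x: "x < length xs" and I: "I x s1" and rX: "regs s1 rX = x"
    have K: "keep {} s s1" using I by (simp add: I_def)
    have m: "mem s1 = mem s" using K by (auto simp: keep_def)
    have R: "regs s1 rOne = 1" "regs s1 rSh = sh" "regs s1 rHalf = 2 ^ (w - 1)"
      "regs s1 rJ = j" "regs s1 rLo = part x mod 2 ^ w" "regs s1 rHi = part x div 2 ^ w"
      using keep_regs[OF K] r I by (simp_all add: I_def)
    define s2 where "s2 = sem w h (load_elem A k) s1"
    have s2K: "keep {} s1 s2" unfolding s2_def by (rule load_elem_keep)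
    have xel: "xs ! x \<in> elements w k" using x xs(1) by auto
    have el: "map (regs s2) (map rEl [0..<k]) = xs ! x"
    proof (rule nth_equalityI)
      show "length (map (regs s2) (map rEl [0..<k])) = length (xs ! x)"
        using xel by (simp add: elements_def)
      fix i assume "i < length (map (regs s2) (map rEl [0..<k]))"
      then have "i < k" by simp
      then show "map (regs s2) (map rEl [0..<k]) ! i = xs ! x ! i"
        using xs(2)[OF x] by (simp add: s2_def load_elem m rX)
    qed
    have R2: "regs s2 rX = x" "regs s2 rOne = 1" "regs s2 rSh = sh" "regs s2 rHalf = 2 ^ (w - 1)"
      "regs s2 rJ = j" "regs s2 rLo = part x mod 2 ^ w" "regs s2 rHi = part x div 2 ^ w"
      using R rX by (simp_all add: s2_def load_elem)
    have hv: "hv j (xs ! x) \<le> 2 ^ (w - 1)" using hv_le[OF j xel] .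
    have c: "?c (xs ! x) < 2 ^ w" using contrib_less[OF j xel] .
    have sub: "(2 ^ (w - 1) + 2 ^ w - hv j (xs ! x)) mod 2 ^ w = 2 ^ (w - 1) - hv j (xs ! x)"
    proof -
      have "2 ^ (w - 1) + 2 ^ w - hv j (xs ! x) = (2 ^ (w - 1) - hv j (xs ! x)) + 2 ^ w" using hv by simp
      also have "\<dots> mod 2 ^ w = 2 ^ (w - 1) - hv j (xs ! x)"
        using less_imp_diff_less[OF half_less] by simp
      finally show ?thesis .
    qed
    have lt: "part x + ?c (xs ! x) < 2 ^ w * 2 ^ w" using part_Suc[OF x] part_le[of "Suc x"] a by simp
    let ?s3 = "sem w h (block cs) s2"
    define s' where "s' = sem w h (block (hash_elem k # (if neg then [Op Sub rH rHalf rH] else []))) s2"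
    have s': "regs s' rH = ?c (xs ! x)" "regs s' rLo = part x mod 2 ^ w" "regs s' rHi = part x div 2 ^ w"
      "regs s' rJ = j" "regs s' rX = x"
      using R2 sub unfolding s'_def contrib_def hv_def
      by (cases neg; simp add: hash_elem_def el del: map_map)+
    have s3': "?s3 = sem w h add_word s'" by (simp add: cs s'_def sem_block_append)
    have s3: "regs ?s3 rLo = part (Suc x) mod 2 ^ w" "regs ?s3 rHi = part (Suc x) div 2 ^ w"
      "regs ?s3 rJ = j" "regs ?s3 rX = x"
      using sem_add_word[of s' "part x" w h] s' c lt unfolding s3' by (simp_all add: part_Suc[OF x])
    have "keep {} s2 ?s3"
      by (cases neg) (simp_all add: cs hash_elem_def add_word_def)
    then have "keep {} s ?s3" using K s2K keep_trans by blast
    then have post: "I (Suc x) ?s3 \<and> regs ?s3 rX = x" using s3 by (simp add: I_def)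
    show "wp w h (block [load_elem A k, block cs]) s1 (2 * k + 17) (\<lambda>s'. I (Suc x) s' \<and> regs s' rX = x)"
    proof (rule wp_sem)
      show "loop_free (block [load_elem A k, block cs])"
        by (simp add: load_elem cs hash_elem_def add_word_def)
      show "cost (block [load_elem A k, block cs]) \<le> 2 * k + 17"
        by (simp add: load_elem cs hash_elem_def add_word_def)
      show "I (Suc x) (sem w h (block [load_elem A k, block cs]) s1) \<and>
        regs (sem w h (block [load_elem A k, block cs]) s1) rX = x"
        using post by (simp add: s2_def)
    qed
  next
    fix x s1 assume "I x s1"
    then show "regs s1 len = length xs \<and> regs s1 rOne = 1"
      using r len(1) by (auto simp: I_def keep_def)
  qed (use len in \<open>auto simp: I_def\<close>)
  then show ?thesis by (rule wp_mono) (auto simp: I_def part_def)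
qed

definition "own xs ys j = (\<Sum>x\<leftarrow>xs. contrib False j x) + (\<Sum>y\<leftarrow>ys. contrib True j y)"

definition "stored s A B V \<longleftrightarrow> (\<forall>j<J. mem s A j = V j mod 2 ^ w \<and> mem s B j = V j div 2 ^ w)"

lemma wp_accumulate:
  assumes r: "regs s rOne = 1" "regs s rSh = sh" "regs s rHalf = 2 ^ (w - 1)" "regs s rJJ = J"
      "regs s Len1 = length xs" "regs s Len2 = length ys" "regs s rXlo = X mod 2 ^ w" "regs s rXhi = X div 2 ^ w"
    and len: "length xs < 2 ^ w" "length ys < 2 ^ w"
    and xs: "set xs \<subseteq> elements w k" "\<And>x i. x < length xs \<Longrightarrow> i < k \<Longrightarrow> mem s (In1 i) x = xs ! x ! i"
    and ys: "set ys \<subseteq> elements w k" "\<And>x i. x < length ys \<Longrightarrow> i < k \<Longrightarrow> mem s (In2 i) x = ys ! x ! i"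
    and small: "\<And>j. j < J \<Longrightarrow> own xs ys j < 2 ^ w * 2 ^ w"
  shows "wp w h (accumulate k) s (J * ((length xs + length ys) * (2 * k + 20) + 20) + 3)
    (\<lambda>s'. keep {Arr 0, Arr 4, Arr 2, Arr 3} s s' \<and> stored s' (Arr 0) (Arr 4) (own xs ys) \<and>
       stored s' (Arr 2) (Arr 3) (\<lambda>_. X))"
proof -
  let ?As = "{Arr 0, Arr 4, Arr 2, Arr 3}"
  let ?B1 = "length xs * (2 * k + 20) + 3" and ?B2 = "length ys * (2 * k + 20) + 3"
  define I where "I x s' \<longleftrightarrow> keep ?As s s' \<and> (\<forall>j<x. mem s' (Arr 0) j = own xs ys j mod 2 ^ w \<and>
    mem s' (Arr 4) j = own xs ys j div 2 ^ w \<and> mem s' (Arr 2) j = X mod 2 ^ w \<and>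
    mem s' (Arr 3) j = X div 2 ^ w)" for x s'
  have "wp w h (accumulate k) s (J * ((length xs + length ys) * (2 * k + 20) + 20) + 3) (I J)"
    unfolding accumulate_def
  proof (rule wp_For[where B = "?B1 + ?B2 + 11"])
    show "I 0 s" by (simp add: I_def)
  next
    fix j s1 assume j: "j < J" and I: "I j s1" and rJ: "regs s1 rJ = j"
    have K1: "keep ?As s s1" using I by (simp add: I_def)
    define s2 where "s2 = sem w h (block [Const rLo 0, Const rHi 0]) s1"
    have K2: "keep {} s1 s2" by (simp add: s2_def)
    have K: "keep ?As s s2" using keep_trans[OF K1 K2] by simp
    have j2: "j < 2 ^ w" using j J_less by simp
    let ?a = "\<Sum>x\<leftarrow>xs. contrib False j x"
    have own: "own xs ys j = ?a + (\<Sum>y\<leftarrow>ys. contrib True j y)" by (simp add: own_def)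
    have L1: "wp w h (For rX Len1 rT1 rOne (block [load_elem In1 k, block [hash_elem k, add_word]])) s2 ?B1
      (\<lambda>s'. keep {} s2 s' \<and> regs s' rJ = j \<and> regs s' rLo = (0 + ?a) mod 2 ^ w \<and>
         regs s' rHi = (0 + ?a) div 2 ^ w)"
    proof (rule wp_side)
      show "mem s2 (In1 i) x = xs ! x ! i" if "x < length xs" "i < k" for x i
        using xs(2)[OF that] keep_mem[OF K] by simp
      show "regs s2 rOne = 1" "regs s2 rSh = sh" "regs s2 rHalf = 2 ^ (w - 1)" "regs s2 Len1 = length xs"
        using r keep_regs[OF K] by simp_all
      show "regs s2 rJ = j" "regs s2 rLo = 0 mod 2 ^ w" "regs s2 rHi = 0 div 2 ^ w"
        using rJ by (simp_all add: s2_def)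
    qed (use len xs j2 own small[OF j] in simp_all)
    have L2: "wp w h (For rX Len2 rT1 rOne (block [load_elem In2 k, block [hash_elem k, Op Sub rH rHalf rH, add_word]])) s3 ?B2
      (\<lambda>s'. keep {} s3 s' \<and> regs s' rJ = j \<and> regs s' rLo = own xs ys j mod 2 ^ w \<and>
         regs s' rHi = own xs ys j div 2 ^ w)" (is "wp _ _ ?c2 _ _ ?Q2")
      if s3: "keep {} s2 s3 \<and> regs s3 rJ = j \<and> regs s3 rLo = (0 + ?a) mod 2 ^ w \<and>
         regs s3 rHi = (0 + ?a) div 2 ^ w" for s3
      unfolding own
    proof (rule wp_side)
      have K3: "keep ?As s s3" using s3 K keep_trans by blast
      show "mem s3 (In2 i) x = ys ! x ! i" if "x < length ys" "i < k" for x i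
        using ys(2)[OF that] keep_mem[OF K3] by simp
      show "regs s3 rOne = 1" "regs s3 rSh = sh" "regs s3 rHalf = 2 ^ (w - 1)" "regs s3 Len2 = length ys"
        using r keep_regs[OF K3] by simp_all
    qed (use s3 len ys j2 own small[OF j] in \<open>simp_all\<close>)
    let ?c4 = "block [Store (Arr 0) rJ rLo, Store (Arr 4) rJ rHi, Store (Arr 2) rJ rXlo, Store (Arr 3) rJ rXhi]"
    have L4: "I (Suc j) (sem w h ?c4 s4) \<and> regs (sem w h ?c4 s4) rJ = j"
      if K4: "keep {} s2 s4" and s4: "regs s4 rJ = j" "regs s4 rLo = own xs ys j mod 2 ^ w"
         "regs s4 rHi = own xs ys j div 2 ^ w" for s4
    proof -
      have K4': "keep ?As s s4" using K K4 keep_trans by blast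
      have "mem s4 = mem s1" using K4 by (auto simp: keep_def s2_def)
      then show ?thesis using I s4 K4' r keep_regs[OF K4'] by (auto simp: I_def less_Suc_eq)
    qed
    let ?Q = "\<lambda>s'. I (Suc j) s' \<and> regs s' rJ = j"
    have 4: "wp w h (block [?c4]) s4 6 ?Q" if "keep {} s2 s4 \<and> regs s4 rJ = j \<and>
       regs s4 rLo = own xs ys j mod 2 ^ w \<and> regs s4 rHi = own xs ys j div 2 ^ w" for s4
      by (rule wp_sem) (use L4[of s4] that in simp_all)
    have 3: "wp w h (block [?c2, ?c4]) s3 (?B2 + 6) ?Q" if s3: "keep {} s2 s3 \<and> regs s3 rJ = j \<and>
       regs s3 rLo = (0 + ?a) mod 2 ^ w \<and> regs s3 rHi = (0 + ?a) div 2 ^ w" for s3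
      unfolding block.simps(2)[of ?c2]
    proof (rule wp_Seq[where ?B1.0 = ?B2 and ?B2.0 = 6])
      show "wp w h ?c2 s3 ?B2 (\<lambda>s1. wp w h (block [?c4]) s1 6 ?Q)"
        by (rule wp_mono[OF L2[OF s3] order_refl], rule 4)
          (use s3 keep_trans[of "{}" s2 s3 "{}"] in blast)
    qed simp
    show "wp w h (block [block [Const rLo 0, Const rHi 0],
        For rX Len1 rT1 rOne (block [load_elem In1 k, block [hash_elem k, add_word]]), ?c2, ?c4]) s1
       (?B1 + ?B2 + 11) ?Q"
      unfolding block.simps(2)[of "block [Const rLo 0, Const rHi 0]"]
        block.simps(2)[of "For rX Len1 rT1 rOne (block [load_elem In1 k, block [hash_elem k, add_word]])"]
    proof (rule wp_Seq[where ?B1.0 = 3 and ?B2.0 = "?B1 + (?B2 + 6)"], rule wp_sem, simp, simp)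
      show "wp w h (Seq (For rX Len1 rT1 rOne (block [load_elem In1 k, block [hash_elem k, add_word]]))
         (block [?c2, ?c4])) (sem w h (block [Const rLo 0, Const rHi 0]) s1) (?B1 + (?B2 + 6)) ?Q"
        unfolding s2_def[symmetric]
        by (rule wp_Seq[OF _ order_refl], rule wp_mono[OF L1 order_refl]) (rule 3)
    qed simp
  next
    show "J * (?B1 + ?B2 + 11 + 3) + 3 \<le> J * ((length xs + length ys) * (2 * k + 20) + 20) + 3"
      by (simp add: algebra_simps)
  next
    fix x s1 assume "I x s1"
    then have "keep ?As s s1" by (simp add: I_def)
    then show "regs s1 rJJ = J \<and> regs s1 rOne = 1" using r by (auto simp: keep_def)
  qed (use J_less in \<open>auto simp: I_def\<close>)
  then show ?thesis by (rule wp_mono) (auto simp: I_def stored_def)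
qed

lemma wp_add_received:
  assumes r: "regs s rOne = 1" "regs s MsgLen = g" "regs s rBase = base"
    and base: "base + g \<le> J"
    and V: "stored s (Arr 0) (Arr 4) V"
    and R: "\<And>x. x < g \<Longrightarrow> mem s Recv x = R x" "\<And>x. x < g \<Longrightarrow> R x < 2 ^ w"
      "\<And>x. x < g \<Longrightarrow> V (base + x) + R x < 2 ^ w * 2 ^ w"
  shows "wp w h add_received s (g * 20 + 3) (\<lambda>s'. keep {Arr 0, Arr 4} s s' \<and> regs s' rBase = base \<and>
    stored s' (Arr 0) (Arr 4) (\<lambda>j. if base \<le> j \<and> j < base + g then V j + R (j - base) else V j))"
proof -
  define F where "F x j = (if base \<le> j \<and> j < base + x then V j + R (j - base) else V j)" for x j
  define I where "I x s' \<longleftrightarrow> keep {Arr 0, Arr 4} s s' \<and> regs s' rBase = base \<and>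
    stored s' (Arr 0) (Arr 4) (F x)" for x s'
  have g_less: "g < 2 ^ w" using base J_less by simp
  have "wp w h add_received s (g * 20 + 3) (I g)"
    unfolding add_received_def
  proof (rule wp_For[where B = 16])
    show "I 0 s" using V r by (simp add: I_def F_def stored_def)
  next
    fix x s1 assume x: "x < g" and I: "I x s1" and rX: "regs s1 rX = x"
    have K: "keep {Arr 0, Arr 4} s s1" and B: "regs s1 rBase = base"
      and H: "\<And>j. j < J \<Longrightarrow> mem s1 (Arr 0) j = F x j mod 2 ^ w \<and> mem s1 (Arr 4) j = F x j div 2 ^ w"
      using I by (auto simp: I_def stored_def)
    have j: "base + x < J" "(base + x) mod 2 ^ w = base + x" using x base J_less by simp_all
    have Fx: "F x (base + x) = V (base + x)" by (simp add: F_def)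
    have FS: "F (Suc x) j = (if j = base + x then V j + R x else F x j)" for j
      by (auto simp: F_def)
    have Rv: "mem s1 Recv x = R x" using keep_mem[OF K] R(1)[OF x] by simp
    have m: "mem s1 (Arr 0) (base + x) = V (base + x) mod 2 ^ w"
      "mem s1 (Arr 4) (base + x) = V (base + x) div 2 ^ w" using H[OF j(1)] Fx by simp_all
    define s2 where "s2 = sem w h (block [Op Add rJ rBase rX, Load rH Recv rX, Load rLo (Arr 0) rJ,
      Load rHi (Arr 4) rJ]) s1"
    have s2: "regs s2 rJ = base + x" "regs s2 rX = x" "regs s2 rBase = base" "regs s2 rH = R x"
      "regs s2 rLo = V (base + x) mod 2 ^ w" "regs s2 rHi = V (base + x) div 2 ^ w" "mem s2 = mem s1"
      by (simp_all add: s2_def rX j Rv m B)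
    have K2: "keep {Arr 0, Arr 4} s s2" using K by (simp add: s2_def)
    note aw = sem_add_word[OF s2(5,6), of h, unfolded s2(4), OF R(2,3)[OF x]]
    define s3 where "s3 = sem w h add_word s2"
    have s3: "regs s3 rJ = base + x" "regs s3 rX = x" "regs s3 rBase = base"
      "regs s3 rLo = (V (base + x) + R x) mod 2 ^ w" "regs s3 rHi = (V (base + x) + R x) div 2 ^ w"
      "mem s3 = mem s1"
      unfolding s3_def aw by (simp_all add: s2)
    have K3: "keep {Arr 0, Arr 4} s s3" unfolding s3_def aw by (simp add: K2)
    have sem: "sem w h (block [Op Add rJ rBase rX, Load rH Recv rX, Load rLo (Arr 0) rJ, Load rHi (Arr 4) rJ,
        add_word, Store (Arr 0) rJ rLo, Store (Arr 4) rJ rHi]) s1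
      = set_mem (Arr 4) (base + x) ((V (base + x) + R x) div 2 ^ w)
         (set_mem (Arr 0) (base + x) ((V (base + x) + R x) mod 2 ^ w) s3)"
      using s3 by (simp add: s3_def s2_def)
    show "wp w h (block [Op Add rJ rBase rX, Load rH Recv rX, Load rLo (Arr 0) rJ, Load rHi (Arr 4) rJ,
        add_word, Store (Arr 0) rJ rLo, Store (Arr 4) rJ rHi]) s1 16 (\<lambda>s'. I (Suc x) s' \<and> regs s' rX = x)"
      by (rule wp_sem, simp add: add_word_def, simp add: add_word_def, unfold sem)
        (use K3 H s3 in \<open>simp add: I_def stored_def FS\<close>)
  next
    fix x s1 assume "I x s1"
    then have "keep {Arr 0, Arr 4} s s1" by (simp add: I_def)
    then show "regs s1 MsgLen = g \<and> regs s1 rOne = 1" using r by (auto simp: keep_def)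
  qed (use g_less in \<open>auto simp: I_def stored_def\<close>)
  then show ?thesis by (rule wp_mono) (auto simp: I_def F_def[abs_def])
qed

text \<open>Besides arrays and scratch registers \<open>emit\<close> changes the persistent register
  \<open>rOk\<close>. The frame condition therefore compares the final state with \<open>s\<close>
  after \<open>rOk\<close> has been set to its final value.\<close>

lemma wp_emit:
  assumes r: "regs s rOne = 1" "regs s MsgLen = g" "regs s rBase = base" "regs s MsgBits = b"
      "regs s rPow = 2 ^ b mod 2 ^ w" "regs s rWB = w - b"
    and base: "base + g \<le> J"
    and V: "stored s (Arr 0) (Arr 4) V" "\<And>x. x < g \<Longrightarrow> V (base + x) < 2 ^ w * 2 ^ w"
    and U: "stored s (Arr 2) (Arr 3) U" "\<And>x. x < g \<Longrightarrow> U (base + x) < 2 ^ w * 2 ^ w"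
  shows "wp w h emit s (g * 35 + 3) (\<lambda>s'.
    keep {Arr 0, Arr 4, Arr 2, Arr 3, Send} (set_reg rOk (regs s' rOk) s) s' \<and>
    stored s' (Arr 0) (Arr 4) (\<lambda>j. if base \<le> j \<and> j < base + g then V j div 2 ^ b else V j) \<and>
    stored s' (Arr 2) (Arr 3) (\<lambda>j. if base \<le> j \<and> j < base + g then U j div 2 ^ b else U j) \<and>
    (\<forall>x<g. mem s' Send x = V (base + x) mod 2 ^ b) \<and>
    (regs s' rOk \<noteq> 0 \<longleftrightarrow> regs s rOk \<noteq> 0 \<and>
       (\<forall>x<g. V (base + x) mod 2 ^ b = U (base + x) mod 2 ^ b)))"
proof -
  let ?As = "{Arr 0, Arr 4, Arr 2, Arr 3, Send}"
  define F where "F V x j = (if base \<le> j \<and> j < base + x then V j div 2 ^ b else V j)"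
    for V :: "nat \<Rightarrow> nat" and x j
  define I where "I x s' \<longleftrightarrow> keep ?As (set_reg rOk (regs s' rOk) s) s' \<and> regs s' rBase = base \<and>
    stored s' (Arr 0) (Arr 4) (F V x) \<and> stored s' (Arr 2) (Arr 3) (F U x) \<and>
    (\<forall>y<x. mem s' Send y = V (base + y) mod 2 ^ b) \<and>
    (regs s' rOk \<noteq> 0 \<longleftrightarrow> regs s rOk \<noteq> 0 \<and>
       (\<forall>y<x. V (base + y) mod 2 ^ b = U (base + y) mod 2 ^ b))" for x s'
  have g_less: "g < 2 ^ w" using base J_less by simp
  have keepOk: "keep ?As (set_reg rOk y s) (set_reg rOk y s')" if "keep ?As (set_reg rOk z s) s'" for y z s'
    using that by (auto simp: keep_def)
  have "wp w h emit s (g * 35 + 3) (I g)"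
    unfolding emit_def
  proof (rule wp_For[where B = 31])
    show "I 0 s" using V(1) U(1) r by (auto simp: I_def F_def keep_def stored_def)
  next
    fix x s1 assume x: "x < g" and I: "I x s1" and rX: "regs s1 rX = x"
    have K: "keep ?As (set_reg rOk (regs s1 rOk) s) s1" and B: "regs s1 rBase = base"
      and HV: "\<And>j. j < J \<Longrightarrow> mem s1 (Arr 0) j = F V x j mod 2 ^ w \<and> mem s1 (Arr 4) j = F V x j div 2 ^ w"
      and HU: "\<And>j. j < J \<Longrightarrow> mem s1 (Arr 2) j = F U x j mod 2 ^ w \<and> mem s1 (Arr 3) j = F U x j div 2 ^ w"
      and S: "\<And>y. y < x \<Longrightarrow> mem s1 Send y = V (base + y) mod 2 ^ b"
      and ok: "regs s1 rOk \<noteq> 0 \<longleftrightarrow> regs s rOk \<noteq> 0 \<and>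
       (\<forall>y<x. V (base + y) mod 2 ^ b = U (base + y) mod 2 ^ b)"
      using I by (auto simp: I_def stored_def)
    have R: "regs s1 MsgBits = b" "regs s1 rPow = 2 ^ b mod 2 ^ w" "regs s1 rWB = w - b"
      using keep_regs[OF K] r by simp_all
    have j: "base + x < J" "(base + x) mod 2 ^ w = base + x" using x base J_less by simp_all
    have Fx: "F V x (base + x) = V (base + x)" for V by (simp add: F_def)
    have FS: "F V (Suc x) j = (if j = base + x then V j div 2 ^ b else F V x j)" for V j
      by (auto simp: F_def)
    have m: "mem s1 (Arr 0) (base + x) = V (base + x) mod 2 ^ w"
      "mem s1 (Arr 4) (base + x) = V (base + x) div 2 ^ w"
      "mem s1 (Arr 2) (base + x) = U (base + x) mod 2 ^ w"
      "mem s1 (Arr 3) (base + x) = U (base + x) div 2 ^ w" using HV[OF j(1)] HU[OF j(1)] Fx by simp_all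
    note sV = double_word_shift[OF b(2) V(2)[OF x]] and sU = double_word_shift[OF b(2) U(2)[OF x]]
    have md: "V mod 2 ^ w mod (2 ^ b mod 2 ^ w) = V mod 2 ^ b" for V :: nat
    proof -
      have "V mod 2 ^ w mod (2 ^ b mod 2 ^ w) = V mod 2 ^ w mod 2 ^ b"
        by (rule mod_wrapped_power) (use b in auto)
      also have "\<dots> = V mod 2 ^ b" using b by (simp add: mod_mod_cancel le_imp_power_dvd)
      finally show ?thesis .
    qed
    define c where "c = block [Op Add rJ rBase rX, pop_digit (Arr 0) (Arr 4) rH,
        pop_digit (Arr 2) (Arr 3) rY, Store Send rX rH, Op Equal rC rH rY]"
    define s2 where "s2 = sem w h c s1"
    have K2: "keep ?As (set_reg rOk (regs s1 rOk) s) s2"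
      using K by (simp add: s2_def c_def pop_digit_def)
    have s2: "regs s2 rX = x" "regs s2 rBase = base" "regs s2 rOk = regs s1 rOk"
      "regs s2 rC = of_bool (V (base + x) mod 2 ^ b = U (base + x) mod 2 ^ b)"
      "stored s2 (Arr 0) (Arr 4) (F V (Suc x))" "stored s2 (Arr 2) (Arr 3) (F U (Suc x))"
      "mem s2 Send = (mem s1 Send)(x := V (base + x) mod 2 ^ b)"
      using HV HU by (simp_all add: s2_def c_def pop_digit_def rX B j m R md sV sU FS stored_def)
    let ?c = "block [Op Add rJ rBase rX, pop_digit (Arr 0) (Arr 4) rH,
        pop_digit (Arr 2) (Arr 3) rY, Store Send rX rH, Op Equal rC rH rY, Cond rC Skip (Const rOk 0)]"
    have sem: "sem w h ?c s1 = (if V (base + x) mod 2 ^ b = U (base + x) mod 2 ^ b then s2 else set_reg rOk 0 s2)"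
      using s2(4) by (simp add: s2_def c_def)
    have post: "I (Suc x) (sem w h ?c s1) \<and> regs (sem w h ?c s1) rX = x"
      unfolding sem using s2 K2 keepOk[OF K2, of 0] S ok
      by (auto simp: I_def less_Suc_eq stored_def)
    show "wp w h ?c s1 31 (\<lambda>s'. I (Suc x) s' \<and> regs s' rX = x)"
      by (rule wp_sem, simp add: pop_digit_def, simp add: pop_digit_def, rule post)
  next
    fix x s1 assume "I x s1"
    then have "keep ?As (set_reg rOk (regs s1 rOk) s) s1" by (simp add: I_def)
    then show "regs s1 MsgLen = g \<and> regs s1 rOne = 1" using r by (auto simp: keep_def)
  qed (use g_less in \<open>auto simp: I_def stored_def\<close>)
  then show ?thesis by (rule wp_mono) (auto simp: I_def F_def[abs_def])
qed

end


subsection \<open>Initialisation\<close>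

lemma sub_wrap: "(y::nat) \<le> x \<Longrightarrow> x < 2 ^ w \<Longrightarrow> (x + 2 ^ w - y) mod 2 ^ w = x - y"
proof -
  assume "y \<le> x" "x < 2 ^ w"
  have "x + 2 ^ w - y = (x - y) + 2 ^ w" using \<open>y \<le> x\<close> by simp
  also have "\<dots> mod 2 ^ w = x - y" using \<open>x < 2 ^ w\<close> by simp
  finally show ?thesis .
qed

lemma wp_floor_log:
  assumes y: "regs s rOne = 1" "regs s a = y" "1 \<le> y" "y < 2 ^ w"
    and r: "r \<noteq> rY" "r \<noteq> rT1" "r \<noteq> rOne" "a \<noteq> rT1"
  shows "wp w h (floor_log_com r a) s (floor_log y * 5 + 6) (\<lambda>s'. regs s' r = floor_log y \<and>
     (\<forall>r'. r' \<notin> {r, rY, rT1} \<longrightarrow> regs s' r' = regs s r') \<and> mem s' = mem s)"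
proof -
  let ?N = "floor_log y"
  let ?c = "block [Op Shr rY rY rOne, Op Add r r rOne, Op Less rT1 rOne rY]"
  define I where "I x s' \<longleftrightarrow> regs s' rY = y div 2 ^ x \<and> regs s' r = x \<and>
    regs s' rT1 = of_bool (1 < y div 2 ^ x) \<and>
    (\<forall>r'. r' \<notin> {r, rY, rT1} \<longrightarrow> regs s' r' = regs s r') \<and> mem s' = mem s" for x and s' :: pe
  have N: "2 ^ ?N \<le> y" "y < 2 * 2 ^ ?N" using floor_log_exp2_le floor_log_exp2_gt y(3) by auto
  have Nw: "?N < 2 ^ w"
  proof -
    have "(2::nat) ^ ?N < 2 ^ w" using N(1) y(4) by (rule le_less_trans)
    then have "?N < w" by simp
    then show ?thesis using less_exp[of w] by linarith
  qed
  have loop: "wp w h (Loop rT1 ?c) s1 (?N * 5 + 1) (I ?N)" if "I 0 s1" for s1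
  proof (rule wp_Loop[where B = 4 and I = I, OF that])
    fix x s2 assume x: "x < ?N" and I: "I x s2"
    have "2 ^ Suc x \<le> y" using N(1) x by (meson Suc_leI le_trans one_le_numeral power_increasing)
    then have "2 \<le> y div 2 ^ x" by (simp add: less_eq_div_iff_mult_less_eq)
    then have "regs s2 rT1 \<noteq> 0" using I by (simp add: I_def)
    moreover have "wp w h ?c s2 4 (I (Suc x))"
    proof (rule wp_sem)
      have one: "regs s2 rOne = 1" using I r y(1) by (auto simp: I_def)
      show "I (Suc x) (sem w h ?c s2)"
        using I one r x Nw by (auto simp: I_def div_mult2_eq[symmetric] mult.commute)
    qed simp_all
    ultimately show "regs s2 rT1 \<noteq> 0 \<and> wp w h ?c s2 4 (I (Suc x))" by simp
  next
    fix s2 assume "I ?N s2"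
    moreover have "y div 2 ^ ?N < 2" using N(2) by (simp add: div_less_iff_less_mult)
    ultimately show "regs s2 rT1 = 0" by (simp add: I_def)
  qed simp
  have "wp w h (floor_log_com r a) s (?N * 5 + 6) (I ?N)"
    unfolding floor_log_com_def block.simps(2)[of "block [move rY a, Const r 0, Op Less rT1 rOne rY]"]
  proof (rule wp_Seq[where ?B1.0 = 4 and ?B2.0 = "?N * 5 + 2"])
    show "wp w h (block [move rY a, Const r 0, Op Less rT1 rOne rY]) s 4
       (\<lambda>s1. wp w h (block [Loop rT1 ?c]) s1 (?N * 5 + 2) (I ?N))"
    proof (rule wp_sem)
      let ?s1 = "sem w h (block [move rY a, Const r 0, Op Less rT1 rOne rY]) s"
      have "I 0 ?s1" using y r by (auto simp: I_def)
      then show "wp w h (block [Loop rT1 ?c]) ?s1 (?N * 5 + 2) (I ?N)"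
        unfolding block.simps(2)[of "Loop rT1 ?c"]
        by (intro wp_Seq[where ?B1.0 = "?N * 5 + 1" and ?B2.0 = 1] wp_mono[OF loop] wp_sem) auto
    qed simp_all
  qed simp
  then show ?thesis by (rule wp_mono) (auto simp: I_def)
qed

locale problem = hashed +
  fixes la lb :: "nat \<Rightarrow> nat list list" and \<delta> :: real
  assumes err_eq: "err = nat \<lceil>log 2 (1 / \<delta>)\<rceil>"
    and la: "\<And>i. i < p \<Longrightarrow> set (la i) \<subseteq> elements w k" "(\<Sum>i<p. length (la i)) = n"
    and lb: "\<And>i. i < p \<Longrightarrow> set (lb i) \<subseteq> elements w k" "(\<Sum>i<p. length (lb i)) = n"
begin

lemma length_less: "i < p \<Longrightarrow> length (la i) < 2 ^ w" "i < p \<Longrightarrow> length (lb i) < 2 ^ w"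
proof -
  assume i: "i < p"
  have "length (la i) \<le> (\<Sum>i<p. length (la i))" by (rule member_le_sum) (use i in auto)
  then show "length (la i) < 2 ^ w" using la(2) n(2) by simp
  have "length (lb i) \<le> (\<Sum>i<p. length (lb i))" by (rule member_le_sum) (use i in auto)
  then show "length (lb i) < 2 ^ w" using lb(2) n(2) by simp
qed

definition "share j v = own (la (v - 1)) (lb (v - 1)) j"

lemma contrib_sum_le:
  assumes "set xs \<subseteq> elements w k" "j < 2 ^ w"
  shows "(\<Sum>x\<leftarrow>xs. contrib neg j x) \<le> length xs * 2 ^ (w - 1)"
proof -
  have "(\<Sum>x\<leftarrow>xs. contrib neg j x) \<le> (\<Sum>x\<leftarrow>xs. 2 ^ (w - 1))"
    by (rule sum_list_mono) (use assms hv_le in \<open>auto simp: contrib_def\<close>)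
  then show ?thesis by (simp add: sum_list_triv)
qed

lemma share_sum_less:
  assumes "j < 2 ^ w"
  shows "(\<Sum>v=1..p. share j v) < 2 ^ w * 2 ^ w"
proof -
  have "(\<Sum>v=1..p. share j v) = (\<Sum>i<p. own (la i) (lb i) j)"
    by (rule sum.reindex_bij_witness[of _ Suc "\<lambda>v. v - 1"]) (auto simp: share_def)
  also have "\<dots> \<le> (\<Sum>i<p. (length (la i) + length (lb i)) * 2 ^ (w - 1))"
    using contrib_sum_le la(1) lb(1) assms
    by (intro sum_mono) (auto simp: own_def add_mult_distrib intro!: add_mono)
  also have "\<dots> = 2 * n * 2 ^ (w - 1)"
    by (simp flip: sum_distrib_right add: sum.distrib la lb mult_2)
  also have "\<dots> = n * 2 ^ w" using w by (cases w) auto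
  also have "\<dots> < 2 ^ w * 2 ^ w" using n(2) by simp
  finally show ?thesis .
qed

lemma own_less: "i < p \<Longrightarrow> j < 2 ^ w \<Longrightarrow> own (la i) (lb i) j < 2 ^ w * 2 ^ w"
proof -
  assume "i < p" "j < 2 ^ w"
  have "share j (Suc i) \<le> (\<Sum>v=1..p. share j v)" by (rule member_le_sum) (use \<open>i < p\<close> in auto)
  also note share_sum_less[OF \<open>j < 2 ^ w\<close>]
  finally show ?thesis by (simp add: share_def)
qed

text \<open>This is the height of the level of \<open>v\<close>, not of the subtree below
  \<open>v\<close>. Nodes of one level thus share a schedule even if the last level is incomplete,
  and a parent is always exactly one higher than each of its children.\<close>

definition "Ev v = D - floor_log v"
definition "left v = (if 2 * v \<le> p then 2 * v else 0)"
definition "right v = (if 2 * v + 1 \<le> p then 2 * v + 1 else 0)"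

definition "stat v s \<longleftrightarrow> regs s rOne = 1 \<and> regs s rE = Ev v \<and> regs s rQ = q \<and> regs s MsgLen = g \<and>
  regs s MsgBits = b \<and> regs s rLeft = left v \<and> regs s rRight = right v \<and>
  regs s rDestA = (if even v then v div 2 else 0) \<and> regs s rDestB = (if odd v then v div 2 else 0) \<and>
  regs s rPow = 2 ^ b mod 2 ^ w \<and> regs s rWB = w - b \<and> regs s rEN = Ev v + NB \<and>
  regs s rDN = D + NB \<and> regs s rStarted = 1"

lemma floor_log_le_D: "v \<le> p \<Longrightarrow> floor_log v \<le> D"
  unfolding D_def by (rule floor_log_le_iff)

lemma D_Suc_less: "D + 1 < 2 ^ w"
  using D less_exp[of w] by linarith

text \<open>For \<open>w = 1\<close> the constant 3 wraps to 1, and \<open>1 div 2 = 0\<close> still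
  gives the right answer; from \<open>w = 2\<close> on the constant is represented
  correctly.\<close>

lemma test_small: "(w div 2 ^ (3 mod 2 ^ w) = 0) \<longleftrightarrow> w < 8"
proof (cases "w = 1")
  case False
  then have "2 \<le> w" using w by simp
  then have "(2::nat) ^ 2 \<le> 2 ^ w" by (intro power_increasing) auto
  then have "(3::nat) mod 2 ^ w = 3" by simp
  moreover have "(w div 8 = 0) = (w < 8)" by presburger
  ultimately show ?thesis by simp
qed simp

lemma X_words: "n div 2 = X div 2 ^ w"
proof -
  have "(2::nat) ^ w = 2 ^ (w - 1) * 2" using w by (cases w) auto
  then show ?thesis by (simp add: X_def div_mult2_eq)
qed

lemma sem_init_word:
  assumes "regs s Rank = i" "i < p" "regs s WordSize = w" "regs s Total = n"
  shows "mem (sem w h init_word s) = mem s"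
    "\<And>r. \<not> scratch r \<Longrightarrow> r \<notin> {rOne, rSh, rHashBits, rHalf, rXlo, rXhi, rV} \<Longrightarrow>
       regs (sem w h init_word s) r = regs s r"
    "regs (sem w h init_word s) rOne = 1" "regs (sem w h init_word s) rSh = sh"
    "regs (sem w h init_word s) rHashBits = hb" "regs (sem w h init_word s) rHalf = 2 ^ (w - 1)"
    "regs (sem w h init_word s) rXlo = X mod 2 ^ w" "regs (sem w h init_word s) rXhi = X div 2 ^ w"
    "regs (sem w h init_word s) rV = Suc i"
proof -
  have w0: "0 < w" using w by simp
  have sw: "(w + 2 ^ w - sh) mod 2 ^ w = hb" "(w + 2 ^ w - Suc 0) mod 2 ^ w = w - Suc 0"
    using sub_wrap[of sh w w] sub_wrap[of 1 w w] w less_exp[of w] by (simp_all add: sh_def hb_def)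
  have half: "2 ^ (w - Suc 0) mod 2 ^ w = (2::nat) ^ (w - Suc 0)" using half_less by simp
  have v: "Suc i mod 2 ^ w = Suc i" using assms(2) p(2) by simp
  have sh': "of_bool (Suc 0 < w) = sh" by (simp add: sh_def)
  show "mem (sem w h init_word s) = mem s" by (rule sem_stores) (simp add: init_word_def)
  show "regs (sem w h init_word s) r = regs s r"
    if "\<not> scratch r" "r \<notin> {rOne, rSh, rHashBits, rHalf, rXlo, rXhi, rV}" for r
    using that by (intro sem_writes) (auto simp: init_word_def)
  show "regs (sem w h init_word s) rOne = 1" "regs (sem w h init_word s) rSh = sh"
    "regs (sem w h init_word s) rHashBits = hb" "regs (sem w h init_word s) rHalf = 2 ^ (w - 1)"
    "regs (sem w h init_word s) rXlo = X mod 2 ^ w" "regs (sem w h init_word s) rXhi = X div 2 ^ w"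
    "regs (sem w h init_word s) rV = Suc i"
    by (simp_all add: init_word_def assms w0 sw half v sh' X_words) (simp add: X_def)
qed

lemma sem_init_params:
  assumes "regs s rD = D" "regs s rE = floor_log v" "v \<le> p" "regs s rOne = 1" "regs s ErrBits = err"
    "regs s WordSize = w" "regs s rHashBits = hb" "regs s rSh = sh"
  shows "mem (sem w h init_params s) = mem s"
    "\<And>r. \<not> scratch r \<Longrightarrow> r \<notin> {rE, MsgLen, MsgBits, rQ} \<Longrightarrow> regs (sem w h init_params s) r = regs s r"
    "regs (sem w h init_params s) rY = L - 1"
    "regs (sem w h init_params s) rE = Ev v" "regs (sem w h init_params s) MsgLen = g"
    "regs (sem w h init_params s) MsgBits = b" "regs (sem w h init_params s) rQ = q"
proof -
  note defs = init_params_def init_hashes_def init_large_def init_small_def init_digits_def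
  show "mem (sem w h init_params s) = mem s" by (rule sem_stores) (simp add: defs)
  show "regs (sem w h init_params s) r = regs s r"
    if "\<not> scratch r" "r \<notin> {rE, MsgLen, MsgBits, rQ}" for r
    using that by (intro sem_writes) (auto simp: defs)
  have Dw: "D < 2 ^ w" "Suc D mod 2 ^ w = Suc D" using D_Suc_less by simp_all
  have E: "(D + 2 ^ w - floor_log v) mod 2 ^ w = Ev v"
    unfolding Ev_def by (rule sub_wrap) (use floor_log_le_D assms(3) Dw in auto)
  have er: "(err + 2 ^ w - Suc 0) mod 2 ^ w = err - Suc 0" using sub_wrap[of 1 err w] err by simp
  have wr: "(w + 2 ^ w - Suc 0) mod 2 ^ w = w - Suc 0" using sub_wrap[of 1 w w] w less_exp[of w] by simp
  have Lm: "(err - Suc 0) div hb = L - Suc 0" "Suc (L - Suc 0) = L" "L mod 2 ^ w = L"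
    using L(1,2) err by (auto simp: L_def)
  define s1 where "s1 = sem w h init_hashes s"
  have s1: "regs s1 rE = Ev v" "regs s1 rD1 = Suc D" "regs s1 rY = L - Suc 0" "regs s1 rL = L"
    "regs s1 rT1 = w div 2 ^ (3 mod 2 ^ w)"
    by (simp_all add: s1_def init_hashes_def assms E er Lm Dw)
  have s1': "regs s1 rOne = 1" "regs s1 ErrBits = err" "regs s1 WordSize = w" "regs s1 rSh = sh"
    unfolding s1_def by (subst sem_writes; simp add: init_hashes_def assms)+
  have ip: "sem w h init_params s = sem w h (Cond rT1 init_large init_small) s1"
    by (simp add: init_params_def s1_def)
  have keep1: "regs (sem w h init_params s) rY = regs s1 rY" "regs (sem w h init_params s) rE = regs s1 rE"
    unfolding ip
    by (rule sem_writes, simp add: init_large_def init_small_def init_digits_def)+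
  show "regs (sem w h init_params s) rY = L - 1" "regs (sem w h init_params s) rE = Ev v"
    by (simp_all add: keep1 s1)
  have "regs (sem w h init_params s) MsgLen = g \<and> regs (sem w h init_params s) MsgBits = b \<and>
    regs (sem w h init_params s) rQ = q"
  proof (cases "w < 8")
    case True
    have "Suc sh mod 2 ^ w = Suc sh" using q_less True by (simp add: q_def)
    moreover have "sem w h init_params s = sem w h init_small s1"
      using True test_small by (simp add: init_params_def s1_def[symmetric] s1)
    ultimately show ?thesis using True by (simp add: init_small_def s1 s1' g_def b_def q_def)
  next
    case False
    define y where "y = err div Suc D"
    have y: "Suc y mod 2 ^ w = Suc y" if "y < w"
      using less_exp[of w] that by (intro mod_less) linarith
    have bb: "b = (if y < w then Suc y else w)" using False by (simp add: b_def y_def)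
    have "Suc ((L - Suc 0) div Suc D) \<le> L"
      using L(1) div_le_dividend[of "L - Suc 0" "Suc D"] by linarith
    then have G0: "Suc ((L - Suc 0) div Suc D) mod 2 ^ w = g"
      using L(2) err(2) False by (simp add: g_def)
    have qq: "((w - Suc 0) div b + Suc 0) mod 2 ^ w = (w - Suc 0) div b + Suc 0"
      "((w - Suc 0) div b + Suc 0 + ((w - Suc 0) div b + Suc 0)) mod 2 ^ w = q"
      using q_less False by (simp_all add: q_def)
    define s2 where "s2 = set_reg MsgLen g (set_reg rH ((L - Suc 0) div Suc D) s1)"
    define s3 where "s3 = sem w h init_digits s2"
    have s3: "regs s3 MsgBits = b"
      by (simp add: s3_def init_digits_def s2_def s1 s1' y bb flip: y_def)
    have s3': "regs s3 MsgLen = g" "regs s3 rOne = 1" "regs s3 WordSize = w"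
      unfolding s3_def by (subst sem_writes; simp add: init_digits_def s2_def s1')+
    have "sem w h init_params s = sem w h init_large s1"
      using False test_small by (simp add: init_params_def s1_def[symmetric] s1)
    also have "\<dots> = sem w h (block [Op Sub rH WordSize rOne, Op Div rH rH MsgBits, Op Add rH rH rOne, Op Add rQ rH rH]) s3"
      by (simp add: init_large_def s3_def s2_def s1 s1' G0)
    finally show ?thesis by (simp add: s3 s3' wr qq del: add_Suc add_Suc_right)
  qed
  then show "regs (sem w h init_params s) MsgLen = g" "regs (sem w h init_params s) MsgBits = b"
    "regs (sem w h init_params s) rQ = q" by simp_all
qed

lemma sem_init_derived:
  assumes "regs s rD = D" "regs s rE = Ev v" "regs s rOne = 1" "regs s rY = L - 1"
    "regs s WordSize = w" "regs s MsgLen = g" "regs s MsgBits = b" "regs s rQ = q"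
  shows "mem (sem w h init_derived s) = mem s"
    "\<And>r. \<not> scratch r \<Longrightarrow> r \<notin> {rNB, rJJ, rPow, rWB, rEN, rDN} \<Longrightarrow> regs (sem w h init_derived s) r = regs s r"
    "regs (sem w h init_derived s) rJJ = J"
    "regs (sem w h init_derived s) rPow = 2 ^ b mod 2 ^ w" "regs (sem w h init_derived s) rWB = w - b"
    "regs (sem w h init_derived s) rEN = Ev v + NB" "regs (sem w h init_derived s) rDN = D + NB"
proof -
  show "mem (sem w h init_derived s) = mem s" by (rule sem_stores) (simp add: init_derived_def)
  show "regs (sem w h init_derived s) r = regs s r"
    if "\<not> scratch r" "r \<notin> {rNB, rJJ, rPow, rWB, rEN, rDN}" for r
    using that by (intro sem_writes) (auto simp: init_derived_def)
  have G: "Suc ((L - Suc 0) div g) mod 2 ^ w = G"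
  proof -
    have "G \<le> J" using g(1) by (simp add: J_def)
    then have "G < 2 ^ w" using J_less by simp
    then show ?thesis by (simp add: G_def)
  qed
  have m: "G * q mod 2 ^ w = NB" "G * g mod 2 ^ w = J" "(w + 2 ^ w - b) mod 2 ^ w = w - b"
    "(Ev v + NB) mod 2 ^ w = Ev v + NB" "(D + NB) mod 2 ^ w = D + NB"
    using NB_D_less J_less b less_exp[of w] sub_wrap[of b w w]
    by (simp_all add: NB_def J_def Ev_def)
  show "regs (sem w h init_derived s) rJJ = J"
    "regs (sem w h init_derived s) rPow = 2 ^ b mod 2 ^ w" "regs (sem w h init_derived s) rWB = w - b"
    "regs (sem w h init_derived s) rEN = Ev v + NB" "regs (sem w h init_derived s) rDN = D + NB"
    by (simp_all add: init_derived_def assms G m)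
qed

lemma sem_init_tree:
  assumes "regs s rV = v" "1 \<le> v" "v \<le> p" "regs s Procs = p" "regs s rOne = 1"
  shows "mem (sem w h init_tree s) = mem s"
    "\<And>r. \<not> scratch r \<Longrightarrow> r \<notin> {rDestA, rDestB, rLeft, rRight, rOk, rStarted} \<Longrightarrow>
       regs (sem w h init_tree s) r = regs s r"
    "regs (sem w h init_tree s) rDestA = (if even v then v div 2 else 0)"
    "regs (sem w h init_tree s) rDestB = (if odd v then v div 2 else 0)"
    "regs (sem w h init_tree s) rLeft = left v" "regs (sem w h init_tree s) rRight = right v"
    "regs (sem w h init_tree s) rOk = 1" "regs (sem w h init_tree s) rStarted = 1"
proof -
  have one: "Suc 0 mod 2 ^ w = Suc 0" using w by (cases w) auto
  have par: "even v \<Longrightarrow> Bit_Operations.and v (Suc 0) = 0" "odd v \<Longrightarrow> Bit_Operations.and v (Suc 0) = Suc 0"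
    "even v \<Longrightarrow> v mod 2 = 0" "odd v \<Longrightarrow> v mod 2 = Suc 0"
    using and_one_eq[of v] by (auto elim: evenE oddE)
  have l: "p div 2 < v \<longleftrightarrow> \<not> 2 * v \<le> p" by auto
  have r: "(p - Suc 0) div 2 < v \<longleftrightarrow> \<not> Suc (2 * v) \<le> p" using p(1) assms(2) by auto
  have pm: "(p + 2 ^ w - Suc 0) mod 2 ^ w = p - Suc 0" using sub_wrap[of 1 p w] p by simp
  have l2: "2 * v \<le> p \<Longrightarrow> (v + v) mod 2 ^ w = 2 * v" using p(2) by simp
  have r2: "Suc (2 * v) \<le> p \<Longrightarrow> Suc (2 * v) mod 2 ^ w = Suc (2 * v)" using p(2) by simp
  note defs = init_tree_def init_parent_def init_left_def init_right_def
  show "mem (sem w h init_tree s) = mem s" by (rule sem_stores) (simp add: defs)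
  show "regs (sem w h init_tree s) r = regs s r"
    if "\<not> scratch r" "r \<notin> {rDestA, rDestB, rLeft, rRight, rOk, rStarted}" for r
    using that by (intro sem_writes) (auto simp: defs)
  have other: "r \<notin> {rH, rC, rLeft} \<Longrightarrow> regs (sem w h init_left s) r = regs s r"
    "r \<notin> {rH, rC, rRight} \<Longrightarrow> regs (sem w h init_right s) r = regs s r"
    "r \<notin> {rY, rT1, rDestA, rDestB} \<Longrightarrow> regs (sem w h init_parent s) r = regs s r" for s r
    by (rule sem_writes, simp add: defs)+
  show "regs (sem w h init_tree s) rDestA = (if even v then v div 2 else 0)"
    "regs (sem w h init_tree s) rDestB = (if odd v then v div 2 else 0)"
    by (cases "even v"; simp add: init_tree_def other; simp add: init_parent_def assms one par)+
  show "regs (sem w h init_tree s) rLeft = left v"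
    by (simp add: init_tree_def other) (simp add: init_left_def assms other one l l2 left_def)
  show "regs (sem w h init_tree s) rRight = right v"
    by (simp add: init_tree_def other)
      (simp add: init_right_def assms other one pm r r2 right_def mod_Suc_eq flip: mult_2)
  show "regs (sem w h init_tree s) rOk = 1" "regs (sem w h init_tree s) rStarted = 1"
    using one by (simp_all add: init_tree_def)
qed

definition "ready v s \<longleftrightarrow> stat v s \<and> regs s rM = 0 \<and> regs s rPar = 0 \<and> regs s rOk \<noteq> 0 \<and> regs s Done = 0 \<and>
  stored s (Arr 0) (Arr 4) (\<lambda>j. share j v) \<and> stored s (Arr 2) (Arr 3) (\<lambda>_. X)"

definition "init_time i = J * ((length (la i) + length (lb i)) * (2 * k + 20) + 20) + 10 * D + 130"

lemma wp_initialise: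
  assumes i: "i < p"
  shows "wp w h (initialise k) (init w p n \<delta> la lb i) (init_time i) (ready (Suc i))"
proof -
  let ?s0 = "init w p n \<delta> la lb i"
  let ?v = "Suc i"
  define s1 where "s1 = sem w h init_word ?s0"
  have s0: "regs ?s0 Rank = i" "regs ?s0 WordSize = w" "regs ?s0 Total = n" "regs ?s0 Procs = p"
    "regs ?s0 ErrBits = err" "regs ?s0 Len1 = length (la i)" "regs ?s0 Len2 = length (lb i)"
    "regs ?s0 rM = 0" "regs ?s0 rPar = 0" "regs ?s0 Done = 0"
    by (simp_all add: init_def err_eq)
  note s1 = sem_init_word[OF s0(1) i s0(2,3), folded s1_def]
  have v: "?v \<le> p" "1 \<le> ?v" "?v < 2 ^ w" "1 \<le> p" using i p by simp_all
  let ?Q = "ready ?v"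
  let ?Bacc = "J * ((length (la i) + length (lb i)) * (2 * k + 20) + 20) + 3"
  have acc: "wp w h (block [accumulate k]) s (?Bacc + 1) ?Q"
    if s: "stat ?v s" "regs s rM = 0" "regs s rPar = 0" "regs s rOk = 1" "regs s Done = 0" "mem s = mem ?s0"
      "regs s rSh = sh" "regs s rHalf = 2 ^ (w - 1)" "regs s rJJ = J" "regs s Len1 = length (la i)"
      "regs s Len2 = length (lb i)" "regs s rXlo = X mod 2 ^ w" "regs s rXhi = X div 2 ^ w" for s
    unfolding block.simps(2)[of "accumulate k"]
  proof (rule wp_Seq[OF _ order_refl])
    have el: "la i ! x \<in> elements w k" if "x < length (la i)" for x using la(1)[OF i] that by auto
    have el': "lb i ! x \<in> elements w k" if "x < length (lb i)" for x using lb(1)[OF i] that by auto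
    have "wp w h (accumulate k) s ?Bacc (\<lambda>s'. keep {Arr 0, Arr 4, Arr 2, Arr 3} s s' \<and>
        stored s' (Arr 0) (Arr 4) (own (la i) (lb i)) \<and> stored s' (Arr 2) (Arr 3) (\<lambda>_. X))"
      by (rule wp_accumulate) (use s el el' i la(1) lb(1) length_less own_less J_less in
        \<open>auto simp: stat_def init_def elements_def\<close>)
    then show "wp w h (accumulate k) s ?Bacc (\<lambda>s1. wp w h (block []) s1 1 ?Q)"
    proof (rule wp_mono[OF _ order_refl])
      fix s' assume s': "keep {Arr 0, Arr 4, Arr 2, Arr 3} s s' \<and>
        stored s' (Arr 0) (Arr 4) (own (la i) (lb i)) \<and> stored s' (Arr 2) (Arr 3) (\<lambda>_. X)"
      then have "keep {Arr 0, Arr 4, Arr 2, Arr 3} s s'" by blast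
      from keep_regs[OF this] have "ready ?v s'" using s s' by (simp add: ready_def stat_def share_def)
      then show "wp w h (block []) s' 1 ?Q" by (intro wp_sem) simp_all
    qed
  qed
  have rest: "wp w h (block [init_params, init_derived, init_tree, accumulate k]) s (?Bacc + 80) ?Q"
    if s: "\<And>r. r \<notin> {rE, rD, rY, rT1} \<Longrightarrow> regs s r = regs s1 r" "regs s rD = D" "regs s rE = floor_log ?v"
      "mem s = mem ?s0" for s :: pe
  proof -
    define s2 where "s2 = sem w h init_params s"
    define s3 where "s3 = sem w h init_derived s2"
    define s4 where "s4 = sem w h init_tree s3"
    have s_regs: "regs s rOne = 1" "regs s ErrBits = err" "regs s WordSize = w" "regs s rHashBits = hb"
      "regs s rSh = sh" "regs s rV = ?v" "regs s Procs = p" "regs s rM = 0" "regs s rPar = 0" "regs s Done = 0"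
      "regs s Len1 = length (la i)" "regs s Len2 = length (lb i)" "regs s rHalf = 2 ^ (w - 1)"
      "regs s rXlo = X mod 2 ^ w" "regs s rXhi = X div 2 ^ w"
      using s(1) s0 by (simp_all add: s1)
    note s2 = sem_init_params[OF s(2,3) v(1) s_regs(1-5), folded s2_def]
    have s3': "regs s2 rD = D" "regs s2 rOne = 1" "regs s2 WordSize = w"
      using s2(2) s s_regs by simp_all
    note s3 = sem_init_derived[OF s3'(1) s2(4) s3'(2) s2(3) s3'(3) s2(5,6,7), folded s3_def]
    have s4': "regs s3 rV = ?v" "regs s3 Procs = p" "regs s3 rOne = 1"
      using s3(2) s2(2) s_regs by simp_all
    note s4 = sem_init_tree[OF s4'(1) v(2,1) s4'(2,3), folded s4_def]
    have F3: "regs s4 rJJ = J" "regs s4 rPow = 2 ^ b mod 2 ^ w" "regs s4 rWB = w - b"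
      "regs s4 rEN = Ev ?v + NB" "regs s4 rDN = D + NB"
      by (simp_all add: s4(2) s3)
    have F2: "regs s4 rE = Ev ?v" "regs s4 MsgLen = g" "regs s4 MsgBits = b" "regs s4 rQ = q"
      by (simp_all add: s4(2) s3(2) s2)
    have F: "regs s4 rOne = 1" "regs s4 rM = 0" "regs s4 rPar = 0" "regs s4 Done = 0" "regs s4 rSh = sh"
      "regs s4 rHalf = 2 ^ (w - 1)" "regs s4 Len1 = length (la i)" "regs s4 Len2 = length (lb i)"
      "regs s4 rXlo = X mod 2 ^ w" "regs s4 rXhi = X div 2 ^ w"
      by (simp_all add: s4(2) s3(2) s2(2) s_regs)
    have st: "stat ?v s4"
      unfolding stat_def by (intro conjI F F2 F3 s4)
    have m: "mem s4 = mem ?s0" by (simp add: s4(1) s3(1) s2(1) s(4))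
    have 4: "wp w h (block [accumulate k]) s4 (?Bacc + 1) ?Q"
      by (rule acc[OF st F(2,3) s4(7) F(4) m F(5,6) F3(1) F(7,8,9,10)])
    have 3: "wp w h (block [init_tree, accumulate k]) s3 (?Bacc + 36) ?Q"
      unfolding block.simps(2)[of init_tree]
      by (rule wp_Seq[where ?B1.0 = 35 and ?B2.0 = "?Bacc + 1"], rule wp_sem, unfold s4_def[symmetric])
        (simp add: init_tree_def init_parent_def init_left_def init_right_def,
          simp add: init_tree_def init_parent_def init_left_def init_right_def, rule 4, simp)
    have 2: "wp w h (block [init_derived, init_tree, accumulate k]) s2 (?Bacc + 45) ?Q"
      unfolding block.simps(2)[of init_derived]
      by (rule wp_Seq[where ?B1.0 = 9 and ?B2.0 = "?Bacc + 36"], rule wp_sem, unfold s3_def[symmetric])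
        (simp add: init_derived_def, simp add: init_derived_def, rule 3, simp)
    show ?thesis
      unfolding block.simps(2)[of init_params]
      by (rule wp_Seq[where ?B1.0 = 35 and ?B2.0 = "?Bacc + 45"], rule wp_sem, unfold s2_def[symmetric])
        (simp add: init_params_def init_hashes_def init_large_def init_small_def init_digits_def,
          simp add: init_params_def init_hashes_def init_large_def init_small_def init_digits_def, rule 2, simp)
  qed
  show ?thesis unfolding initialise_def block.simps(2)[of init_word] block.simps(2)[of "floor_log_com rD Procs"]
      block.simps(2)[of "floor_log_com rE rV"]
  proof (rule wp_Seq[where ?B1.0 = 9 and ?B2.0 = "(D * 5 + 6) + ((D * 5 + 6) + (?Bacc + 80))"], rule wp_sem)
    show "wp w h (Seq (floor_log_com rD Procs) (Seq (floor_log_com rE rV)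
       (block [init_params, init_derived, init_tree, accumulate k]))) (sem w h init_word ?s0)
       ((D * 5 + 6) + ((D * 5 + 6) + (?Bacc + 80))) ?Q"
      unfolding s1_def[symmetric]
    proof (rule wp_Seq[OF _ order_refl], rule wp_mono[OF wp_floor_log[of s1 Procs p]])
      fix s :: pe assume s: "regs s rD = floor_log p \<and> (\<forall>r'. r' \<notin> {rD, rY, rT1} \<longrightarrow> regs s r' = regs s1 r') \<and> mem s = mem s1"
      show "wp w h (Seq (floor_log_com rE rV) (block [init_params, init_derived, init_tree, accumulate k])) s
         (D * 5 + 6 + (?Bacc + 80)) ?Q"
      proof (rule wp_Seq[OF _ order_refl], rule wp_mono[OF wp_floor_log[of s rV ?v]])
        fix s' :: pe assume s': "regs s' rE = floor_log ?v \<and> (\<forall>r'. r' \<notin> {rE, rY, rT1} \<longrightarrow> regs s' r' = regs s r') \<and> mem s' = mem s"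
        show "wp w h (block [init_params, init_derived, init_tree, accumulate k]) s' (?Bacc + 80) ?Q"
          by (rule rest) (use s s' s1 in \<open>auto simp: D_def\<close>)
      qed (use s s1 v floor_log_le_D[OF v(1)] in auto)
    qed (use s1 s0 p in \<open>auto simp: D_def\<close>)
  qed (simp_all add: init_word_def init_time_def)
qed

end


subsection \<open>Sums over the heap-ordered tree of PEs\<close>

text \<open>The guard \<open>v = 0\<close> secures termination, as node 0 would be its own left
  child. In all other cases the children have larger numbers.\<close>

function tree_sum :: "nat \<Rightarrow> (nat \<Rightarrow> nat) \<Rightarrow> nat \<Rightarrow> nat" where
  "tree_sum p f v = (if v = 0 \<or> p < v then 0 else f v + tree_sum p f (2 * v) + tree_sum p f (2 * v + 1))"
  by pat_completeness auto
termination by (relation "Wellfounded.measure (\<lambda>(p, f, v). p + 1 - v)") auto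

declare tree_sum.simps [simp del]

lemma tree_sum_outside: "p < v \<Longrightarrow> tree_sum p f v = 0"
  by (simp add: tree_sum.simps)

text \<open>The claim about the root is generalised to a window of roots from \<open>a\<close> to
  \<open>2 * a - 1\<close>, for which induction works: the children of these nodes form exactly the
  window that belongs to \<open>2 * a\<close>. The subtrees of a window partition the nodes from
  \<open>a\<close> to \<open>p\<close>.\<close>

lemma tree_sum_level:
  assumes "1 \<le> a"
  shows "(\<Sum>v=a..<2*a. tree_sum p f v) = (\<Sum>v=a..p. f v)"
  using assms
proof (induction "p + 1 - a" arbitrary: a rule: less_induct)
  case less
  show ?case
  proof (cases "p < a")
    case True
    then show ?thesis by (simp add: tree_sum_outside)
  next
    case False
    let ?g = "\<lambda>v. if v \<le> p then f v else 0"
    have pair: "(\<Sum>v=a..<2*a. F (2 * v) + F (2 * v + 1)) = (\<Sum>u=2*a..<2*(2*a). F u)" for F :: "nat \<Rightarrow> nat"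
    proof -
      have "(\<Sum>v=a..<c. F (2 * v) + F (2 * v + 1)) = (\<Sum>u=2*a..<2*c. F u)" if "a \<le> c" for c
        using that by (induction c rule: dec_induct) (simp_all add: add.assoc)
      from this[of "2 * a"] show ?thesis by simp
    qed
    have "(\<Sum>v=a..<2*a. tree_sum p f v) =
        (\<Sum>v=a..<2*a. ?g v + (tree_sum p f (2 * v) + tree_sum p f (2 * v + 1)))"
    proof (rule sum.cong)
      fix v assume "v \<in> {a..<2*a}"
      then show "tree_sum p f v = ?g v + (tree_sum p f (2 * v) + tree_sum p f (2 * v + 1))"
        using less.prems by (subst tree_sum.simps) (simp add: tree_sum_outside)
    qed simp
    also have "\<dots> = (\<Sum>v=a..<2*a. ?g v) + (\<Sum>u=2*a..<2*(2*a). tree_sum p f u)"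
      unfolding sum.distrib[of ?g] pair[of "tree_sum p f"] ..
    also have "(\<Sum>u=2*a..<2*(2*a). tree_sum p f u) = (\<Sum>v=2*a..p. f v)"
      by (rule less.hyps) (use less.prems False in auto)
    also have "(\<Sum>v=2*a..p. f v) = (\<Sum>v=2*a..p. ?g v)" by simp
    also have "\<dots> = (\<Sum>v=2*a..<2*a+p+1. ?g v)"
      by (rule sum.mono_neutral_left) auto
    also have "(\<Sum>v=a..<2*a. ?g v) + \<dots> = (\<Sum>v=a..<2*a+p+1. ?g v)"
      by (rule sum.atLeastLessThan_concat) auto
    also have "\<dots> = (\<Sum>v=a..p. ?g v)"
      by (rule sum.mono_neutral_right) auto
    finally show ?thesis by simp
  qed
qed

lemma tree_sum_root: "tree_sum p f 1 = (\<Sum>v=1..p. f v)"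
  using tree_sum_level[of 1 p f] by (simp add: numeral_2_eq_2)

lemma tree_sum_le_root: "1 \<le> v \<Longrightarrow> tree_sum p f v \<le> tree_sum p f 1"
proof (induction v rule: less_induct)
  case (less v)
  show ?case
  proof (cases "v = 1")
    case False
    then have v: "2 \<le> v" using less.prems by simp
    show ?thesis
    proof (cases "p < v")
      case True
      then show ?thesis by (simp add: tree_sum_outside)
    next
      case False
      have "v = 2 * (v div 2) \<or> v = 2 * (v div 2) + 1" by presburger
      then have "tree_sum p f v \<le> tree_sum p f (2 * (v div 2)) + tree_sum p f (2 * (v div 2) + 1)"
        by (metis le_add1 le_add2)
      also have "\<dots> \<le> tree_sum p f (v div 2)"
        using v False by (subst (3) tree_sum.simps) auto
      also have "\<dots> \<le> tree_sum p f 1" using less.IH[of "v div 2"] v by simp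
      finally show ?thesis .
    qed
  qed simp
qed

subsection \<open>Adding digit streams with the carry kept in the accumulator\<close>

lemma mod_digit_split:
  fixes A P Q :: nat
  shows "A mod (P * Q) = A mod P + P * (A div P mod Q)"
  by (simp add: mod_mult2_eq)

text \<open>Adding the next digit of \<open>A\<close> after the shift is the same as having added
  one more digit of \<open>A\<close> before it. So a digit may arrive late without any separate
  bookkeeping of carries.\<close>

lemma carry_add_digit:
  fixes c A P Q :: nat
  assumes "P > 0"
  shows "(c + A mod P) div P + A div P mod Q = (c + A mod (P * Q)) div P"
  using assms unfolding mod_digit_split by (simp add: add.assoc[symmetric])

text \<open>The digit at weight \<open>P\<close> depends on the summands modulo \<open>P * Q\<close>
  only; the digits of the children that have not arrived yet cannot influence it.\<close>

lemma carry_digit: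
  fixes c A B P Q :: nat
  assumes "P > 0" "Q > 0"
  shows "(c + A mod (P * Q) + B mod (P * Q)) div P mod Q = (c + A + B) div P mod Q"
proof -
  have *: "N div P mod Q = N mod (P * Q) div P" for N :: nat
    using assms by (simp add: mod_mult2_eq)
  have "(c + A mod (P * Q) + B mod (P * Q)) mod (P * Q) = (c + A + B) mod (P * Q)"
    by (metis mod_add_left_eq mod_add_right_eq)
  then show ?thesis by (simp only: *)
qed

lemma digits_eq_imp_mod_eq:
  fixes A B b :: nat
  assumes "\<And>e. e < m \<Longrightarrow> A div 2 ^ (b * e) mod 2 ^ b = B div 2 ^ (b * e) mod 2 ^ b"
  shows "A mod 2 ^ (b * m) = B mod 2 ^ (b * m)"
  using assms
proof (induction m)
  case (Suc m)
  have *: "N mod 2 ^ (b * Suc m) = N mod 2 ^ (b * m) + 2 ^ (b * m) * (N div 2 ^ (b * m) mod 2 ^ b)" for N :: nat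
    using mod_digit_split[of N "2 ^ (b * m)" "2 ^ b"] by (simp add: power_add mult.commute)
  show ?case unfolding * using Suc by simp
qed simp

context problem
begin

definition "S j v = tree_sum p (share j) v"
text \<open>The number of digits of sum \<open>j\<close> among the first \<open>t\<close> blocks.
  Natural subtraction gives 0 before the turn of the group \<open>j div g\<close>, and the minimum
  freezes the value at \<open>q\<close> afterwards.\<close>

definition "pops j t = min (t - q * (j div g)) q"
definition "dig j v e = S j v div 2 ^ (b * e) mod 2 ^ b"
definition "digit v t x = dig ((t div q) * g + x) v (t mod q)"
definition "xdigit t = X div 2 ^ (b * (t mod q)) mod 2 ^ b"
text \<open>\<open>cur v t fl j\<close> is the \<open>j\<close>-th accumulator of node \<open>v\<close> after \<open>t\<close> blocks have been sent; \<open>fl\<close> tells whether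
  block \<open>t\<close> of the left child has already been added.\<close>

definition "cur v t fl j = (share j v + S j (2 * v) mod 2 ^ (b * (pops j t + of_bool (fl \<and> j div g = t div q)))
  + S j (2 * v + 1) mod 2 ^ (b * pops j t)) div 2 ^ (b * pops j t)"
definition "curX t j = X div 2 ^ (b * pops j t)"

lemma S_rec: "1 \<le> v \<Longrightarrow> v \<le> p \<Longrightarrow> S j v = share j v + S j (2 * v) + S j (2 * v + 1)"
  unfolding S_def by (subst tree_sum.simps) simp

lemma S_outside: "p < v \<Longrightarrow> S j v = 0"
  by (simp add: S_def tree_sum_outside)

lemma S_less: "1 \<le> v \<Longrightarrow> j < J \<Longrightarrow> S j v < 2 ^ w * 2 ^ w"
  unfolding S_def
  using tree_sum_le_root[of v p "share j"] share_sum_less[of j] J_less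
  unfolding tree_sum_root by simp

lemma digit_less: "digit v t x < 2 ^ w"
proof -
  have "digit v t x < 2 ^ b" by (simp add: digit_def dig_def)
  also have "(2::nat) ^ b \<le> 2 ^ w" using b by simp
  finally show ?thesis .
qed

lemma in_group: "t div q * g \<le> j \<and> j < t div q * g + g \<longleftrightarrow> j div g = t div q"
proof
  assume "j div g = t div q"
  then show "t div q * g \<le> j \<and> j < t div q * g + g"
    using g(1) dividend_less_div_times[of g j] by (metis add.commute div_times_less_eq_dividend less_eq_Suc_le One_nat_def)
next
  assume *: "t div q * g \<le> j \<and> j < t div q * g + g"
  then show "j div g = t div q"
    using g(1) by (intro div_nat_eqI) (simp_all add: mult.commute)
qed

lemma pops_group:
  assumes "j div g = t div q"
  shows "pops j t = t mod q" "pops j (Suc t) = Suc (t mod q)"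
proof -
  have t: "q * (t div q) + t mod q = t" by (rule mult_div_mod_eq)
  have lt: "t mod q < q" using q by simp
  have 1: "t - q * (t div q) = t mod q" "Suc t - q * (t div q) = Suc (t mod q)" using t by linarith+
  show "pops j t = t mod q" "pops j (Suc t) = Suc (t mod q)"
    unfolding pops_def assms 1 using lt by simp_all
qed

lemma pops_other:
  assumes "j div g \<noteq> t div q"
  shows "pops j (Suc t) = pops j t"
proof -
  have t: "q * (t div q) + t mod q = t" by (rule mult_div_mod_eq)
  have lt: "t mod q < q" using q by simp
  consider "Suc (j div g) \<le> t div q" | "Suc (t div q) \<le> j div g" using assms by linarith
  then show ?thesis
  proof cases
    case 1
    then have "q * Suc (j div g) \<le> q * (t div q)" by (rule mult_le_mono2)
    then have "q * (j div g) + q \<le> t" using t unfolding mult_Suc_right by linarith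
    then show ?thesis by (simp add: pops_def)
  next
    case 2
    then have "q * Suc (t div q) \<le> q * (j div g)" by (rule mult_le_mono2)
    then have "Suc t \<le> q * (j div g)" using t lt unfolding mult_Suc_right by linarith
    then show ?thesis by (simp add: pops_def)
  qed
qed

lemma cur_left:
  "cur v t True j = (if j div g = t div q then cur v t False j + dig j (2 * v) (t mod q) else cur v t False j)"
proof (cases "j div g = t div q")
  case True
  let ?P = "2 ^ (b * (t mod q)) :: nat"
  have "2 ^ (b * Suc (t mod q)) = ?P * 2 ^ b" by (simp add: power_add)
  then show ?thesis
    using True carry_add_digit[of ?P "share j v + S j (2 * v + 1) mod ?P" "S j (2 * v)" "2 ^ b"]
    by (simp add: cur_def dig_def pops_group add_ac)
qed (simp add: cur_def)

lemma cur_right: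
  assumes "j div g = t div q"
  shows "cur v t True j + dig j (2 * v + 1) (t mod q) =
    (share j v + S j (2 * v) mod 2 ^ (b * Suc (t mod q)) + S j (2 * v + 1) mod 2 ^ (b * Suc (t mod q)))
      div 2 ^ (b * (t mod q))"
proof -
  let ?P = "2 ^ (b * (t mod q)) :: nat"
  have "2 ^ (b * Suc (t mod q)) = ?P * 2 ^ b" by (simp add: power_add)
  then show ?thesis
    using assms carry_add_digit[of ?P "share j v + S j (2 * v) mod 2 ^ (b * Suc (t mod q))" "S j (2 * v + 1)" "2 ^ b"]
    by (simp add: cur_def dig_def pops_group)
qed

text \<open>The accumulator never exceeds the sum over the whole subtree, since it is a shifted sum
  of truncated parts. Hence two words suffice throughout the stream.\<close>

lemma cur_right_le:
  assumes "j div g = t div q" "1 \<le> v" "v \<le> p"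
  shows "cur v t True j + dig j (2 * v + 1) (t mod q) \<le> S j v"
  unfolding cur_right[OF assms(1)] S_rec[OF assms(2,3)]
  by (rule order_trans[OF div_le_dividend]) (intro add_mono mod_less_eq_dividend order_refl)

lemma cur_left_le:
  assumes "j div g = t div q" "1 \<le> v" "v \<le> p"
  shows "cur v t False j + dig j (2 * v) (t mod q) \<le> S j v"
  using cur_right_le[OF assms] cur_left[of v t j] assms(1) by simp

text \<open>Once the current digits of both children are added, the lowest digit of the accumulator
  is final: it agrees with the digit of the exact subtree sum, although higher digits of the
  children are still missing.\<close>

lemma cur_emit:
  assumes "j div g = t div q" "1 \<le> v" "v \<le> p"
  shows "(cur v t True j + dig j (2 * v + 1) (t mod q)) mod 2 ^ b = dig j v (t mod q)"
  using carry_digit[of "2 ^ (b * (t mod q))" "2 ^ b" "share j v" "S j (2 * v)" "S j (2 * v + 1)"]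
  unfolding cur_right[OF assms(1)]
  by (simp add: dig_def S_rec[OF assms(2,3)] power_add mult.commute)

lemma cur_pop:
  "cur v (Suc t) False j = (if j div g = t div q
     then (cur v t True j + dig j (2 * v + 1) (t mod q)) div 2 ^ b else cur v t True j)"
proof (cases "j div g = t div q")
  case True
  show ?thesis
    using True unfolding cur_right[OF True]
    by (simp add: cur_def pops_group flip: div_mult2_eq power_add) (simp add: add.commute)
qed (simp add: cur_def pops_other)

lemma curX_pop:
  "curX (Suc t) j = (if j div g = t div q then curX t j div 2 ^ b else curX t j)"
  by (simp add: curX_def pops_group pops_other flip: div_mult2_eq power_add) (simp add: add.commute)

lemma curX_digit: "j div g = t div q \<Longrightarrow> curX t j mod 2 ^ b = xdigit t"
  by (simp add: curX_def xdigit_def pops_group)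

lemma curX_less: "curX t j < 2 ^ w * 2 ^ w"
proof -
  have "curX t j \<le> X" by (simp add: curX_def)
  also have "X < 2 ^ w * 2 ^ w" unfolding X_def using n(2) half_less by (intro mult_strict_mono) auto
  finally show ?thesis .
qed

end


subsection \<open>Supersteps of a single PE\<close>

context problem
begin

section \<open>Schedule and invariants of a node\<close>

definition "act_s v m \<longleftrightarrow> Ev v < m \<and> m \<le> Ev v + NB"
definition "act_r v m \<longleftrightarrow> Ev v \<le> m \<and> m < Ev v + NB"
text \<open>\<open>popsA\<close> counts the blocks emitted before superstep A of round
  \<open>m\<close>, \<open>popsB\<close> those emitted when it is over. Truncated subtraction and
  the minimum describe nodes that have not started yet or have already finished.\<close>

definition "popsA v m = min (m - Suc (Ev v)) NB"
definition "popsB v m = min (m - Ev v) NB"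

definition "core v m par T fl s \<longleftrightarrow> stat v s \<and> regs s rM = m \<and> regs s rPar = par \<and> regs s Done = 0 \<and>
  stored s (Arr 0) (Arr 4) (cur v T fl) \<and> stored s (Arr 2) (Arr 3) (curX T) \<and>
  (regs s rOk \<noteq> 0 \<longleftrightarrow> (\<forall>t<T. \<forall>x<g. digit v t x = xdigit t))"

definition "recv_holds u t s \<longleftrightarrow> (u \<le> p \<longrightarrow> (\<forall>x<g. mem s Recv x = digit u t x))"
definition "send_holds v t s \<longleftrightarrow> (\<forall>x<g. mem s Send x = digit v t x)"
definition "asks s d r \<longleftrightarrow> regs s Dest = d \<and> regs s Source = r"

text \<open>\<open>invA\<close> and \<open>invB\<close> describe a node before the local computation
  of superstep A or B, \<open>postA\<close> and \<open>postB\<close> the same node afterwards, just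
  before the exchange. Here the flag of \<open>core\<close> is \<open>act_s v m\<close>: the left
  block of the coming emission has been added in the previous superstep B, while the right one still
  lies in \<open>Recv\<close>.\<close>

definition "invA m v s \<longleftrightarrow> core v m 0 (popsA v m) (act_s v m) s \<and>
  (act_s v m \<longrightarrow> recv_holds (2 * v + 1) (m - Suc (Ev v)) s)"

definition "postA m v s \<longleftrightarrow> core v m 1 (popsB v m) False s \<and>
  (act_s v m \<longrightarrow> send_holds v (m - Suc (Ev v)) s) \<and>
  asks s (if act_s v m \<and> even v then v div 2 else 0) (if act_r v m then left v else 0)"

definition "invB m v s \<longleftrightarrow> core v m 1 (popsB v m) False s \<and>
  (act_s v m \<longrightarrow> send_holds v (m - Suc (Ev v)) s) \<and>
  (act_r v m \<longrightarrow> recv_holds (2 * v) (m - Ev v) s)"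

definition "postB m v s \<longleftrightarrow> core v (Suc m) 0 (popsA v (Suc m)) (act_s v (Suc m)) s \<and>
  (act_s v m \<longrightarrow> send_holds v (m - Suc (Ev v)) s) \<and>
  asks s (if act_s v m \<and> odd v then v div 2 else 0) (if act_r v m then right v else 0)"

definition "final v s \<longleftrightarrow> regs s Done \<noteq> 0 \<and>
  (regs s Accept \<noteq> 0 \<longleftrightarrow> (\<forall>t<NB. \<forall>x<g. digit v t x = xdigit t))"

lemma sched_simps:
  "popsA v (Suc m) = popsB v m" "act_s v (Suc m) \<longleftrightarrow> act_r v m"
  "act_s v m \<Longrightarrow> popsA v m = m - Suc (Ev v)" "act_s v m \<Longrightarrow> popsB v m = Suc (m - Suc (Ev v))"
  "act_s v m \<Longrightarrow> m - Suc (Ev v) < NB" "act_r v m \<Longrightarrow> m - Ev v < NB"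
  "act_r v m \<Longrightarrow> popsB v m = m - Ev v" "\<not> act_s v m \<Longrightarrow> popsB v m = popsA v m"
  unfolding popsA_def popsB_def act_s_def act_r_def by auto

lemma ready_invA: "ready v s \<Longrightarrow> invA 0 v s"
proof -
  have "cur v 0 False j = share j v" "curX 0 j = X" for j by (simp_all add: cur_def curX_def pops_def)
  moreover have "\<not> act_s v 0" "popsA v 0 = 0" by (simp_all add: act_s_def popsA_def)
  ultimately show "ready v s \<Longrightarrow> invA 0 v s" by (simp add: ready_def invA_def core_def stored_def)
qed

lemma sem_request:
  assumes s: "stat v s" "regs s rM = m" and d: "d = Reg i" "i < 30" and r: "r = Reg i'" "i' < 30"
  defines "s' \<equiv> sem w h (request d r) s"
  shows "mem s' = mem s" "\<And>r'. \<not> scratch r' \<Longrightarrow> r' \<notin> {rSnd, rRcv, Dest, Source} \<Longrightarrow> regs s' r' = regs s r'"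
    "regs s' rSnd \<noteq> 0 \<longleftrightarrow> act_s v m" "regs s' rRcv \<noteq> 0 \<longleftrightarrow> act_r v m"
    "asks s' (if act_s v m then regs s d else 0) (if act_r v m then regs s r else 0)"
proof -
  show "mem s' = mem s" unfolding s'_def by (rule sem_stores) (simp add: request_def)
  show "regs s' r' = regs s r'" if "\<not> scratch r'" "r' \<notin> {rSnd, rRcv, Dest, Source}" for r'
    unfolding s'_def by (rule sem_writes) (use that in \<open>auto simp: request_def\<close>)
  have E: "regs s rE = Ev v" "regs s rEN = Ev v + NB" using s by (simp_all add: stat_def)
  have one: "0 < w" using w by simp
  have ne: "d \<noteq> rSnd" "d \<noteq> rRcv" "d \<noteq> rC" "d \<noteq> rH" "r \<noteq> rSnd" "r \<noteq> rRcv" "r \<noteq> rC" "r \<noteq> rH"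
    "d \<noteq> Dest" "d \<noteq> Source" "r \<noteq> Dest" "r \<noteq> Source"
    using d r by auto
  have "(regs s' rSnd \<noteq> 0 \<longleftrightarrow> act_s v m) \<and> (regs s' rRcv \<noteq> 0 \<longleftrightarrow> act_r v m) \<and>
    asks s' (if act_s v m then regs s d else 0) (if act_r v m then regs s r else 0)"
    by (cases "Ev v < m"; cases "Ev v + NB < m"; cases "m < Ev v"; cases "m < Ev v + NB")
      (simp_all add: s'_def request_def s E one ne asks_def act_s_def act_r_def)
  then show "regs s' rSnd \<noteq> 0 \<longleftrightarrow> act_s v m" "regs s' rRcv \<noteq> 0 \<longleftrightarrow> act_r v m"
    "asks s' (if act_s v m then regs s d else 0) (if act_r v m then regs s r else 0)" by blast+
qed

lemma group_bound: "t < NB \<Longrightarrow> t div q * g + g \<le> J"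
proof -
  assume "t < NB"
  then have "t div q < G" unfolding NB_def by (rule less_mult_imp_div_less)
  then have "Suc (t div q) * g \<le> G * g" by (intro mult_le_mono1) simp
  then show ?thesis by (simp add: J_def)
qed

lemma group_less: "t < NB \<Longrightarrow> x < g \<Longrightarrow> t div q * g + x < J" "x < g \<Longrightarrow> (t div q * g + x) div g = t div q"
  using group_bound[of t] by simp_all

lemma m_less: "m \<le> D + NB \<Longrightarrow> m < 2 ^ w"
  using NB_D_less by simp

text \<open>The flag \<open>fl\<close> selects the message of the right child, which is processed after that of the left
  child. A missing child contributes the digit \<open>0\<close>.\<close>

lemma wp_add_child:
  assumes t: "t < NB" and v: "1 \<le> v" "v \<le> p"
    and s: "stat v s" "regs s rBase = t div q * g" "recv_holds u t s" "stored s (Arr 0) (Arr 4) (cur v t fl)"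
    and u: "if fl then u = 2 * v + 1 \<and> c = rRight else u = 2 * v \<and> c = rLeft"
  shows "wp w h (Cond c add_received Skip) s (g * 20 + 5) (\<lambda>s'. keep {Arr 0, Arr 4} s s' \<and>
    regs s' rBase = t div q * g \<and>
    stored s' (Arr 0) (Arr 4) (\<lambda>j. if j div g = t div q then cur v t fl j + dig j u (t mod q) else cur v t fl j))"
proof -
  let ?base = "t div q * g"
  have c: "regs s c \<noteq> 0 \<longleftrightarrow> u \<le> p" using s(1) u v by (auto simp: stat_def left_def right_def split: if_splits)
  have le: "cur v t fl j + dig j u (t mod q) \<le> S j v" if "j div g = t div q" for j
    using u cur_right_le[OF that v] cur_left_le[OF that v] by (cases fl) auto
  have grp: "(\<lambda>j. if ?base \<le> j \<and> j < ?base + g then cur v t fl j + digit u t (j - ?base) else cur v t fl j)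
    = (\<lambda>j. if j div g = t div q then cur v t fl j + dig j u (t mod q) else cur v t fl j)" (is "_ = ?F")
  proof
    fix j
    show "(if ?base \<le> j \<and> j < ?base + g then cur v t fl j + digit u t (j - ?base) else cur v t fl j) = ?F j"
      using in_group[of t j] by (cases "j div g = t div q") (auto simp: digit_def)
  qed
  show ?thesis
  proof (rule wp_Cond[where B = "g * 20 + 3"])
    assume "regs s c \<noteq> 0"
    then have up: "u \<le> p" using c by simp
    have "wp w h add_received s (g * 20 + 3) (\<lambda>s'. keep {Arr 0, Arr 4} s s' \<and> regs s' rBase = ?base \<and>
      stored s' (Arr 0) (Arr 4) (\<lambda>j. if ?base \<le> j \<and> j < ?base + g then cur v t fl j + digit u t (j - ?base) else cur v t fl j))"
    proof (rule wp_add_received)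
      fix x assume x: "x < g"
      show "mem s Recv x = digit u t x" using s(3) up x by (simp add: recv_holds_def)
      show "digit u t x < 2 ^ w" by (rule digit_less)
      show "cur v t fl (?base + x) + digit u t x < 2 ^ w * 2 ^ w"
        using le[OF group_less(2)[OF x]] S_less[OF v(1) group_less(1)[OF t x]] by (simp add: digit_def)
    qed (use s group_bound[OF t] in \<open>simp_all add: stat_def\<close>)
    then show "wp w h add_received s (g * 20 + 3) (\<lambda>s'. keep {Arr 0, Arr 4} s s' \<and> regs s' rBase = ?base \<and>
      stored s' (Arr 0) (Arr 4) ?F)" unfolding grp .
  next
    assume "regs s c = 0"
    then have up: "p < u" using c by simp
    have "?F = cur v t fl" using S_outside[OF up] by (auto simp: dig_def)
    then show "wp w h Skip s (g * 20 + 3) (\<lambda>s'. keep {Arr 0, Arr 4} s s' \<and> regs s' rBase = ?base \<and>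
      stored s' (Arr 0) (Arr 4) ?F)" using s by (intro wp_sem) simp_all
  qed simp
qed

lemma wp_stepA:
  assumes v: "1 \<le> v" "v \<le> p" and inv: "invA m v s" and m: "m \<le> D + NB"
  shows "wp w h stepA s (g * 55 + 70) (\<lambda>s'. if m = D + NB then final v s' else postA m v s')"
proof -
  let ?Q = "\<lambda>s'. if m = D + NB then final v s' else postA m v s'"
  let ?ask = "\<lambda>s'. asks s' (if act_s v m \<and> even v then v div 2 else 0) (if act_r v m then left v else 0)"
  have core: "core v m 0 (popsA v m) (act_s v m) s"
    and recv: "act_s v m \<Longrightarrow> recv_holds (2 * v + 1) (m - Suc (Ev v)) s"
    using inv by (simp_all add: invA_def)
  have st: "stat v s" "regs s rM = m" using core by (simp_all add: core_def)
  define s1 where "s1 = sem w h (request rDestA rLeft) s"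
  note rq = sem_request[OF st refl _ refl, of 11 9, folded s1_def, simplified]
  have core1: "core v m 0 (popsA v m) (act_s v m) s1"
    using core rq(1,2) by (auto simp: core_def stored_def stat_def)
  have ask1: "?ask s1" using rq(5) st by (cases "act_s v m"; cases "act_r v m") (auto simp: stat_def asks_def)
  have recv1: "act_s v m \<Longrightarrow> recv_holds (2 * v + 1) (m - Suc (Ev v)) s1"
    using recv rq(1) by (simp add: recv_holds_def)
  let ?fin = "block [Op Equal rC rM rDN, Cond rC (block [move Accept rOk, Const Done 1]) Skip, Const rPar 1]"
  have w0: "0 < w" using w by simp
  have fin: "wp w h (block [?fin]) s2 20 ?Q"
    if s2: "core v m 0 (popsB v m) False s2" "act_s v m \<Longrightarrow> send_holds v (m - Suc (Ev v)) s2" "?ask s2" for s2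
  proof (rule wp_sem)
    have r: "regs s2 rM = m" "regs s2 rDN = D + NB" using s2(1) by (simp_all add: core_def stat_def)
    show "?Q (sem w h (block [?fin]) s2)"
    proof (cases "m = D + NB")
      case True
      \<comment> \<open>The root has height \<open>D\<close>, so it emits its last block in exactly
        this round; the lower nodes are done earlier. All nodes stop in the same superstep.\<close>
      have "popsB v m = NB" by (simp add: popsB_def True Ev_def)
      then show ?thesis using True s2(1) w0 by (simp add: final_def r core_def)
    next
      case False
      have e: "sem w h (block [?fin]) s2 = set_reg rPar 1 (set_reg rC 0 s2)"
        using False w0 by (simp add: r)
      have "core v m 1 (popsB v m) False (set_reg rPar 1 (set_reg rC 0 s2))"
        using s2(1) by (simp add: core_def stat_def stored_def)
      moreover have "?ask (set_reg rPar 1 (set_reg rC 0 s2))" using s2(3) by (simp add: asks_def)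
      moreover have "act_s v m \<Longrightarrow> send_holds v (m - Suc (Ev v)) (set_reg rPar 1 (set_reg rC 0 s2))"
        using s2(2) by (simp add: send_holds_def)
      ultimately show ?thesis unfolding e using False by (simp add: postA_def)
    qed
  qed simp_all
  let ?data = "block [block [Op Sub rBase rM rOne, Op Sub rBase rBase rE, Op Div rBase rBase rQ,
                 Op Mul rBase rBase MsgLen], Cond rRight add_received Skip, emit]"
  let ?P = "\<lambda>s2. core v m 0 (popsB v m) False s2 \<and> (act_s v m \<longrightarrow> send_holds v (m - Suc (Ev v)) s2) \<and> ?ask s2"
  have data: "wp w h ?data s1 (g * 55 + 20) ?P" if act: "act_s v m"
  proof -
    define t where "t = m - Suc (Ev v)"
    have t: "t < NB" "popsA v m = t" "popsB v m = Suc t" using sched_simps[where v = v and m = m] act by (simp_all add: t_def)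
    let ?base = "t div q * g"
    define s2 where "s2 = sem w h (block [Op Sub rBase rM rOne, Op Sub rBase rBase rE, Op Div rBase rBase rQ,
                 Op Mul rBase rBase MsgLen]) s1"
    have K2: "keep {} s1 s2" by (simp add: s2_def)
    have r: "regs s1 rM = m" "regs s1 rOne = 1" "regs s1 rE = Ev v" "regs s1 rQ = q" "regs s1 MsgLen = g"
      using core1 by (simp_all add: core_def stat_def)
    have mm: "(m + 2 ^ w - Suc 0) mod 2 ^ w = m - Suc 0" "(m + 2 ^ w - Suc (Ev v)) mod 2 ^ w = t"
      using sub_wrap[of 1 m w] sub_wrap[of "Suc (Ev v)" m w] m_less[OF m] act by (simp_all add: act_s_def t_def)
    have mm': "m - Suc 0 + 2 ^ w - Ev v = m + 2 ^ w - Suc (Ev v)" using act by (simp add: act_s_def)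
    have bm: "?base mod 2 ^ w = ?base" using group_bound[OF t(1)] J_less by simp
    have b2: "regs s2 rBase = ?base" by (simp add: s2_def r mm mm' bm)
    have core2: "core v m 0 t True s2"
      using core1 keep_regs[OF K2] keep_mem[OF K2] act t by (simp add: core_def stored_def stat_def)
    have recv2: "recv_holds (2 * v + 1) t s2" using recv1[OF act] keep_mem[OF K2] by (simp add: recv_holds_def t_def)
    let ?V = "\<lambda>j. if j div g = t div q then cur v t True j + dig j (2 * v + 1) (t mod q) else cur v t True j"
    have add: "wp w h (Cond rRight add_received Skip) s2 (g * 20 + 5) (\<lambda>s'. keep {Arr 0, Arr 4} s2 s' \<and>
        regs s' rBase = ?base \<and> stored s' (Arr 0) (Arr 4) ?V)"
      by (rule wp_add_child[OF t(1) v _ b2 recv2]) (use core2 in \<open>auto simp: core_def\<close>)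
    have em: "wp w h (block [emit]) s3 (g * 35 + 4) ?P"
      if s3: "keep {Arr 0, Arr 4} s2 s3 \<and> regs s3 rBase = ?base \<and> stored s3 (Arr 0) (Arr 4) ?V" for s3
    proof -
      have K3: "keep {Arr 0, Arr 4} s2 s3" using s3 by blast
      have st3: "stat v s3" using core2 keep_regs[OF K3] by (simp add: core_def stat_def)
      have X3: "stored s3 (Arr 2) (Arr 3) (curX t)"
        using core2 keep_mem[OF K3] by (simp add: core_def stored_def)
      have "wp w h emit s3 (g * 35 + 3) (\<lambda>s'.
        keep {Arr 0, Arr 4, Arr 2, Arr 3, Send} (set_reg rOk (regs s' rOk) s3) s' \<and>
        stored s' (Arr 0) (Arr 4) (\<lambda>j. if ?base \<le> j \<and> j < ?base + g then ?V j div 2 ^ b else ?V j) \<and>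
        stored s' (Arr 2) (Arr 3) (\<lambda>j. if ?base \<le> j \<and> j < ?base + g then curX t j div 2 ^ b else curX t j) \<and>
        (\<forall>x<g. mem s' Send x = ?V (?base + x) mod 2 ^ b) \<and>
        (regs s' rOk \<noteq> 0 \<longleftrightarrow> regs s3 rOk \<noteq> 0 \<and>
           (\<forall>x<g. ?V (?base + x) mod 2 ^ b = curX t (?base + x) mod 2 ^ b)))"
      proof (rule wp_emit)
        fix x assume x: "x < g"
        note gl = group_less(2)[OF x, of t]
        show "?V (?base + x) < 2 ^ w * 2 ^ w"
          using cur_right_le[OF gl v] S_less[OF v(1) group_less(1)[OF t(1) x]] gl by simp
        show "curX t (?base + x) < 2 ^ w * 2 ^ w" by (rule curX_less)
      qed (use s3 st3 X3 group_bound[OF t(1)] in \<open>simp_all add: stat_def\<close>)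
      then have "wp w h emit s3 (g * 35 + 3) ?P"
      proof (rule wp_mono[OF _ order_refl])
        fix s' assume s': "keep {Arr 0, Arr 4, Arr 2, Arr 3, Send} (set_reg rOk (regs s' rOk) s3) s' \<and>
          stored s' (Arr 0) (Arr 4) (\<lambda>j. if ?base \<le> j \<and> j < ?base + g then ?V j div 2 ^ b else ?V j) \<and>
          stored s' (Arr 2) (Arr 3) (\<lambda>j. if ?base \<le> j \<and> j < ?base + g then curX t j div 2 ^ b else curX t j) \<and>
          (\<forall>x<g. mem s' Send x = ?V (?base + x) mod 2 ^ b) \<and>
          (regs s' rOk \<noteq> 0 \<longleftrightarrow> regs s3 rOk \<noteq> 0 \<and>
             (\<forall>x<g. ?V (?base + x) mod 2 ^ b = curX t (?base + x) mod 2 ^ b))"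
        have K: "keep {Arr 0, Arr 4, Arr 2, Arr 3, Send} (set_reg rOk (regs s' rOk) s3) s'" using s' by blast
        have regs': "regs s' r = regs s1 r" if "\<not> scratch r" "r \<noteq> rOk" for r
          using keep_regs[OF K that(1)] keep_regs[OF K3 that(1)] keep_regs[OF K2 that(1)] that(2) by simp
        have Vd: "?V (?base + x) mod 2 ^ b = digit v t x" "curX t (?base + x) mod 2 ^ b = xdigit t" if "x < g" for x
          using cur_emit[OF group_less(2)[OF that] v] curX_digit[OF group_less(2)[OF that]] group_less(2)[OF that]
          by (simp_all add: digit_def)
        have V': "(\<lambda>j. if ?base \<le> j \<and> j < ?base + g then ?V j div 2 ^ b else ?V j) = cur v (Suc t) False"
          "(\<lambda>j. if ?base \<le> j \<and> j < ?base + g then curX t j div 2 ^ b else curX t j) = curX (Suc t)"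
          unfolding in_group by (simp_all add: fun_eq_iff cur_pop curX_pop)
        have "regs s3 rOk = regs s1 rOk" using keep_regs[OF K3] keep_regs[OF K2] by simp
        then have ok: "regs s' rOk \<noteq> 0 \<longleftrightarrow> (\<forall>t'<Suc t. \<forall>x<g. digit v t' x = xdigit t')"
          using s' Vd core1 t(2) by (auto simp: core_def less_Suc_eq)
        have "stat v s'" using core1 regs' by (simp add: core_def stat_def)
        moreover have "regs s' rM = m" "regs s' rPar = 0" "regs s' Done = 0"
          using core1 regs' by (simp_all add: core_def)
        ultimately have "core v m 0 (Suc t) False s'" using s' ok unfolding V' by (simp add: core_def)
        moreover have "?ask s'" using ask1 regs' by (simp add: asks_def)
        moreover have "send_holds v t s'" using s' Vd by (simp add: send_holds_def)
        ultimately show "?P s'" by (simp add: t t_def)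
      qed
      then show ?thesis unfolding block.simps(2)[of emit]
        by (intro wp_Seq[where ?B1.0 = "g * 35 + 3" and ?B2.0 = 1])
          (auto elim!: wp_mono intro!: wp_sem)
    qed
    have ad: "wp w h (block [Cond rRight add_received Skip, emit]) s2 (g * 55 + 9) ?P"
      unfolding block.simps(2)[of "Cond rRight add_received Skip"]
      by (rule wp_Seq[where ?B1.0 = "g * 20 + 5" and ?B2.0 = "g * 35 + 4"], rule wp_mono[OF add order_refl em])
        simp_all
    show ?thesis unfolding block.simps(2)[of "block [Op Sub rBase rM rOne, Op Sub rBase rBase rE, Op Div rBase rBase rQ,
                 Op Mul rBase rBase MsgLen]"]
      by (rule wp_Seq[where ?B1.0 = 5 and ?B2.0 = "g * 55 + 9"], rule wp_sem, simp, simp,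
          unfold s2_def[symmetric], rule ad) simp
  qed
  have "wp w h (Cond rSnd ?data Skip) s1 (g * 55 + 21) ?P"
  proof (rule wp_Cond[where B = "g * 55 + 20"])
    assume "regs s1 rSnd = 0"
    then have na: "\<not> act_s v m" using rq(3) by simp
    then have "?P s1" using core1 ask1 sched_simps(8)[OF na] by simp
    then show "wp w h Skip s1 (g * 55 + 20) ?P" by (intro wp_sem) simp_all
  qed (use data rq(3) in auto)
  then have mid: "wp w h (block [Cond rSnd ?data Skip, ?fin]) s1 (g * 55 + 41) ?Q"
    unfolding block.simps(2)[of "Cond rSnd ?data Skip"]
    by (intro wp_Seq[where ?B1.0 = "g * 55 + 21" and ?B2.0 = 20])
      (erule wp_mono, simp, rule fin, blast+, simp)
  show ?thesis unfolding stepA_def block.simps(2)[of "request rDestA rLeft"]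
    by (rule wp_Seq[where ?B1.0 = 25 and ?B2.0 = "g * 55 + 41"], rule wp_sem, simp add: request_def,
        simp add: request_def, unfold s1_def[symmetric], rule mid) simp
qed

lemma wp_stepB:
  assumes v: "1 \<le> v" "v \<le> p" and inv: "invB m v s" and m: "m < D + NB"
  shows "wp w h stepB s (g * 55 + 70) (postB m v)"
proof -
  let ?ask = "\<lambda>s'. asks s' (if act_s v m \<and> odd v then v div 2 else 0) (if act_r v m then right v else 0)"
  have core: "core v m 1 (popsB v m) False s"
    and send: "act_s v m \<Longrightarrow> send_holds v (m - Suc (Ev v)) s"
    and recv: "act_r v m \<Longrightarrow> recv_holds (2 * v) (m - Ev v) s"
    using inv by (simp_all add: invB_def)
  have st: "stat v s" "regs s rM = m" using core by (simp_all add: core_def)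
  define s1 where "s1 = sem w h (request rDestB rRight) s"
  note rq = sem_request[OF st refl _ refl, of 12 10, folded s1_def, simplified]
  have core1: "core v m 1 (popsB v m) False s1"
    using core rq(1,2) by (auto simp: core_def stored_def stat_def)
  have ask1: "?ask s1" using rq(5) st by (cases "act_s v m"; cases "act_r v m") (auto simp: stat_def asks_def)
  have recv1: "act_r v m \<Longrightarrow> recv_holds (2 * v) (m - Ev v) s1"
    using recv rq(1) by (simp add: recv_holds_def)
  have send1: "act_s v m \<Longrightarrow> send_holds v (m - Suc (Ev v)) s1"
    using send rq(1) by (simp add: send_holds_def)
  let ?P = "\<lambda>s2. core v m 1 (popsB v m) (act_r v m) s2 \<and> (act_s v m \<longrightarrow> send_holds v (m - Suc (Ev v)) s2) \<and> ?ask s2"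
  let ?fin = "block [Const rPar 0, Op Add rM rM rOne]"
  have fin: "wp w h (block [?fin]) s2 20 (postB m v)" if s2: "?P s2" for s2
  proof (rule wp_sem)
    have r: "regs s2 rM = m" "regs s2 rOne = 1" using s2 by (simp_all add: core_def stat_def)
    have e: "sem w h (block [?fin]) s2 = set_reg rM (Suc m) (set_reg rPar 0 s2)"
      using m_less[of "Suc m"] m by (simp add: r)
    show "postB m v (sem w h (block [?fin]) s2)" unfolding e postB_def sched_simps(1,2)
      using s2 by (simp add: core_def stat_def stored_def asks_def send_holds_def)
  qed simp_all
  let ?b = "block [Op Sub rBase rM rE, Op Div rBase rBase rQ, Op Mul rBase rBase MsgLen]"
  let ?data = "block [?b, Cond rLeft add_received Skip]"
  have data: "wp w h ?data s1 (g * 55 + 20) ?P" if act: "act_r v m"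
  proof -
    define t where "t = m - Ev v"
    have t: "t < NB" "popsB v m = t" using sched_simps[where v = v and m = m] act by (simp_all add: t_def)
    let ?base = "t div q * g"
    define s2 where "s2 = sem w h ?b s1"
    have K2: "keep {} s1 s2" by (simp add: s2_def)
    have r: "regs s1 rM = m" "regs s1 rE = Ev v" "regs s1 rQ = q" "regs s1 MsgLen = g"
      using core1 by (simp_all add: core_def stat_def)
    have mm: "(m + 2 ^ w - Ev v) mod 2 ^ w = t"
      using sub_wrap[of "Ev v" m w] m_less[of m] m act by (simp add: act_r_def t_def)
    have bm: "?base mod 2 ^ w = ?base" using group_bound[OF t(1)] J_less by simp
    have b2: "regs s2 rBase = ?base" by (simp add: s2_def r mm bm)
    have core2: "core v m 1 t False s2"
      using core1 keep_regs[OF K2] keep_mem[OF K2] act t by (simp add: core_def stored_def stat_def)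
    have recv2: "recv_holds (2 * v) t s2" using recv1[OF act] keep_mem[OF K2] by (simp add: recv_holds_def t_def)
    let ?V = "\<lambda>j. if j div g = t div q then cur v t False j + dig j (2 * v) (t mod q) else cur v t False j"
    have V: "?V = cur v t True" using cur_left by (simp add: fun_eq_iff)
    have "wp w h (Cond rLeft add_received Skip) s2 (g * 20 + 5) (\<lambda>s'. keep {Arr 0, Arr 4} s2 s' \<and>
        regs s' rBase = ?base \<and> stored s' (Arr 0) (Arr 4) ?V)"
      by (rule wp_add_child[OF t(1) v _ b2 recv2]) (use core2 in \<open>auto simp: core_def\<close>)
    then have "wp w h (Cond rLeft add_received Skip) s2 (g * 20 + 5) ?P"
      unfolding V
    proof (rule wp_mono[OF _ order_refl])
      fix s' assume s': "keep {Arr 0, Arr 4} s2 s' \<and> regs s' rBase = ?base \<and> stored s' (Arr 0) (Arr 4) (cur v t True)"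
      then have K: "keep {Arr 0, Arr 4} s2 s'" by blast
      have regs': "regs s' r = regs s1 r" if "\<not> scratch r" for r
        using keep_regs[OF K that] keep_regs[OF K2 that] by simp
      have mem': "mem s' A = mem s1 A" if "A \<notin> {Arr 0, Arr 4}" for A
        using keep_mem[OF K that] keep_mem[OF K2] by simp
      have "stat v s'" using core1 regs' by (simp add: core_def stat_def)
      then have "core v m 1 t True s'" using s' core1 regs' mem' t by (simp add: core_def stored_def)
      moreover have "?ask s'" using ask1 regs' by (simp add: asks_def)
      moreover have "act_s v m \<longrightarrow> send_holds v (m - Suc (Ev v)) s'" using send1 mem' by (simp add: send_holds_def)
      ultimately show "?P s'" using act t by simp
    qed
    then have ad: "wp w h (block [Cond rLeft add_received Skip]) s2 (g * 20 + 6) ?P"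
      unfolding block.simps(2)[of "Cond rLeft add_received Skip"]
      by (intro wp_Seq[where ?B1.0 = "g * 20 + 5" and ?B2.0 = 1]) (auto elim!: wp_mono intro!: wp_sem)
    show ?thesis unfolding block.simps(2)[of ?b]
      by (rule wp_Seq[where ?B1.0 = 5 and ?B2.0 = "g * 20 + 6"], rule wp_sem, simp, simp,
          unfold s2_def[symmetric], rule ad) simp
  qed
  have "wp w h (Cond rRcv ?data Skip) s1 (g * 55 + 21) ?P"
  proof (rule wp_Cond[where B = "g * 55 + 20"])
    assume "regs s1 rRcv = 0"
    then have na: "\<not> act_r v m" using rq(4) by simp
    then have "?P s1" using core1 ask1 send1 by simp
    then show "wp w h Skip s1 (g * 55 + 20) ?P" by (intro wp_sem) simp_all
  qed (use data rq(4) in auto)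
  then have mid: "wp w h (block [Cond rRcv ?data Skip, ?fin]) s1 (g * 55 + 41) (postB m v)"
    unfolding block.simps(2)[of "Cond rRcv ?data Skip"]
    by (intro wp_Seq[where ?B1.0 = "g * 55 + 21" and ?B2.0 = 20])
      (erule wp_mono, simp, rule fin, blast+, simp)
  show ?thesis unfolding stepB_def block.simps(2)[of "request rDestB rRight"]
    by (rule wp_Seq[where ?B1.0 = 25 and ?B2.0 = "g * 55 + 41"], rule wp_sem, simp add: request_def,
        simp add: request_def, unfold s1_def[symmetric], rule mid) simp
qed

definition "step_time = g * 55 + 75"

lemma wp_checker_A:
  assumes v: "1 \<le> v" "v \<le> p" and inv: "invA m v s" and m: "m \<le> D + NB"
  shows "wp w h (checker k) s step_time (\<lambda>s'. if m = D + NB then final v s' else postA m v s')"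
proof -
  have r: "regs s rStarted \<noteq> 0" "regs s rPar = 0" using inv by (simp_all add: invA_def core_def stat_def)
  define Q where "Q = (\<lambda>s' :: pe. if m = D + NB then final v s' else postA m v s')"
  show ?thesis unfolding checker_def step_time_def Q_def[symmetric]
    by (rule wp_Seq[where ?B1.0 = 3 and ?B2.0 = "g * 55 + 71"],
        rule wp_Cond[where B = 1], rule wp_sem, simp, simp, simp,
        rule wp_Cond[where B = "g * 55 + 70"])
      (use r wp_stepA[OF v inv m, folded Q_def] in simp_all)
qed

lemma wp_checker_B:
  assumes v: "1 \<le> v" "v \<le> p" and inv: "invB m v s" and m: "m < D + NB"
  shows "wp w h (checker k) s step_time (postB m v)"
proof -
  have r: "regs s rStarted \<noteq> 0" "regs s rPar \<noteq> 0" using inv by (simp_all add: invB_def core_def stat_def)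
  show ?thesis unfolding checker_def step_time_def
    by (rule wp_Seq[where ?B1.0 = 3 and ?B2.0 = "g * 55 + 71"],
        rule wp_Cond[where B = 1], rule wp_sem, simp, simp, simp,
        rule wp_Cond[where B = "g * 55 + 70"])
      (use r wp_stepB[OF v inv m] in simp_all)
qed

lemma wp_checker_first:
  assumes i: "i < p" and m: "0 < D + NB"
  shows "wp w h (checker k) (init w p n \<delta> la lb i) (init_time i + step_time) (postA 0 (Suc i))"
  unfolding checker_def
proof (rule wp_Seq[where ?B1.0 = "init_time i + 1" and ?B2.0 = "g * 55 + 71"])
  have r: "regs (init w p n \<delta> la lb i) rStarted = 0" by (simp add: init_def)
  have "wp w h (initialise k) (init w p n \<delta> la lb i) (init_time i)
    (\<lambda>s1. wp w h (Cond rPar stepB stepA) s1 (g * 55 + 71) (postA 0 (Suc i)))"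
  proof (rule wp_mono[OF wp_initialise[OF i] order_refl])
    fix s :: pe assume s: "ready (Suc i) s"
    have "wp w h stepA s (g * 55 + 70) (postA 0 (Suc i))"
      by (rule wp_mono[OF wp_stepA[OF _ _ ready_invA[OF s]] order_refl]) (use i m in \<open>auto split: if_splits\<close>)
    moreover have "regs s rPar = 0" using s by (simp add: ready_def)
    ultimately show "wp w h (Cond rPar stepB stepA) s (g * 55 + 71) (postA 0 (Suc i))"
      by (intro wp_Cond[where B = "g * 55 + 70"]) simp_all
  qed
  then show "wp w h (Cond rStarted Skip (initialise k)) (init w p n \<delta> la lb i) (init_time i + 1)
    (\<lambda>s1. wp w h (Cond rPar stepB stepA) s1 (g * 55 + 71) (postA 0 (Suc i)))"
    using r by (intro wp_Cond[where B = "init_time i"]) simp_all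
qed (simp add: step_time_def)

end


subsection \<open>The whole network\<close>

text \<open>The final states of the local computations are obtained by choice from the
  \<open>wp\<close> assumptions, so the continuation has to work for every family of states
  satisfying \<open>Q\<close>.\<close>

lemma superstep:
  assumes p: "1 \<le> p" and nf: "\<And>i. i < p \<Longrightarrow> \<not> finished (S i)"
    and wps: "\<And>i. i < p \<Longrightarrow> wp w h prog (S i) B (Q i)"
    and cont: "\<And>S1. (\<And>i. i < p \<Longrightarrow> Q i (S1 i)) \<Longrightarrow> matched p S1 \<and> exchange_time \<alpha> \<beta> p S1 \<le> X \<and>
      (\<exists>T S'. run w h prog \<alpha> \<beta> p (exchange S1) T S' \<and> T \<le> Y \<and> R S')"
  shows "\<exists>T S'. run w h prog \<alpha> \<beta> p S T S' \<and> T \<le> real B + X + Y \<and> R S'"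
proof -
  have "\<forall>i. \<exists>ts. i < p \<longrightarrow> exec w h prog (S i) (fst ts) (snd ts) \<and> fst ts \<le> B \<and> Q i (snd ts)"
    using wps unfolding wp_def by fastforce
  then obtain F where F: "\<And>i. i < p \<Longrightarrow> exec w h prog (S i) (fst (F i)) (snd (F i)) \<and> fst (F i) \<le> B \<and> Q i (snd (F i))"
    by metis
  define t S1 where "t i = fst (F i)" and "S1 i = snd (F i)" for i
  have Q: "\<And>i. i < p \<Longrightarrow> Q i (S1 i)" and tB: "\<And>i. i < p \<Longrightarrow> t i \<le> B"
    using F by (auto simp: t_def S1_def)
  obtain T S' where r: "matched p S1" "exchange_time \<alpha> \<beta> p S1 \<le> X"
      "run w h prog \<alpha> \<beta> p (exchange S1) T S'" "T \<le> Y" "R S'"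
    using cont[OF Q] by blast
  have "run w h prog \<alpha> \<beta> p S (real (Max (t ` {..<p})) + exchange_time \<alpha> \<beta> p S1 + T) S'"
  proof (rule run_step[OF _ _ r(1,3)])
    show "\<not> (\<forall>i<p. finished (S i))" using nf[of 0] p by (auto simp: Suc_le_eq)
    show "\<forall>i<p. local_phase w h prog (S i) (t i) (S1 i)"
      using F nf by (auto simp: local_phase_def t_def S1_def)
  qed
  moreover have "Max (t ` {..<p}) \<le> B" using tB p by (subst Max_le_iff) (auto simp: lessThan_empty_iff)
  ultimately show ?thesis using r by (intro exI[of _ "real (Max (t ` {..<p})) + exchange_time \<alpha> \<beta> p S1 + T"] exI[of _ S']) simp
qed

context problem
begin

lemma Ev_child:
  assumes "1 \<le> u" "c = 2 * u \<or> c = 2 * u + 1" "c \<le> p"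
  shows "Ev u = Suc (Ev c)"
proof -
  have "c div 2 = u" "2 \<le> c" using assms by auto
  then have "floor_log c = Suc (floor_log u)" using floor_log_rec[of c] by (simp del: floor_log_half)
  then show ?thesis using floor_log_le_D[OF assms(3)] by (simp add: Ev_def)
qed

text \<open>A child sends in precisely the rounds in which its parent receives, and both count the
  same block, because their heights differ by one. This is what makes every send meet a
  receive.\<close>

lemma act_child:
  assumes "1 \<le> u" "c = 2 * u \<or> c = 2 * u + 1" "c \<le> p"
  shows "act_s c m \<longleftrightarrow> act_r u m" "m - Suc (Ev c) = m - Ev u"
  using Ev_child[OF assms] by (auto simp: act_s_def act_r_def)

text \<open>A single PE never sends, and it must not be charged \<alpha>: the corresponding term of
  the time bound vanishes for \<open>p = 1\<close>.\<close>

definition "comm \<alpha> \<beta> = (if p = 1 then 0 else \<alpha> + \<beta> * real (g * b))"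

text \<open>Supersteps A and B differ only in the children that send: even nodes are left children,
  odd ones right children. The flag \<open>odd_child\<close> treats both at once.\<close>

lemma exchange_children:
  fixes odd_child :: bool and S1 :: "nat \<Rightarrow> pe"
  defines "child v \<equiv> 2 * v + of_bool odd_child"
  assumes post: "\<And>i. i < p \<Longrightarrow> stat (Suc i) (S1 i) \<and> regs (S1 i) Done = 0 \<and>
     (act_s (Suc i) m \<longrightarrow> send_holds (Suc i) (m - Suc (Ev (Suc i))) (S1 i)) \<and>
     asks (S1 i) (if act_s (Suc i) m \<and> odd (Suc i) = odd_child then Suc i div 2 else 0)
       (if act_r (Suc i) m \<and> child (Suc i) \<le> p then child (Suc i) else 0)"
    and ab: "0 \<le> \<alpha>" "0 \<le> \<beta>"
  shows "matched p S1" "exchange_time \<alpha> \<beta> p S1 \<le> comm \<alpha> \<beta>"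
    "i < p \<Longrightarrow> \<exists>f. exchange S1 i = (S1 i)\<lparr>mem := (mem (S1 i))(Recv := f)\<rparr>"
    "i < p \<Longrightarrow> act_r (Suc i) m \<Longrightarrow> recv_holds (child (Suc i)) (m - Ev (Suc i)) (exchange S1 i)"
proof -
  have sends: "sends_to (S1 i) j \<longleftrightarrow> act_s (Suc i) m \<and> odd (Suc i) = odd_child \<and> Suc i div 2 = Suc j"
    if "i < p" for i j
    using post[OF that] by (auto simp: sends_to_def finished_def asks_def split: if_splits)
  have recvs: "receives_from (S1 j) i \<longleftrightarrow> act_r (Suc j) m \<and> child (Suc j) \<le> p \<and> child (Suc j) = Suc i"
    if "j < p" for i j
    using post[OF that] by (auto simp: receives_from_def finished_def asks_def split: if_splits)
  have ch: "child u = 2 * u \<or> child u = 2 * u + 1" for u by (simp add: child_def)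
  show matched: "matched p S1"
    unfolding matched_def
  proof (intro conjI allI impI)
    fix i j assume i: "i < p" and "sends_to (S1 i) j"
    then have s: "act_s (Suc i) m" "odd (Suc i) = odd_child" "Suc i div 2 = Suc j" using sends by auto
    have c: "child (Suc j) = Suc i"
      unfolding child_def s(3)[symmetric] s(2)[symmetric] by (cases "odd (Suc i)") (simp_all add: even_two_times_div_two odd_two_times_div_two_succ)
    show j: "j < p" using s(3) i by linarith
    have "act_r (Suc j) m" using act_child(1)[of "Suc j" "Suc i"] ch[of "Suc j"] c s(1) i by auto
    then show "receives_from (S1 j) i" using recvs[OF j] c i by auto
  next
    fix i j assume j: "j < p" and "receives_from (S1 j) i"
    then have s: "act_r (Suc j) m" "child (Suc j) \<le> p" "child (Suc j) = Suc i" using recvs by auto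
    show i: "i < p" using s by simp
    have "act_s (Suc i) m" using act_child(1)[of "Suc j" "Suc i"] ch[of "Suc j"] s by auto
    moreover have "odd (Suc i) = odd_child" "Suc i div 2 = Suc j"
      unfolding s(3)[symmetric] child_def by (cases odd_child; simp)+
    ultimately show "sends_to (S1 i) j" using sends[OF i] by auto
  qed
  show "exchange_time \<alpha> \<beta> p S1 \<le> comm \<alpha> \<beta>"
  proof -
    define I where "I = {i. i < p \<and> (\<exists>j. sends_to (S1 i) j)}"
    have bits: "msg_bits (S1 i) = g * b" if "i \<in> I" for i
      using post[of i] that by (simp add: I_def msg_bits_def stat_def)
    have fin: "finite I" by (simp add: I_def)
    show ?thesis
    proof (cases "I = {}")
      case True
      then show ?thesis using ab by (simp add: exchange_time_def flip: I_def add: comm_def)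
    next
      case False
      then obtain i j where ij: "i < p" "sends_to (S1 i) j" by (auto simp: I_def)
      \<comment> \<open>A sender has a parent and is therefore not the root, so there are at least
        two PEs.\<close>
      then have "Suc i div 2 = Suc j" using sends by auto
      then have "p \<noteq> 1" using ij(1) by auto
      then have c: "comm \<alpha> \<beta> = \<alpha> + \<beta> * real (g * b)" by (simp add: comm_def)
      have "Max ((\<lambda>i. \<alpha> + \<beta> * real (msg_bits (S1 i))) ` I) \<le> comm \<alpha> \<beta>"
        using False fin bits by (subst Max_le_iff) (auto simp: c)
      then show ?thesis using False by (simp add: exchange_time_def Let_def flip: I_def)
    qed
  qed
  show "\<exists>f. exchange S1 i = (S1 i)\<lparr>mem := (mem (S1 i))(Recv := f)\<rparr>"
  proof (cases "\<exists>j. receives_from (S1 i) j")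
    case False
    then have "exchange S1 i = (S1 i)\<lparr>mem := (mem (S1 i))(Recv := mem (S1 i) Recv)\<rparr>"
      by (simp add: exchange_def)
    then show ?thesis by blast
  qed (auto simp: exchange_def)
  show "recv_holds (child (Suc i)) (m - Ev (Suc i)) (exchange S1 i)" if i: "i < p" and act: "act_r (Suc i) m"
    unfolding recv_holds_def
  proof (intro impI allI)
    fix x assume c: "child (Suc i) \<le> p" and x: "x < g"
    define u where "u = child (Suc i) - 1"
    have u: "Suc u = child (Suc i)" "u < p" using c by (simp_all add: u_def child_def)
    have rf: "receives_from (S1 i) u" using recvs[OF i] act c u by simp
    then have src: "regs (S1 i) Source - Suc 0 = u" by (simp add: receives_from_def)
    have "mem (exchange S1 i) Recv = message (S1 u)"
      using rf by (auto simp: exchange_def src)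
    moreover have "message (S1 u) x = digit (Suc u) (m - Suc (Ev (Suc u))) x"
    proof -
      have "act_s (Suc u) m" using act_child(1)[of "Suc i" "Suc u"] ch[of "Suc i"] act c u by auto
      then have "send_holds (Suc u) (m - Suc (Ev (Suc u))) (S1 u)" "regs (S1 u) MsgLen = g" "regs (S1 u) MsgBits = b"
        using post[OF u(2)] by (simp_all add: stat_def)
      then show ?thesis using x by (simp add: message_def send_holds_def digit_def dig_def)
    qed
    moreover have "m - Suc (Ev (Suc u)) = m - Ev (Suc i)"
      using act_child(2)[of "Suc i" "Suc u"] ch[of "Suc i"] c u by auto
    ultimately show "mem (exchange S1 i) Recv x = digit (child (Suc i)) (m - Ev (Suc i)) x"
      by (simp add: u)
  qed
qed

lemma core_Recv: "core v m par T fl (s\<lparr>mem := (mem s)(Recv := f)\<rparr>) \<longleftrightarrow> core v m par T fl s"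
  by (simp add: core_def stat_def stored_def)

lemma send_Recv: "send_holds v t (s\<lparr>mem := (mem s)(Recv := f)\<rparr>) \<longleftrightarrow> send_holds v t s"
  by (simp add: send_holds_def)

lemma exchange_A:
  fixes S1 :: "nat \<Rightarrow> pe"
  assumes post: "\<And>i. i < p \<Longrightarrow> postA m (Suc i) (S1 i)" and ab: "0 \<le> \<alpha>" "0 \<le> \<beta>"
  shows "matched p S1" "exchange_time \<alpha> \<beta> p S1 \<le> comm \<alpha> \<beta>"
    "i < p \<Longrightarrow> invB m (Suc i) (exchange S1 i)"
proof -
  have *: "stat (Suc i) (S1 i) \<and> regs (S1 i) Done = 0 \<and>
     (act_s (Suc i) m \<longrightarrow> send_holds (Suc i) (m - Suc (Ev (Suc i))) (S1 i)) \<and>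
     asks (S1 i) (if act_s (Suc i) m \<and> odd (Suc i) = False then Suc i div 2 else 0)
       (if act_r (Suc i) m \<and> 2 * Suc i + of_bool False \<le> p then 2 * Suc i + of_bool False else 0)" if "i < p" for i
  proof -
    have e: "(if act_r v m \<and> 2 * v + of_bool False \<le> p then 2 * v + of_bool False else 0) =
        (if act_r v m then left v else 0)" for v by (simp add: left_def)
    show ?thesis using post[OF that] unfolding postA_def core_def e by simp
  qed
  note ex = exchange_children[OF *, of \<alpha> \<beta>, OF _ ab]
  show "matched p S1" "exchange_time \<alpha> \<beta> p S1 \<le> comm \<alpha> \<beta>" using ex(1,2) by simp_all
  assume i: "i < p"
  obtain f where f: "exchange S1 i = (S1 i)\<lparr>mem := (mem (S1 i))(Recv := f)\<rparr>" using ex(3)[OF _ i] by blast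
  have "act_r (Suc i) m \<longrightarrow> recv_holds (2 * Suc i) (m - Ev (Suc i)) (exchange S1 i)"
    using ex(4)[OF _ i] by simp
  then show "invB m (Suc i) (exchange S1 i)"
    using post[OF i] unfolding invB_def postA_def f core_Recv send_Recv by blast
qed

lemma exchange_B:
  fixes S1 :: "nat \<Rightarrow> pe"
  assumes post: "\<And>i. i < p \<Longrightarrow> postB m (Suc i) (S1 i)" and ab: "0 \<le> \<alpha>" "0 \<le> \<beta>"
  shows "matched p S1" "exchange_time \<alpha> \<beta> p S1 \<le> comm \<alpha> \<beta>"
    "i < p \<Longrightarrow> invA (Suc m) (Suc i) (exchange S1 i)"
proof -
  have *: "stat (Suc i) (S1 i) \<and> regs (S1 i) Done = 0 \<and>
     (act_s (Suc i) m \<longrightarrow> send_holds (Suc i) (m - Suc (Ev (Suc i))) (S1 i)) \<and>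
     asks (S1 i) (if act_s (Suc i) m \<and> odd (Suc i) = True then Suc i div 2 else 0)
       (if act_r (Suc i) m \<and> 2 * Suc i + of_bool True \<le> p then 2 * Suc i + of_bool True else 0)" if "i < p" for i
  proof -
    have e: "(if act_r v m \<and> 2 * v + of_bool True \<le> p then 2 * v + of_bool True else 0) =
        (if act_r v m then right v else 0)" for v by (simp add: right_def)
    show ?thesis using post[OF that] unfolding postB_def core_def e by simp
  qed
  note ex = exchange_children[OF *, of \<alpha> \<beta>, OF _ ab]
  show "matched p S1" "exchange_time \<alpha> \<beta> p S1 \<le> comm \<alpha> \<beta>" using ex(1,2) by simp_all
  assume i: "i < p"
  obtain f where f: "exchange S1 i = (S1 i)\<lparr>mem := (mem (S1 i))(Recv := f)\<rparr>" using ex(3)[OF _ i] by blast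
  have "act_s (Suc i) (Suc m) \<longrightarrow> recv_holds (2 * Suc i + 1) (Suc m - Suc (Ev (Suc i))) (exchange S1 i)"
    using ex(4)[OF _ i] by (simp add: sched_simps(2))
  then show "invA (Suc m) (Suc i) (exchange S1 i)"
    using post[OF i] unfolding invA_def postB_def f core_Recv by blast
qed

definition "verdict \<longleftrightarrow> (\<forall>t<NB. \<forall>x<g. digit 1 t x = xdigit t)"

text \<open>Every remaining round takes two supersteps, except the final one, which ends after
  superstep A.\<close>

lemma run_from_A:
  assumes "m \<le> D + NB" "\<And>i. i < p \<Longrightarrow> invA m (Suc i) (St i)" and ab: "0 \<le> \<alpha>" "0 \<le> \<beta>"
  shows "\<exists>T S'. run w h (checker k) \<alpha> \<beta> p St T S' \<and>
    T \<le> real (2 * (D + NB - m) + 1) * (real step_time + comm \<alpha> \<beta>) \<and> (accepting S' \<longleftrightarrow> verdict)"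
  using assms(1,2)
proof (induction "D + NB - m" arbitrary: m St)
  case 0
  then have m: "m = D + NB" by simp
  have comm: "0 \<le> comm \<alpha> \<beta>" using ab by (simp add: comm_def)
  have "\<exists>T S'. run w h (checker k) \<alpha> \<beta> p St T S' \<and> T \<le> real step_time + comm \<alpha> \<beta> + 0 \<and> (accepting S' \<longleftrightarrow> verdict)"
  proof (rule superstep[where Q = "\<lambda>i. final (Suc i)", OF p(1)])
    fix i assume i: "i < p"
    show "\<not> finished (St i)" using 0(3)[OF i] by (simp add: invA_def core_def finished_def)
    show "wp w h (checker k) (St i) step_time (final (Suc i))"
      using wp_checker_A[OF _ _ 0(3)[OF i] 0(2)] i m by simp
  next
    fix S1 :: "nat \<Rightarrow> pe" assume f: "\<And>i. i < p \<Longrightarrow> final (Suc i) (S1 i)"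
    have fin: "\<And>i. i < p \<Longrightarrow> finished (S1 i)" using f by (simp add: final_def finished_def)
    then have ns: "\<not> sends_to (S1 i) j" "\<not> receives_from (S1 i) j" if "i < p" for i j
      using that by (simp_all add: sends_to_def receives_from_def)
    have ex: "\<And>i. i < p \<Longrightarrow> exchange S1 i = S1 i" using ns by (simp add: exchange_def)
    have "run w h (checker k) \<alpha> \<beta> p (exchange S1) 0 (exchange S1)"
      by (rule run_done) (use ex fin in auto)
    moreover have "accepting (exchange S1) \<longleftrightarrow> verdict"
      using f[of 0] ex[of 0] p(1) by (simp add: accepting_def final_def verdict_def)
    moreover have "matched p S1" using ns by (auto simp: matched_def)
    moreover have "exchange_time \<alpha> \<beta> p S1 \<le> comm \<alpha> \<beta>"
    proof -
      have "{i. i < p \<and> (\<exists>j. sends_to (S1 i) j)} = {}" using ns by auto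
      then show ?thesis using comm unfolding exchange_time_def by simp
    qed
    ultimately show "matched p S1 \<and> exchange_time \<alpha> \<beta> p S1 \<le> comm \<alpha> \<beta> \<and>
      (\<exists>T S'. run w h (checker k) \<alpha> \<beta> p (exchange S1) T S' \<and> T \<le> 0 \<and> (accepting S' \<longleftrightarrow> verdict))"
      by blast
  qed
  then show ?case using m by simp
next
  case (Suc d)
  then have m: "m < D + NB" by simp
  let ?c = "real step_time + comm \<alpha> \<beta>"
  let ?Y = "real (2 * d + 1) * ?c"
  have B: "\<exists>T S'. run w h (checker k) \<alpha> \<beta> p S2 T S' \<and> T \<le> real step_time + comm \<alpha> \<beta> + ?Y \<and> (accepting S' \<longleftrightarrow> verdict)"
    if S2: "\<And>i. i < p \<Longrightarrow> invB m (Suc i) (S2 i)" for S2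
  proof (rule superstep[where Q = "\<lambda>i. postB m (Suc i)", OF p(1)])
    fix i assume i: "i < p"
    show "\<not> finished (S2 i)" using S2[OF i] by (simp add: invB_def core_def finished_def)
    show "wp w h (checker k) (S2 i) step_time (postB m (Suc i))"
      using wp_checker_B[OF _ _ S2[OF i] m] i by simp
  next
    fix S1 :: "nat \<Rightarrow> pe" assume post: "\<And>i. i < p \<Longrightarrow> postB m (Suc i) (S1 i)"
    note ex = exchange_B[where m = m and ?S1.0 = S1, OF post ab]
    have "\<exists>T S'. run w h (checker k) \<alpha> \<beta> p (exchange S1) T S' \<and>
      T \<le> real (2 * (D + NB - Suc m) + 1) * ?c \<and> (accepting S' \<longleftrightarrow> verdict)"
      by (rule Suc.hyps(1)) (use Suc.hyps(2) m ex(3) in auto)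
    moreover have "D + NB - Suc m = d" using Suc.hyps(2) by simp
    ultimately show "matched p S1 \<and> exchange_time \<alpha> \<beta> p S1 \<le> comm \<alpha> \<beta> \<and>
      (\<exists>T S'. run w h (checker k) \<alpha> \<beta> p (exchange S1) T S' \<and> T \<le> ?Y \<and> (accepting S' \<longleftrightarrow> verdict))"
      using ex(1,2) by simp
  qed
  have "\<exists>T S'. run w h (checker k) \<alpha> \<beta> p St T S' \<and>
      T \<le> real step_time + comm \<alpha> \<beta> + (real step_time + comm \<alpha> \<beta> + ?Y) \<and> (accepting S' \<longleftrightarrow> verdict)"
  proof (rule superstep[where Q = "\<lambda>i. postA m (Suc i)", OF p(1)])
    fix i assume i: "i < p"
    show "\<not> finished (St i)" using Suc.prems(2)[OF i] by (simp add: invA_def core_def finished_def)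
    show "wp w h (checker k) (St i) step_time (postA m (Suc i))"
      using wp_checker_A[OF _ _ Suc.prems(2)[OF i] Suc.prems(1)] i m by simp
  next
    fix S1 :: "nat \<Rightarrow> pe" assume post: "\<And>i. i < p \<Longrightarrow> postA m (Suc i) (S1 i)"
    note ex = exchange_A[where m = m and ?S1.0 = S1, OF post ab]
    show "matched p S1 \<and> exchange_time \<alpha> \<beta> p S1 \<le> comm \<alpha> \<beta> \<and>
      (\<exists>T S'. run w h (checker k) \<alpha> \<beta> p (exchange S1) T S' \<and> T \<le> real step_time + comm \<alpha> \<beta> + ?Y \<and> (accepting S' \<longleftrightarrow> verdict))"
      using ex(1,2) B[OF ex(3)] by simp
  qed
  moreover have "real step_time + comm \<alpha> \<beta> + (real step_time + comm \<alpha> \<beta> + ?Y) = real (2 * (D + NB - m) + 1) * ?c"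
    unfolding Suc.hyps(2)[symmetric] by (simp add: algebra_simps)
  ultimately show ?case by simp
qed

text \<open>Round 0 is unrolled because its first superstep starts from \<open>init\<close> and also
  performs the initialisation. It is not the final round, since \<open>NB\<close> is
  positive.\<close>

lemma run_checker:
  assumes ab: "0 \<le> \<alpha>" "0 \<le> \<beta>" and IT: "\<And>i. i < p \<Longrightarrow> init_time i \<le> IT"
  shows "\<exists>T S'. run w h (checker k) \<alpha> \<beta> p (init w p n \<delta> la lb) T S' \<and>
    T \<le> real IT + real (2 * (D + NB) + 1) * (real step_time + comm \<alpha> \<beta>) \<and> (accepting S' \<longleftrightarrow> verdict)"
proof -
  let ?c = "real step_time + comm \<alpha> \<beta>"
  have NB: "0 < NB" using q G by (simp add: NB_def)
  let ?d = "D + NB - 1"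
  have B: "\<exists>T S'. run w h (checker k) \<alpha> \<beta> p S2 T S' \<and>
      T \<le> real step_time + comm \<alpha> \<beta> + real (2 * ?d + 1) * ?c \<and> (accepting S' \<longleftrightarrow> verdict)"
    if S2: "\<And>i. i < p \<Longrightarrow> invB 0 (Suc i) (S2 i)" for S2
  proof (rule superstep[where Q = "\<lambda>i. postB 0 (Suc i)", OF p(1)])
    fix i assume i: "i < p"
    show "\<not> finished (S2 i)" using S2[OF i] by (simp add: invB_def core_def finished_def)
    show "wp w h (checker k) (S2 i) step_time (postB 0 (Suc i))"
      using wp_checker_B[OF _ _ S2[OF i]] i NB by simp
  next
    fix S1 :: "nat \<Rightarrow> pe" assume post: "\<And>i. i < p \<Longrightarrow> postB 0 (Suc i) (S1 i)"
    note ex = exchange_B[where m = 0 and ?S1.0 = S1, OF post ab]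
    show "matched p S1 \<and> exchange_time \<alpha> \<beta> p S1 \<le> comm \<alpha> \<beta> \<and>
      (\<exists>T S'. run w h (checker k) \<alpha> \<beta> p (exchange S1) T S' \<and> T \<le> real (2 * ?d + 1) * ?c \<and> (accepting S' \<longleftrightarrow> verdict))"
      using ex(1,2) run_from_A[OF _ ex(3) ab] NB by simp
  qed
  have "\<exists>T S'. run w h (checker k) \<alpha> \<beta> p (init w p n \<delta> la lb) T S' \<and>
      T \<le> real (IT + step_time) + comm \<alpha> \<beta> + (real step_time + comm \<alpha> \<beta> + real (2 * ?d + 1) * ?c) \<and> (accepting S' \<longleftrightarrow> verdict)"
  proof (rule superstep[where Q = "\<lambda>i. postA 0 (Suc i)", OF p(1)])
    fix i assume i: "i < p"
    show "\<not> finished (init w p n \<delta> la lb i)" by (simp add: init_def finished_def)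
    show "wp w h (checker k) (init w p n \<delta> la lb i) (IT + step_time) (postA 0 (Suc i))"
      by (rule wp_mono[OF wp_checker_first[OF i]]) (use NB IT[OF i] in auto)
  next
    fix S1 :: "nat \<Rightarrow> pe" assume post: "\<And>i. i < p \<Longrightarrow> postA 0 (Suc i) (S1 i)"
    note ex = exchange_A[where m = 0 and ?S1.0 = S1, OF post ab]
    show "matched p S1 \<and> exchange_time \<alpha> \<beta> p S1 \<le> comm \<alpha> \<beta> \<and>
      (\<exists>T S'. run w h (checker k) \<alpha> \<beta> p (exchange S1) T S' \<and>
        T \<le> real step_time + comm \<alpha> \<beta> + real (2 * ?d + 1) * ?c \<and> (accepting S' \<longleftrightarrow> verdict))"
      using ex(1,2) B[OF ex(3)] by simp
  qed
  moreover have "real (IT + step_time) + comm \<alpha> \<beta> + (real step_time + comm \<alpha> \<beta> + real (2 * ?d + 1) * ?c)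
     = real IT + real (2 * (D + NB) + 1) * ?c"
  proof -
    obtain d where d: "D + NB = Suc d" using NB by (cases "D + NB") auto
    show ?thesis unfolding d by (simp add: algebra_simps)
  qed
  ultimately show ?thesis by (simp only:)
qed

lemma verdict_iff: "verdict \<longleftrightarrow> (\<forall>j<J. S j 1 mod 2 ^ (b * q) = X mod 2 ^ (b * q))"
proof
  assume v: verdict
  show "\<forall>j<J. S j 1 mod 2 ^ (b * q) = X mod 2 ^ (b * q)"
  proof (intro allI impI digits_eq_imp_mod_eq)
    fix j e assume j: "j < J" and e: "e < q"
    \<comment> \<open>The block that carries digit \<open>e\<close> of sum \<open>j\<close>; within
      this block the sum has position \<open>j mod g\<close>.\<close>
    define t where "t = j div g * q + e"
    have td: "t div q = j div g" "t mod q = e" using e by (simp_all add: t_def)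
    have "j div g < G" using j unfolding J_def by (rule less_mult_imp_div_less)
    then have "Suc (j div g) * q \<le> NB" unfolding NB_def by (intro mult_le_mono1) simp
    then have "t < NB" using e by (simp add: t_def)
    moreover have "j mod g < g" using g(1) by simp
    ultimately have "digit 1 t (j mod g) = xdigit t" using v by (simp add: verdict_def)
    then show "S j 1 div 2 ^ (b * e) mod 2 ^ b = X div 2 ^ (b * e) mod 2 ^ b"
      by (simp add: digit_def xdigit_def dig_def td)
  qed
next
  assume *: "\<forall>j<J. S j 1 mod 2 ^ (b * q) = X mod 2 ^ (b * q)"
  have **: "A div 2 ^ (b * e) mod 2 ^ b = A mod 2 ^ (b * q) div 2 ^ (b * e) mod 2 ^ b" if e: "e < q" for A e :: nat
  proof -
    have "b * Suc e \<le> b * q" using e by (intro mult_le_mono2) simp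
    then have be: "b * e + b \<le> b * q" by simp
    have d: "N div 2 ^ (b * e) mod 2 ^ b = N mod 2 ^ (b * e + b) div 2 ^ (b * e)" for N :: nat
      using mod_digit_split[of N "2 ^ (b * e)" "2 ^ b"] by (simp add: power_add)
    show ?thesis unfolding d using be by (simp add: mod_mod_cancel le_imp_power_dvd)
  qed
  show verdict unfolding verdict_def
  proof (intro allI impI)
    fix t x assume t: "t < NB" and x: "x < g"
    have "t mod q < q" using q by simp
    then show "digit 1 t x = xdigit t"
      unfolding digit_def dig_def xdigit_def using * ** group_less(1)[OF t x] by metis
  qed
qed

end


subsection \<open>The verdict\<close>

lemma sum_mset_image_sum: "(\<Sum>x\<in>#(\<Sum>i<p. M i). f x) = (\<Sum>i<(p::nat). \<Sum>x\<in>#M i. f x)"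
  by (induction p) simp_all

lemma sum_list_as_sum_mset: "(\<Sum>x\<leftarrow>xs. f x) = (\<Sum>x\<in>#mset xs. f x)"
  by (simp flip: sum_mset_sum_list)

context problem
begin

text \<open>The complement trick gives \<open>S j 1 + ?b = ?a + X\<close> in the natural numbers, so
  equal hash sums mean \<open>S j 1 = X\<close>. The comparison modulo \<open>2 ^ (b * q)\<close>
  loses nothing because \<open>X\<close> is below this modulus and \<open>S j 1\<close> is below
  \<open>X\<close> plus the modulus.\<close>

lemma verdict_eq_sums:
  assumes A: "mset as = (\<Sum>i<p. mset (la i))" and B: "mset bs = (\<Sum>i<p. mset (lb i))"
    and len: "length as = n" "length bs = n" and el: "set as \<subseteq> elements w k" "set bs \<subseteq> elements w k"
  shows "verdict \<longleftrightarrow> (\<forall>j<J. (\<Sum>x\<in>#mset as. hv j x) = (\<Sum>x\<in>#mset bs. hv j x))"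
proof -
  have "S j 1 mod 2 ^ (b * q) = X mod 2 ^ (b * q) \<longleftrightarrow> (\<Sum>x\<in>#mset as. hv j x) = (\<Sum>x\<in>#mset bs. hv j x)"
    if j: "j < J" for j
  proof -
    let ?a = "\<Sum>x\<leftarrow>as. hv j x" and ?b = "\<Sum>x\<leftarrow>bs. hv j x"
    have jw: "j < 2 ^ w" using j J_less by simp
    have aX: "?a \<le> X" using contrib_sum_le[OF el(1) jw, of False] len by (simp add: contrib_def X_def)
    have bX: "?b \<le> X" using contrib_sum_le[OF el(2) jw, of False] len by (simp add: contrib_def X_def)
    have neg: "(\<Sum>y\<leftarrow>bs. contrib True j y) + ?b = X"
    proof -
      have "(\<Sum>y\<leftarrow>bs. contrib True j y) + ?b = (\<Sum>y\<leftarrow>bs. contrib True j y + hv j y)"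
        by (simp add: sum_list_addf)
      also have "\<dots> = (\<Sum>y\<leftarrow>bs. 2 ^ (w - 1))"
        by (rule arg_cong[of _ _ sum_list], rule map_cong) (use el(2) hv_le[OF jw] in \<open>auto simp: contrib_def\<close>)
      finally show ?thesis by (simp add: sum_list_triv len X_def)
    qed
    have "S j 1 = (\<Sum>v=1..p. share j v)" by (simp only: S_def tree_sum_root)
    also have "\<dots> = (\<Sum>i<p. own (la i) (lb i) j)"
      by (rule sum.reindex_bij_witness[of _ Suc "\<lambda>v. v - 1"]) (auto simp: share_def)
    also have "\<dots> = (\<Sum>i<p. \<Sum>x\<in>#mset (la i). contrib False j x) + (\<Sum>i<p. \<Sum>x\<in>#mset (lb i). contrib True j x)"
      by (simp add: own_def sum.distrib sum_list_as_sum_mset)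
    also have "\<dots> = ?a + (\<Sum>y\<leftarrow>bs. contrib True j y)"
      unfolding sum_mset_image_sum[symmetric] A[symmetric] B[symmetric] sum_list_as_sum_mset
      by (simp add: contrib_def[abs_def])
    finally have Sj: "S j 1 = ?a + (\<Sum>y\<leftarrow>bs. contrib True j y)" .
    then have Sb: "S j 1 + ?b = ?a + X" using neg by linarith
    let ?M = "2 ^ (b * q) :: nat"
    have "S j 1 mod ?M = X mod ?M \<longleftrightarrow> ?a = ?b"
    proof
      assume eq: "S j 1 mod ?M = X mod ?M"
      have XM: "X mod ?M = X" using X_less by simp
      define d where "d = S j 1 div ?M"
      have Sd: "S j 1 = X + ?M * d" using eq XM mod_mult_div_eq[of "S j 1" ?M] by (simp add: d_def)
      \<comment> \<open>Here \<open>S j 1 \<le> ?a + X \<le> 2 * X\<close>, and one copy of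
        \<open>X\<close> is less than the modulus.\<close>
      have "S j 1 < X + ?M" using Sb aX X_less by linarith
      then have "?M * d < ?M * 1" using Sd by linarith
      then have "d = 0" by simp
      then show "?a = ?b" using Sd Sb by simp
    next
      assume "?a = ?b"
      then show "S j 1 mod ?M = X mod ?M" using Sb by simp
    qed
    then show ?thesis by (simp only: sum_list_as_sum_mset)
  qed
  then show ?thesis unfolding verdict_iff by blast
qed

end


subsection \<open>Running time\<close>

context params
begin

lemma D_g_le: "(D + 1) * g \<le> 8 * L + D + 1"
proof (cases "w < 8")
  case True
  then have "(D + 1) * g \<le> 8 * L" using D by (simp add: g_def mult_le_mono1)
  then show ?thesis by simp
next
  case False
  then have "g * (D + 1) \<le> L + (D + 1) - 1"
    using ceil_div_bounds(2)[OF L(1), of "D + 1"] by (simp add: g_def)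
  then show ?thesis by (simp add: mult.commute)
qed

text \<open>The communication volume of \<open>D + 1\<close> supersteps. With full-word digits,
  \<open>(D + 1) * w\<close> is at most \<open>err\<close>, so the rounding of \<open>g\<close> is
  harmless. With shorter digits, \<open>err\<close> is less than \<open>w * (D + 1)\<close>, which
  bounds \<open>g\<close> by a constant, and \<open>b * (D + 1)\<close> exceeds \<open>err\<close>
  by at most \<open>D + 1\<close>.\<close>

lemma D_g_b_le: "(D + 1) * g * b \<le> 8 * (L * w) + 3 * err + 3 * w"
proof (cases "w < 8")
  case True
  then have "(D + 1) * g * b \<le> 8 * L * w" using D
    by (intro mult_le_mono) (simp_all add: g_def b_def)
  then show ?thesis by simp
next
  case False
  define y where "y = err div (D + 1)"
  have y: "err < (y + 1) * (D + 1)" "y * (D + 1) \<le> err"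
    using dividend_less_times_div[of "D + 1" err] div_times_less_eq_dividend[of err "D + 1"]
    by (simp_all add: y_def mult.commute)
  have gD: "(D + 1) * g \<le> L + (D + 1)"
    using ceil_div_bounds(2)[OF L(1), of "D + 1"] False by (simp add: g_def mult.commute)
  show ?thesis
  proof (cases "y < w")
    case F: False
    then have "b = w" by (simp add: b_def y_def)
    then have "(D + 1) * g * b \<le> (L + (D + 1)) * w" using gD by (simp only: mult_le_mono1)
    moreover have "(D + 1) * w \<le> (D + 1) * y" using F by (intro mult_le_mono2) simp
    ultimately show ?thesis using y(2) by (simp add: algebra_simps)
  next
    case T: True
    then have b: "b = y + 1" using False by (simp add: b_def y_def)
    have "(y + 1) * (D + 1) \<le> w * (D + 1)" using T by (intro mult_le_mono1) simp
    also have "\<dots> \<le> 2 * hb * (D + 1)" using hb(2) by (rule mult_le_mono1)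
    finally have "err - 1 < 2 * (D + 1) * hb" using y(1) by (simp add: mult_ac)
    then have "(err - 1) div hb < 2 * (D + 1)" by (rule less_mult_imp_div_less)
    then have "L - 1 < 2 * (D + 1)" by (simp add: L_def)
    then have "(L - 1) div (D + 1) < 2" by (rule less_mult_imp_div_less)
    then have "g \<le> 3" using False by (simp add: g_def)
    then have "(D + 1) * g * b \<le> (D + 1) * 3 * (y + 1)"
      unfolding b by (intro mult_le_mono order_refl)
    also have "\<dots> = 3 * (y * (D + 1)) + 3 * (D + 1)" by (simp add: algebra_simps)
    also have "\<dots> \<le> 3 * err + 3 * w" using y(2) D by (intro add_mono mult_le_mono2) auto
    finally show ?thesis by simp
  qed
qed

end

text \<open>\<open>c1\<close> bounds \<open>L * w / log 2 (1 / \<delta>)\<close>, \<open>c3\<close>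
  the number of supersteps divided by \<open>D + 1\<close>, and \<open>c4\<close> the volume
  \<open>(D + 1) * g * b\<close> divided by \<open>log 2 (1 / \<delta>)\<close>. The three summands
  are the coefficients of the local work, of the \<beta> term and of the \<alpha> term.\<close>

definition time_const :: "nat \<Rightarrow> real \<Rightarrow> real \<Rightarrow> real" where
  "time_const k C K =
     (let c1 = 2 + 4 * K; c3 = 18 + 4 * K; c4 = 8 * c1 + 3 * (1 + K) + 3 * K
      in (2 * c1 * C * (4 * real k + 60) + 130 * C * K + c3 * (440 * c1 * C + 130 * C * K))
         + c3 * c4 + (10 + 132 * c3))"

text \<open>Everything is reduced to the three terms of the claim: \<open>Z\<close> is the local
  work \<open>n / p * l / w\<close>, \<open>Y\<close> is \<alpha> times \<open>log 2 p\<close>, and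
  the third is \<beta> times \<open>l\<close>. The assumption on \<alpha> turns the \<open>D\<close>
  supersteps of latency and local overhead into a multiple of \<open>Y\<close>.\<close>

lemma (in params) time_bound:
  fixes C K \<alpha> \<beta> l :: real
  assumes l: "0 < l" "real err \<le> l + 1" "l \<le> real err" and K: "real w \<le> K * l" and C: "1 \<le> C * (real n / real p)"
    and ab: "1 \<le> \<alpha>" "0 \<le> \<beta>" and len: "real len \<le> C * (real n / real p)"
  shows "real (J * (2 * len * (2 * k + 20) + 20) + 10 * D + 130)
      + real (2 * (D + NB) + 1) * (real (g * 55 + 75) + (if p = 1 then 0 else \<alpha> + \<beta> * real (g * b)))
    \<le> time_const k C K * ((real n / (real p * real w) + \<beta>) * l + \<alpha> * log 2 (real p))"
proof -
  define N a lp c1 c3 c4 where "N = real n / real p" and "a = l / real w" and "lp = log 2 (real p)"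
    and "c1 = 2 + 4 * K" and "c3 = 18 + 4 * K" and "c4 = 8 * c1 + 3 * (1 + K) + 3 * K"
  have w0: "0 < real w" "1 \<le> real w" using w by simp_all
  have p0: "0 < real p" "1 \<le> real p" using p by simp_all
  have Kl: "1 \<le> K * l" using K w0 by linarith
  have K0: "0 < K" using Kl l(1) by (metis less_le_trans zero_less_mult_pos2 zero_less_one)
  have N0: "0 < N" using n p by (simp add: N_def)
  have C0: "0 < C" using C N0 unfolding N_def by (metis less_le_trans zero_less_mult_pos2 zero_less_one)
  have CN: "1 \<le> C * N" using C by (simp add: N_def)
  have a0: "0 < a" using l w0 by (simp add: a_def)
  have al: "a * real w = l" using w0 by (simp add: a_def)
  have Ka: "1 \<le> K * a" using K w0 by (simp add: a_def pos_le_divide_eq)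
  define Z where "Z = N * a"
  have Z0: "0 < Z" using N0 a0 by (simp add: Z_def)
  have aZ: "a \<le> C * Z" using mult_right_mono[OF CN, of a] a0 by (simp add: Z_def)
  \<comment> \<open>Additive constants are charged to \<open>Z\<close>: some PE holds an element,
    hence \<open>1 \<le> C * N\<close>, and \<open>w \<ge> 1\<close> together with the bound on
    \<open>w\<close> gives \<open>1 \<le> K * a\<close>.\<close>
  have oneZ: "1 \<le> C * K * Z"
  proof -
    have "1 \<le> K * a" by (rule Ka)
    also have "\<dots> \<le> K * (C * Z)" using aZ K0 by (intro mult_left_mono) auto
    finally show ?thesis by (simp add: mult_ac)
  qed
  have err_l: "real err \<le> (1 + K) * l" using l(2) Kl by (simp add: algebra_simps)
  have c1: "0 < c1" using K0 by (simp add: c1_def)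
  have c3: "0 < c3" using K0 by (simp add: c3_def)
  have c4: "0 < c4" using K0 c1 by (simp add: c4_def)
  have Lw: "real L * real w \<le> c1 * l"
  proof -
    have "L * w \<le> 2 * (L * hb)" using hb(2) by (simp add: mult.left_commute)
    also have "\<dots> \<le> 2 * err + 2 * w" using L(4) hb(3) by linarith
    finally have "real (L * w) \<le> real (2 * err + 2 * w)" by (simp only: of_nat_le_iff)
    then have "real L * real w \<le> 2 * real err + 2 * real w" by simp
    also have "\<dots> \<le> 2 * ((1 + K) * l) + 2 * (K * l)" using err_l K by linarith
    finally show ?thesis by (simp add: c1_def algebra_simps)
  qed
  then have La: "real L \<le> c1 * a" using w0 by (simp add: a_def pos_le_divide_eq)
  have LZ: "real L \<le> c1 * C * Z"
  proof -
    have "c1 * a \<le> c1 * (C * Z)" using aZ c1 by (intro mult_left_mono) auto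
    then show ?thesis using La by (simp add: mult_ac)
  qed
  have Ja: "real J \<le> 2 * c1 * a" using J(2) La by linarith
  have D_lp: "real D \<le> lp"
  proof -
    have "2 ^ D \<le> real p" using power_floor_log_le by (metis of_nat_le_iff of_nat_numeral of_nat_power)
    then have "log 2 (2 ^ D) \<le> lp" unfolding lp_def using p0 by (subst log_le_cancel_iff) auto
    then show ?thesis by (simp add: log_nat_power)
  qed
  have lp0: "0 \<le> lp" using D_lp by linarith
  define Y where "Y = \<alpha> * lp"
  have lpY: "lp \<le> Y" using mult_right_mono[OF ab(1) lp0] by (simp add: Y_def)
  have Y0: "0 \<le> Y" using lp0 lpY by linarith
  have D1: "real D + 1 \<le> Y + C * K * Z" using D_lp lpY oneZ by linarith
  have steps: "real (2 * (D + NB) + 1) \<le> (real D + 1) * c3"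
  proof -
    have "real (NB * err) \<le> real ((D + 1) * (8 * err + 2 * w))" using NB_le by (simp only: of_nat_le_iff)
    then have "real NB * real err \<le> (real D + 1) * (8 * real err + 2 * real w)"
      by (simp add: algebra_simps)
    also have "\<dots> \<le> (real D + 1) * (8 * real err + 2 * (K * real err))"
    proof -
      have "real w \<le> K * real err" using K mult_left_mono[OF l(3), of K] K0 by linarith
      then show ?thesis by (intro mult_left_mono) auto
    qed
    also have "\<dots> = (real D + 1) * (8 + 2 * K) * real err" by (simp add: algebra_simps)
    finally have "real NB \<le> (real D + 1) * (8 + 2 * K)" using err(1) by simp
    then show ?thesis by (simp add: c3_def algebra_simps)
  qed
  have Dg: "(real D + 1) * real g \<le> 8 * real L + real D + 1"
  proof -
    have "real ((D + 1) * g) \<le> real (8 * L + D + 1)" using D_g_le by (simp only: of_nat_le_iff)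
    then show ?thesis by (simp add: algebra_simps)
  qed
  have Dgb: "(real D + 1) * real (g * b) \<le> c4 * l"
  proof -
    have "real ((D + 1) * g * b) \<le> real (8 * (L * w) + 3 * err + 3 * w)" using D_g_b_le by (simp only: of_nat_le_iff)
    then have "(real D + 1) * real (g * b) \<le> 8 * (real L * real w) + 3 * real err + 3 * real w"
      by (simp add: algebra_simps)
    also have "\<dots> \<le> 8 * (c1 * l) + 3 * ((1 + K) * l) + 3 * (K * l)" using Lw err_l K by linarith
    also have "\<dots> = c4 * l" by (simp add: c4_def algebra_simps)
    finally show ?thesis .
  qed
  have part1: "real (J * (2 * len * (2 * k + 20) + 20) + 10 * D + 130)
     \<le> 2 * c1 * C * (4 * real k + 60) * Z + 10 * Y + 130 * C * K * Z"
  proof -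
    have "real (2 * len * (2 * k + 20) + 20) = real len * (4 * real k + 40) + 20" by (simp add: algebra_simps)
    also have "\<dots> \<le> C * N * (4 * real k + 40) + 20 * (C * N)"
      using len CN by (intro add_mono mult_right_mono) (auto simp: N_def)
    finally have in1: "real (2 * len * (2 * k + 20) + 20) \<le> C * N * (4 * real k + 60)" by (simp add: algebra_simps)
    have "real J * real (2 * len * (2 * k + 20) + 20) \<le> (2 * c1 * a) * (C * N * (4 * real k + 60))"
      using Ja in1 c1 a0 by (intro mult_mono) auto
    also have "\<dots> = 2 * c1 * C * (4 * real k + 60) * Z" by (simp add: Z_def mult_ac)
    finally have "real J * real (2 * len * (2 * k + 20) + 20) \<le> 2 * c1 * C * (4 * real k + 60) * Z" .
    then show ?thesis using D_lp lpY oneZ unfolding of_nat_add of_nat_mult[of J] by simp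
  qed
  have part2: "real (2 * (D + NB) + 1) * real (g * 55 + 75) \<le> c3 * (440 * c1 * C * Z + 130 * (Y + C * K * Z))"
  proof -
    have "real (2 * (D + NB) + 1) * real (g * 55 + 75) \<le> (real D + 1) * c3 * real (g * 55 + 75)"
      using steps by (intro mult_right_mono) auto
    also have "\<dots> = c3 * (55 * ((real D + 1) * real g) + 75 * (real D + 1))" by (simp add: algebra_simps)
    also have "\<dots> \<le> c3 * (55 * (8 * real L + real D + 1) + 75 * (real D + 1))"
      using Dg c3 by (intro mult_left_mono add_mono) auto
    also have "\<dots> = c3 * (440 * real L + 130 * (real D + 1))" by (simp add: algebra_simps)
    also have "\<dots> \<le> c3 * (440 * (c1 * C * Z) + 130 * (Y + C * K * Z))"
    proof (intro mult_left_mono)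
      show "440 * real L + 130 * (real D + 1) \<le> 440 * (c1 * C * Z) + 130 * (Y + C * K * Z)"
        by (rule add_mono) (rule mult_left_mono[OF LZ] mult_left_mono[OF D1], simp)+
    qed (use c3 in simp)
    finally show ?thesis by (simp add: mult_ac)
  qed
  have part3: "real (2 * (D + NB) + 1) * (if p = 1 then 0 else \<alpha> + \<beta> * real (g * b)) \<le> c3 * (2 * Y + c4 * (\<beta> * l))"
  proof (cases "p = 1")
    case True
    then show ?thesis using c3 c4 Y0 ab l by simp
  next
    case False
    then have "2 \<le> real p" using p by simp
    \<comment> \<open>With at least two PEs \<open>lp\<close> is at least 1, so that
      \<open>D + 1\<close> is at most \<open>2 * lp\<close> and the \<alpha> cost of all supersteps
      is absorbed by \<open>Y\<close>. For one PE there is no such cost.\<close>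
    then have "log 2 2 \<le> lp" unfolding lp_def using p0 by (subst log_le_cancel_iff) auto
    then have "1 \<le> lp" by simp
    then have "(real D + 1) * \<alpha> \<le> (2 * lp) * \<alpha>" using D_lp ab by (intro mult_right_mono) auto
    then have Da: "(real D + 1) * \<alpha> \<le> 2 * Y" by (simp add: Y_def mult_ac)
    have Db: "\<beta> * ((real D + 1) * real (g * b)) \<le> \<beta> * (c4 * l)" using Dgb ab by (intro mult_left_mono) auto
    have "0 \<le> \<alpha> + \<beta> * real (g * b)" using ab by simp
    then have "real (2 * (D + NB) + 1) * (\<alpha> + \<beta> * real (g * b)) \<le> (real D + 1) * c3 * (\<alpha> + \<beta> * real (g * b))"
      using steps by (rule mult_right_mono[rotated])
    also have "\<dots> = c3 * ((real D + 1) * \<alpha> + \<beta> * ((real D + 1) * real (g * b)))" by (simp add: algebra_simps)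
    also have "\<dots> \<le> c3 * (2 * Y + \<beta> * (c4 * l))" using add_mono[OF Da Db] c3 by (intro mult_left_mono) auto
    finally show ?thesis using False by (simp add: mult_ac)
  qed
  define cN cB cY where "cN = 2 * c1 * C * (4 * real k + 60) + 130 * C * K + c3 * (440 * c1 * C + 130 * C * K)"
    and "cB = c3 * c4" and "cY = 10 + 132 * c3"
  have pos: "0 \<le> cN" "0 \<le> cB" "0 \<le> cY" using c1 c3 c4 C0 K0 by (simp_all add: cN_def cB_def cY_def)
  have tc: "time_const k C K = cN + cB + cY"
    by (simp add: time_const_def Let_def cN_def cB_def cY_def c4_def c1_def c3_def)
  have bl: "0 \<le> \<beta> * l" using ab l by simp
  have "real (J * (2 * len * (2 * k + 20) + 20) + 10 * D + 130)
      + real (2 * (D + NB) + 1) * (real (g * 55 + 75) + (if p = 1 then 0 else \<alpha> + \<beta> * real (g * b)))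
    \<le> (2 * c1 * C * (4 * real k + 60) * Z + 10 * Y + 130 * C * K * Z)
      + (c3 * (440 * c1 * C * Z + 130 * (Y + C * K * Z)) + c3 * (2 * Y + c4 * (\<beta> * l)))"
    unfolding distrib_left[of "real (2 * (D + NB) + 1)"] using part1 part2 part3 by linarith
  also have "\<dots> = cN * Z + cB * (\<beta> * l) + cY * Y" by (simp add: cN_def cB_def cY_def algebra_simps)
  also have "\<dots> \<le> (cN + cB + cY) * Z + (cN + cB + cY) * (\<beta> * l) + (cN + cB + cY) * Y"
    using pos Z0 Y0 bl by (intro add_mono mult_right_mono) auto
  also have "\<dots> = time_const k C K * (Z + \<beta> * l + Y)" by (simp add: tc algebra_simps)
  also have "Z + \<beta> * l + Y = (real n / (real p * real w) + \<beta>) * l + \<alpha> * log 2 (real p)"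
    by (simp add: Z_def N_def a_def Y_def lp_def algebra_simps)
  finally show ?thesis .
qed


subsection \<open>The error probability\<close>

lemma finite_elements: "finite (elements w k)"
proof -
  have "elements w k = {xs. set xs \<subseteq> {..<2 ^ w} \<and> length xs = k}" by (auto simp: elements_def)
  then show ?thesis using finite_lists_length_eq[of "{..<2 ^ w} :: nat set" k] by simp
qed

lemma random_hash_less:
  assumes "h \<in> set_pmf (random_hash w k)" "j < 2 ^ w" "x \<in> elements w k"
  shows "h (j, x) < 2 ^ w"
proof -
  have fin: "finite ({..<2 ^ w} \<times> elements w k :: (nat \<times> nat list) set)" using finite_elements by simp
  have "set_pmf (pmf_of_set {..<2 ^ w :: nat}) = {..<2 ^ w}"
    by (rule set_pmf_of_set) (auto simp: lessThan_empty_iff)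
  then show ?thesis using assms unfolding random_hash_def set_Pi_pmf[OF fin]
    by (fastforce simp: PiE_dflt_def)
qed

text \<open>An affine equation with different slopes has at most one solution \<open>z\<close>, as
  is seen over the integers. Halving makes \<open>y div 2 ^ m = z\<close> hold on an interval of
  \<open>2 ^ m\<close> values of \<open>y\<close>, whence the numerator.\<close>

lemma prob_affine_collision:
  fixes c d r s :: nat and m w :: nat
  assumes "c \<noteq> d"
  shows "measure_pmf.prob (pmf_of_set {..<2 ^ w}) {y :: nat. c * (y div 2 ^ m) + r = d * (y div 2 ^ m) + s}
    \<le> 2 ^ m / 2 ^ w"
proof -
  let ?E = "{y :: nat. c * (y div 2 ^ m) + r = d * (y div 2 ^ m) + s}"
  have uniq: "z = z'" if "c * z + r = d * z + s" "c * z' + r = d * z' + s" for z z' :: nat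
  proof -
    have "int c * int z + int r = int d * int z + int s" "int c * int z' + int r = int d * int z' + int s"
      using that by (metis of_nat_add of_nat_mult)+
    then have "(int c - int d) * (int z - int z') = 0" by (simp add: algebra_simps)
    then show ?thesis using assms by simp
  qed
  have sub: "\<exists>z. ?E \<subseteq> {z * 2 ^ m..<z * 2 ^ m + 2 ^ m}"
  proof (cases "?E = {}")
    case False
    then obtain y where y: "y \<in> ?E" by blast
    have "x \<in> {y div 2 ^ m * 2 ^ m..<y div 2 ^ m * 2 ^ m + 2 ^ m}" if "x \<in> ?E" for x
    proof -
      have "x div 2 ^ m = y div 2 ^ m" using uniq[of "x div 2 ^ m" "y div 2 ^ m"] that y by simp
      then show ?thesis using div_mult_mod_eq[of x "2 ^ m"] by (metis atLeastLessThan_iff le_add1 mod_less_divisor nat_add_left_cancel_less zero_less_numeral zero_less_power)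
    qed
    then show ?thesis by blast
  qed auto
  then obtain z where z: "?E \<subseteq> {z * 2 ^ m..<z * 2 ^ m + 2 ^ m}" by blast
  have "card ({..<2 ^ w} \<inter> ?E) \<le> card {z * 2 ^ m..<z * 2 ^ m + (2 ^ m :: nat)}"
    using z by (intro card_mono) auto
  then have "card ({..<2 ^ w} \<inter> ?E) \<le> 2 ^ m" by simp
  then have "real (card ({..<2 ^ w} \<inter> ?E)) \<le> real (2 ^ m)" by (simp only: of_nat_le_iff)
  then show ?thesis by (subst measure_pmf_of_set) (auto simp: lessThan_empty_iff intro!: divide_right_mono)
qed

lemma sum_mset_split: "(\<Sum>x\<in>#M. f x) = count M y * f y + (\<Sum>x\<in>#filter_mset (\<lambda>x. x \<noteq> y) M. f x)"
  for f :: "'a \<Rightarrow> nat"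
  by (induction M) auto

text \<open>Let \<open>y\<close> be an element with different multiplicities. All hash values except
  those of \<open>y\<close> under the first \<open>J\<close> functions are fixed; each of the
  \<open>J\<close> equations then restricts one remaining coordinate, and these are independent, so
  the probabilities multiply. \<open>J \<le> 2 ^ w\<close> guarantees that the coordinates exist in
  the family.\<close>

lemma prob_collision:
  assumes ne: "A \<noteq> B" and el: "set_mset A \<subseteq> elements w k" "set_mset B \<subseteq> elements w k" and J: "J \<le> 2 ^ w"
  shows "measure_pmf.prob (random_hash w k)
     {h. \<forall>j<J. (\<Sum>x\<in>#A. h (j, x) div 2 ^ m) = (\<Sum>x\<in>#B. h (j, x) div 2 ^ m)} \<le> (2 ^ m / 2 ^ w) ^ J"
    (is "measure_pmf.prob _ ?E \<le> _")
proof -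
  obtain y where y: "count A y \<noteq> count B y" using ne by (meson multiset_eqI)
  then have "y \<in># A \<or> y \<in># B" by (metis count_inI)
  then have yel: "y \<in> elements w k" using el by blast
  let ?U = "pmf_of_set {..<2 ^ w :: nat}"
  define I where "I = {..<J} \<times> {y}"
  define R where "R = {..<2 ^ w} \<times> elements w k - I"
  have fin: "finite I" "finite R" using finite_elements by (simp_all add: I_def R_def)
  have un: "{..<2 ^ w} \<times> elements w k = R \<union> I" using J yel by (auto simp: I_def R_def)
  have dj: "R \<inter> I = {}" by (auto simp: R_def)
  \<comment> \<open>Sampling in two stages: \<open>f\<close> fixes the coordinates in
    \<open>R\<close>, then \<open>g\<close> the hash values of \<open>y\<close>.\<close>
  have rh: "random_hash w k = Pi_pmf R 0 (\<lambda>_. ?U) \<bind> (\<lambda>f. map_pmf (\<lambda>g x. if x \<in> R then f x else g x) (Pi_pmf I 0 (\<lambda>_. ?U)))"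
    unfolding random_hash_def un Pi_pmf_union[OF fin(2,1) dj]
    by (simp add: pair_pmf_def map_pmf_def bind_assoc_pmf bind_return_pmf)
  have bound: "measure_pmf.prob (map_pmf (\<lambda>g x. if x \<in> R then f x else g x) (Pi_pmf I 0 (\<lambda>_. ?U))) ?E
      \<le> (2 ^ m / 2 ^ w) ^ J" for f
  proof -
    define ra where "ra j = (\<Sum>x\<in>#filter_mset (\<lambda>x. x \<noteq> y) A. f (j, x) div 2 ^ m)" for j
    define rb where "rb j = (\<Sum>x\<in>#filter_mset (\<lambda>x. x \<noteq> y) B. f (j, x) div 2 ^ m)" for j
    \<comment> \<open>The values of the coordinate \<open>ix\<close> for which its own equation
      holds; \<open>f\<close> enters through the constants \<open>ra\<close> and \<open>rb\<close>
      only.\<close>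
    define Q where "Q ix = {z :: nat. count A y * (z div 2 ^ m) + ra (fst ix) = count B y * (z div 2 ^ m) + rb (fst ix)}"
      for ix :: "nat \<times> nat list"
    have "(\<lambda>g x. if x \<in> R then f x else g x) -` ?E \<subseteq> Pi I Q"
    proof
      fix g assume g: "g \<in> (\<lambda>g x. if x \<in> R then f x else g x) -` ?E"
      show "g \<in> Pi I Q"
      proof
        fix ix assume "ix \<in> I"
        then obtain j where j: "ix = (j, y)" "j < J" by (auto simp: I_def)
        let ?h = "\<lambda>x. if x \<in> R then f x else g x"
        have eq: "(\<Sum>x\<in>#A. ?h (j, x) div 2 ^ m) = (\<Sum>x\<in>#B. ?h (j, x) div 2 ^ m)" using g j by simp
        have hy: "?h (j, y) = g ix" using j by (simp add: R_def I_def)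
        have other: "(\<Sum>x\<in>#filter_mset (\<lambda>x. x \<noteq> y) M. ?h (j, x) div 2 ^ m) = (\<Sum>x\<in>#filter_mset (\<lambda>x. x \<noteq> y) M. f (j, x) div 2 ^ m)"
          if "set_mset M \<subseteq> elements w k" for M
        proof (rule arg_cong[of _ _ sum_mset], rule image_mset_cong)
          fix x assume "x \<in># filter_mset (\<lambda>x. x \<noteq> y) M"
          then have "(j, x) \<in> R" using that j J by (auto simp: R_def I_def)
          then show "?h (j, x) div 2 ^ m = f (j, x) div 2 ^ m" by simp
        qed
        show "g ix \<in> Q ix"
          using eq unfolding sum_mset_split[of _ A y] sum_mset_split[of _ B y] other[OF el(1)] other[OF el(2)] hy
          by (simp add: Q_def ra_def rb_def j)
      qed
    qed
    then have "measure_pmf.prob (map_pmf (\<lambda>g x. if x \<in> R then f x else g x) (Pi_pmf I 0 (\<lambda>_. ?U))) ?E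
        \<le> measure_pmf.prob (Pi_pmf I 0 (\<lambda>_. ?U)) (Pi I Q)"
      unfolding measure_map_pmf by (intro measure_pmf.finite_measure_mono) auto
    also have "\<dots> = (\<Prod>x\<in>I. measure_pmf.prob ?U (Q x))" by (rule measure_Pi_pmf_Pi) (rule fin)
    also have "\<dots> \<le> (\<Prod>x\<in>I. 2 ^ m / 2 ^ w)"
      using prob_affine_collision[OF y] by (intro prod_mono) (auto simp: Q_def)
    also have "\<dots> = (2 ^ m / 2 ^ w) ^ J" by (simp add: I_def)
    finally show ?thesis .
  qed
  let ?c = "(2 ^ m / 2 ^ w :: real) ^ J"
  have "emeasure (measure_pmf (random_hash w k)) ?E \<le> ennreal ?c"
  proof -
    have "emeasure (measure_pmf (random_hash w k)) ?E =
       (\<integral>\<^sup>+ f. emeasure (measure_pmf (map_pmf (\<lambda>g x. if x \<in> R then f x else g x) (Pi_pmf I 0 (\<lambda>_. ?U)))) ?E \<partial>measure_pmf (Pi_pmf R 0 (\<lambda>_. ?U)))"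
      unfolding rh by (rule emeasure_bind_pmf)
    also have "\<dots> \<le> (\<integral>\<^sup>+ f. ennreal ?c \<partial>measure_pmf (Pi_pmf R 0 (\<lambda>_. ?U)))"
    proof (rule nn_integral_mono)
      fix f
      show "emeasure (measure_pmf (map_pmf (\<lambda>g x. if x \<in> R then f x else g x) (Pi_pmf I 0 (\<lambda>_. ?U)))) ?E \<le> ennreal ?c"
        unfolding measure_pmf.emeasure_eq_measure by (rule ennreal_leI) (rule bound)
    qed
    also have "\<dots> = ennreal ?c" by simp
    finally show ?thesis .
  qed
  then show ?thesis unfolding measure_pmf.emeasure_eq_measure by (simp add: ennreal_le_iff)
qed

text \<open>A hash value has \<open>hb = w - sh\<close> useful bits, so one function misses a
  difference with probability at most \<open>1 / 2 ^ hb\<close>; and \<open>hb * J\<close> is at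
  least \<open>err\<close>.\<close>

lemma (in params) collision_le:
  assumes "0 < \<delta>" "log 2 (1 / \<delta>) \<le> real err"
  shows "(2 ^ sh / 2 ^ w) ^ J \<le> \<delta>"
proof -
  have "sh \<le> w" using w by (simp add: sh_def)
  then have "(2 ^ sh / 2 ^ w :: real) = 1 / 2 ^ hb" by (simp add: hb_def power_diff)
  then have "(2 ^ sh / 2 ^ w :: real) ^ J = 1 / 2 ^ (hb * J)" by (simp add: power_one_over power_mult power_divide)
  moreover have "1 / \<delta> \<le> 2 ^ (hb * J)"
  proof -
    have "err \<le> hb * J" using L(3) J(1) by (meson le_trans mult_le_mono2)
    then have "log 2 (1 / \<delta>) \<le> real (hb * J)" using assms(2) by (meson le_trans of_nat_mono order_trans)
    then have "1 / \<delta> \<le> 2 powr real (hb * J)" using assms(1) by (subst (asm) log_le_iff) auto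
    then show ?thesis by (simp only: powr_realpow zero_less_numeral)
  qed
  ultimately show ?thesis using assms(1) by (simp add: field_simps)
qed

theorem theorem2:
  fixes k :: nat
  shows "\<exists>prog. \<forall>C K :: real. \<exists>c :: real. \<forall>(w::nat) (p::nat) (n::nat) (\<delta>::real) (\<alpha>::real) (\<beta>::real) as bs la lb.
    1 \<le> w \<longrightarrow> 1 \<le> p \<longrightarrow> p < 2 ^ w \<longrightarrow> 1 \<le> n \<longrightarrow> n < 2 ^ w \<longrightarrow>
    0 < \<delta> \<longrightarrow> \<delta> < 1 \<longrightarrow> \<lceil>log 2 (1 / \<delta>)\<rceil> < 2 ^ w \<longrightarrow> real w \<le> K * log 2 (1 / \<delta>) \<longrightarrow>
    1 \<le> \<alpha> \<longrightarrow> 0 \<le> \<beta> \<longrightarrow>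
    length as = n \<longrightarrow> length bs = n \<longrightarrow>
    set as \<subseteq> elements w k \<longrightarrow> set bs \<subseteq> elements w k \<longrightarrow>
    well_distributed C p as la \<longrightarrow> well_distributed C p bs lb \<longrightarrow>
      (\<forall>h \<in> set_pmf (random_hash w k). \<exists>T S.
         run w h prog \<alpha> \<beta> p (init w p n \<delta> la lb) T S \<and>
         T \<le> c * ((real n / (real p * real w) + \<beta>) * log 2 (1 / \<delta>) + \<alpha> * log 2 (real p)) \<and>
         (mset bs = mset as \<longrightarrow> accepting S)) \<and>
      (mset bs \<noteq> mset as \<longrightarrow>
         measure_pmf.prob (random_hash w k)
           {h. \<exists>T S. run w h prog \<alpha> \<beta> p (init w p n \<delta> la lb) T S \<and> \<not> accepting S} \<ge> 1 - \<delta>)"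
proof (intro exI[of _ "checker k"] allI)
  fix C K :: real
  show "\<exists>c :: real. \<forall>(w::nat) (p::nat) (n::nat) (\<delta>::real) (\<alpha>::real) (\<beta>::real) as bs la lb.
    1 \<le> w \<longrightarrow> 1 \<le> p \<longrightarrow> p < 2 ^ w \<longrightarrow> 1 \<le> n \<longrightarrow> n < 2 ^ w \<longrightarrow>
    0 < \<delta> \<longrightarrow> \<delta> < 1 \<longrightarrow> \<lceil>log 2 (1 / \<delta>)\<rceil> < 2 ^ w \<longrightarrow> real w \<le> K * log 2 (1 / \<delta>) \<longrightarrow>
    1 \<le> \<alpha> \<longrightarrow> 0 \<le> \<beta> \<longrightarrow>
    length as = n \<longrightarrow> length bs = n \<longrightarrow>
    set as \<subseteq> elements w k \<longrightarrow> set bs \<subseteq> elements w k \<longrightarrow>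
    well_distributed C p as la \<longrightarrow> well_distributed C p bs lb \<longrightarrow>
      (\<forall>h \<in> set_pmf (random_hash w k). \<exists>T S.
         run w h (checker k) \<alpha> \<beta> p (init w p n \<delta> la lb) T S \<and>
         T \<le> c * ((real n / (real p * real w) + \<beta>) * log 2 (1 / \<delta>) + \<alpha> * log 2 (real p)) \<and>
         (mset bs = mset as \<longrightarrow> accepting S)) \<and>
      (mset bs \<noteq> mset as \<longrightarrow>
         measure_pmf.prob (random_hash w k)
           {h. \<exists>T S. run w h (checker k) \<alpha> \<beta> p (init w p n \<delta> la lb) T S \<and> \<not> accepting S} \<ge> 1 - \<delta>)"
  proof (intro exI[of _ "time_const k C K"] allI impI)
    fix w p n :: nat and \<delta> \<alpha> \<beta> :: real and as bs :: "nat list list" and la lb :: "nat \<Rightarrow> nat list list"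
    assume w: "1 \<le> w" and p: "1 \<le> p" "p < 2 ^ w" and n: "1 \<le> n" "n < 2 ^ w" and \<delta>: "0 < \<delta>" "\<delta> < 1"
      and ceil: "\<lceil>log 2 (1 / \<delta>)\<rceil> < 2 ^ w" and K: "real w \<le> K * log 2 (1 / \<delta>)"
      and ab: "1 \<le> \<alpha>" "0 \<le> \<beta>" and len: "length as = n" "length bs = n"
      and el: "set as \<subseteq> elements w k" "set bs \<subseteq> elements w k"
      and wd: "well_distributed C p as la" "well_distributed C p bs lb"
    define l where "l = log 2 (1 / \<delta>)"
    define err where "err = nat \<lceil>l\<rceil>"
    have l0: "0 < l" using \<delta> by (simp add: l_def)
    have errl: "real err = of_int \<lceil>l\<rceil>" using l0 by (simp add: err_def)
    have eb: "1 \<le> err" "err < 2 ^ w" "l \<le> real err" "real err \<le> l + 1"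
    proof -
      show "1 \<le> err" using l0 by (simp add: err_def Suc_le_eq)
      show "err < 2 ^ w" using ceil unfolding err_def l_def[symmetric] by (simp add: nat_less_iff)
      show "l \<le> real err" "real err \<le> l + 1" unfolding errl by linarith+
    qed
    \<comment> \<open>\<open>J\<close>, \<open>sh\<close> and the other parameters are needed
      independently of the hash functions, in order to state the collision event;
      \<open>problem\<close> is interpreted later for each \<open>h\<close>.\<close>
    interpret params w p n err by unfold_locales (use w p n eb in auto)
    have ma: "mset as = (\<Sum>i<p. mset (la i))" and mb: "mset bs = (\<Sum>i<p. mset (lb i))"
      and la_len: "\<And>i. i < p \<Longrightarrow> real (length (la i)) \<le> C * (real n / real p)"
      and lb_len: "\<And>i. i < p \<Longrightarrow> real (length (lb i)) \<le> C * (real n / real p)"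
      using wd len by (auto simp: well_distributed_def)
    have sizes: "(\<Sum>i<p. length (la i)) = n" "(\<Sum>i<p. length (lb i)) = n"
      using arg_cong[OF ma, of size] arg_cong[OF mb, of size] len by simp_all
    have sub: "set (la i) \<subseteq> elements w k" "set (lb i) \<subseteq> elements w k" if i: "i < p" for i
    proof -
      have "mset (la i) \<subseteq># mset as" "mset (lb i) \<subseteq># mset bs" unfolding ma mb
        using i by (simp_all add: sum.remove[of "{..<p}" i])
      then have "set_mset (mset (la i)) \<subseteq> set_mset (mset as)" "set_mset (mset (lb i)) \<subseteq> set_mset (mset bs)"
        by (simp_all only: set_mset_mono)
      then show "set (la i) \<subseteq> elements w k" "set (lb i) \<subseteq> elements w k" using el by auto
    qed
    obtain i0 where i0: "i0 < p" "1 \<le> length (la i0)"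
    proof -
      have "\<not> (\<forall>i<p. length (la i) = 0)" using sizes(1) n(1) by (metis lessThan_iff not_one_le_zero sum.neutral)
      then show ?thesis using that by (auto simp: Suc_le_eq)
    qed
    \<comment> \<open>The largest local length in either sequence, because a superstep is as slow as
      its slowest PE.\<close>
    define Lm where "Lm = Max ((\<lambda>i. max (length (la i)) (length (lb i))) ` {..<p})"
    have fin: "finite ((\<lambda>i. max (length (la i)) (length (lb i))) ` {..<p})" "(\<lambda>i. max (length (la i)) (length (lb i))) ` {..<p} \<noteq> {}"
      using p by (auto simp: lessThan_empty_iff)
    have Lm_ge: "length (la i) \<le> Lm" "length (lb i) \<le> Lm" if "i < p" for i
    proof -
      have "max (length (la i)) (length (lb i)) \<le> Lm" unfolding Lm_def using fin that by (intro Max_ge) auto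
      then show "length (la i) \<le> Lm" "length (lb i) \<le> Lm" by simp_all
    qed
    have Lm_le: "real Lm \<le> C * (real n / real p)"
    proof -
      have "Lm \<in> (\<lambda>i. max (length (la i)) (length (lb i))) ` {..<p}" unfolding Lm_def using fin by (rule Max_in)
      then show ?thesis using la_len lb_len by (auto simp: max_def)
    qed
    \<comment> \<open>The PE \<open>i0\<close> is not empty, so \<open>C * n / p\<close> bounds a
      length that is at least 1. This is what allows rounding and constants to be charged to
      \<open>n / p\<close>.\<close>
    have CN: "1 \<le> C * (real n / real p)" using la_len[OF i0(1)] i0(2) by linarith
    have prob: "problem w p n err k h la lb \<delta>" if h: "h \<in> set_pmf (random_hash w k)" for h
      by unfold_locales (use random_hash_less[OF h] sizes sub in \<open>auto simp: err_def l_def\<close>)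
    \<comment> \<open>Time bound and acceptance criterion for a fixed hash family; completeness and
      the error bound are both read off from the equivalence.\<close>
    have main: "\<exists>T S. run w h (checker k) \<alpha> \<beta> p (init w p n \<delta> la lb) T S \<and>
         T \<le> time_const k C K * ((real n / (real p * real w) + \<beta>) * log 2 (1 / \<delta>) + \<alpha> * log 2 (real p)) \<and>
         (accepting S \<longleftrightarrow> (\<forall>j<J. (\<Sum>x\<in>#mset as. h (j, x) div 2 ^ sh) = (\<Sum>x\<in>#mset bs. h (j, x) div 2 ^ sh)))"
      if h: "h \<in> set_pmf (random_hash w k)" for h
    proof -
      interpret problem w p n err k h la lb \<delta> by (rule prob[OF h])
      have IT: "init_time i \<le> J * (2 * Lm * (2 * k + 20) + 20) + 10 * D + 130" if i: "i < p" for i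
      proof -
        have "(length (la i) + length (lb i)) * (2 * k + 20) \<le> 2 * Lm * (2 * k + 20)"
          using Lm_ge[OF i] by (intro mult_le_mono1) simp
        then show ?thesis unfolding init_time_def by (intro add_mono mult_le_mono2 order_refl) simp
      qed
      obtain T S' where r: "run w h (checker k) \<alpha> \<beta> p (init w p n \<delta> la lb) T S'"
        "T \<le> real (J * (2 * Lm * (2 * k + 20) + 20) + 10 * D + 130) + real (2 * (D + NB) + 1) * (real step_time + comm \<alpha> \<beta>)"
        "accepting S' \<longleftrightarrow> verdict"
        using run_checker[of \<alpha> \<beta>, OF _ _ IT] ab by auto
      have "T \<le> time_const k C K * ((real n / (real p * real w) + \<beta>) * l + \<alpha> * log 2 (real p))"
        using r(2) time_bound[OF l0 eb(4,3) K[folded l_def] CN ab Lm_le, of k] unfolding step_time_def comm_def by linarith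
      then show ?thesis using r(1,3) verdict_eq_sums[OF ma mb len el] unfolding l_def hv_def by blast
    qed
    show "(\<forall>h \<in> set_pmf (random_hash w k). \<exists>T S.
         run w h (checker k) \<alpha> \<beta> p (init w p n \<delta> la lb) T S \<and>
         T \<le> time_const k C K * ((real n / (real p * real w) + \<beta>) * log 2 (1 / \<delta>) + \<alpha> * log 2 (real p)) \<and>
         (mset bs = mset as \<longrightarrow> accepting S)) \<and>
      (mset bs \<noteq> mset as \<longrightarrow>
         measure_pmf.prob (random_hash w k)
           {h. \<exists>T S. run w h (checker k) \<alpha> \<beta> p (init w p n \<delta> la lb) T S \<and> \<not> accepting S} \<ge> 1 - \<delta>)"
    proof (intro conjI ballI impI)
      fix h assume h: "h \<in> set_pmf (random_hash w k)"
      show "\<exists>T S. run w h (checker k) \<alpha> \<beta> p (init w p n \<delta> la lb) T S \<and>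
         T \<le> time_const k C K * ((real n / (real p * real w) + \<beta>) * log 2 (1 / \<delta>) + \<alpha> * log 2 (real p)) \<and>
         (mset bs = mset as \<longrightarrow> accepting S)"
        using main[OF h] by fastforce
    next
      assume ne: "mset bs \<noteq> mset as"
      let ?P = "random_hash w k"
      let ?E = "{h. \<forall>j<J. (\<Sum>x\<in>#mset as. h (j, x) div 2 ^ sh) = (\<Sum>x\<in>#mset bs. h (j, x) div 2 ^ sh)}"
      let ?R = "{h. \<exists>T S. run w h (checker k) \<alpha> \<beta> p (init w p n \<delta> la lb) T S \<and> \<not> accepting S}"
      have "measure_pmf.prob ?P ?E \<le> (2 ^ sh / 2 ^ w) ^ J"
        by (rule prob_collision) (use ne el J_less in auto)
      also have "\<dots> \<le> \<delta>" using collision_le[OF \<delta>(1)] eb(3) by (simp add: l_def)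
      finally have "1 - \<delta> \<le> measure_pmf.prob ?P (- ?E)"
        using measure_pmf.prob_compl[of ?E ?P] by (simp add: Compl_eq_Diff_UNIV)
      \<comment> \<open>Runs have been constructed for hash families in the support only, and
        families outside it have probability 0.\<close>
      also have "\<dots> = measure_pmf.prob ?P (- ?E \<inter> set_pmf ?P)" by (simp add: measure_Int_set_pmf)
      also have "\<dots> \<le> measure_pmf.prob ?P ?R"
      proof (rule measure_pmf.finite_measure_mono)
        show "- ?E \<inter> set_pmf ?P \<subseteq> ?R" using main by fastforce
      qed simp
      finally show "1 - \<delta> \<le> measure_pmf.prob ?P ?R" .
    qed
  qed
qed

end
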